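(* Let $E$ be a unital commutative Fréchet ${}^*$-algebra which is isomorphic as a Fréchet space to a nuclear power series space $\Lambda_\infty(\alpha)$ of infinite type. Then the following statements are equivalent. (i) $E$ is isomorphic as a Fréchet ${}^*$-algebra to a complemented ${}^*$-subalgebra $F$ of $\mathscr{L}^*(s)$ such that $F\subset\mathscr{L}(\ell_2)$. (ii) $E$ is isomorphic as a Fréchet ${}^*$-algebra to a closed ${}^*$-subalgebra $F$ of $\mathscr{L}^*(s)$ such that $F\subset\mathscr{L}(\ell_2)$. (iii) $E$ is a $\beta$DN-algebra, i.e. there is a dominating Hilbert norm $\|\cdot\|=\sqrt{(\cdot,\cdot)}$ on $E$ such that $(xy,z)=(y,x^*z)$ for all $x,y,z\in E$ and such that for every $x\in E$ there is $C>0$ with $\|xy\|\le C\|y\|$ for all $y\in E$.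
   Context: All spaces are over $\mathbb{C}$. A topological ${}^*$-algebra is a topological vector space that is a ${}^*$-algebra with separately continuous multiplication and continuous involution; a Fréchet ${}^*$-algebra is a topological ${}^*$-algebra whose underlying space is a Fréchet space (metrizable, complete, locally convex; local $m$-convexity is not required). An isomorphism of Fréchet (topological) ${}^*$-algebras is a ${}^*$-algebra isomorphism that is a homeomorphism; a subalgebra carries the subspace topology. Power series spaces: for a monotonically increasing sequence $\alpha=(\alpha_j)_{j\in\mathbb{N}}\subset(0,\infty)$ with $\alpha_j\to\infty$, $\Lambda_\infty(\alpha)=\{(\xi_j)\in\mathbb{C}^{\mathbb{N}}:|\xi|_{\alpha,q}^2=\sum_j|\xi_j|^2e^{2q\alpha_j}<\infty\text{ for all }q\in\mathbb{N}_0\}$, with the Fréchet topology given by the norms $|\cdot|_{\alpha,q}$. It is nuclear if and only if $\sup_j \frac{\log j}{\alpha_j}<\infty$. Dominating norm: let $E$ be a Fréchet space with an (increasing) fundamental system of seminorms $(\|\cdot\|_q)_{q\in\mathbb{N}_0}$. A continuous norm $\|\cdot\|$ on $E$ is dominating if for every $q$ there are $r\in\mathbb{N}_0$ and $C>0$ with $\|x\|_q^2\le C\|x\|\,\|x\|_r$ for all $x\in E$. It is a dominating Hilbert norm if moreover $\|\cdot\|=\sqrt{(\cdot,\cdot)}$ for a scalar product $(\cdot,\cdot)$ on $E$. The algebra $\mathscr{L}^*(s)$: $s=\{\xi\in\mathbb{C}^{\mathbb{N}}:|\xi|_q^2=\sum_j|\xi_j|^2j^{2q}<\infty\text{ for all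 }q\in\mathbb{N}_0\}$ with the Fréchet topology given by the norms $|\cdot|_q$; it is a dense subspace of $\ell_2$. $\mathscr{L}^*(s)$ is the set of all linear maps $x\colon s\to s$ such that, regarding $x$ as an unbounded operator in $\ell_2$ with domain $s$, its Hilbert space adjoint $x^*$ satisfies $s\subset\mathscr{D}(x^* )$ and $x^*(s)\subset s$. It is a ${}^*$-algebra under composition with involution $x\mapsto x^*|_s$ (again written $x^*$). Its topology $\tau^*$ is the locally convex topology given by the seminorms $p_{N,B}(x)=\max\{\sup_{\xi\in B}|x\xi|_N,\sup_{\xi\in B}|x^*\xi|_N\}$, where $N\in\mathbb{N}_0$ and $B$ runs over the bounded subsets of $s$. A ${}^*$-subalgebra of $\mathscr{L}^*(s)$ is complemented if it is the range of a continuous linear projection on $\mathscr{L}^*(s)$. The notation $F\subset\mathscr{L}(\ell_2)$ means that every $x\in F$ extends to a bounded operator on $\ell_2$. *)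

theory Defs
  imports "HOL-Analysis.Analysis" "HOL-Library.Function_Algebras"
begin

text \<open>
  A complex vector space is a linear subspace \<open>V\<close> of a type of class \<open>ab_group_add\<close>, together with
  a scalar multiplication \<open>sc :: complex \<Rightarrow> 'a \<Rightarrow> 'a\<close> satisfying the library locale \<open>vector_space\<close>.
  Topologies are values of type \<open>'a topology\<close> with \<open>topspace\<close> equal to \<open>V\<close>.
\<close>

section \<open>Locally convex spaces\<close>

definition linear_map_on ::
  "(complex \<Rightarrow> 'a \<Rightarrow> 'a) \<Rightarrow> (complex \<Rightarrow> 'b \<Rightarrow> 'b) \<Rightarrow> 'a::ab_group_add set \<Rightarrow> ('a \<Rightarrow> 'b::ab_group_add) \<Rightarrow> bool"
  where "linear_map_on sc1 sc2 V f \<longleftrightarrow>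
    (\<forall>x\<in>V. \<forall>y\<in>V. f (x + y) = f x + f y) \<and> (\<forall>c. \<forall>x\<in>V. f (sc1 c x) = sc2 c (f x))"

definition seminorm_on :: "(complex \<Rightarrow> 'a \<Rightarrow> 'a) \<Rightarrow> 'a::ab_group_add set \<Rightarrow> ('a \<Rightarrow> real) \<Rightarrow> bool"
  where "seminorm_on sc V p \<longleftrightarrow>
    (\<forall>x\<in>V. 0 \<le> p x) \<and>
    (\<forall>c. \<forall>x\<in>V. p (sc c x) = cmod c * p x) \<and>
    (\<forall>x\<in>V. \<forall>y\<in>V. p (x + y) \<le> p x + p y)"

definition seminorm_topology :: "'a::ab_group_add set \<Rightarrow> ('a \<Rightarrow> real) set \<Rightarrow> 'a topology"
  where "seminorm_topology V P =
    topology_generated_by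
      (insert V {{y \<in> V. p (y - x) < \<epsilon>} | p x \<epsilon>. p \<in> P \<and> x \<in> V \<and> 0 < \<epsilon>})"

lemma topspace_seminorm_topology [simp]: "topspace (seminorm_topology V P) = V"
  unfolding seminorm_topology_def topology_generated_by_topspace by blast

definition locally_convex_space ::
  "(complex \<Rightarrow> 'a \<Rightarrow> 'a) \<Rightarrow> 'a::ab_group_add set \<Rightarrow> 'a topology \<Rightarrow> bool"
  where "locally_convex_space sc V T \<longleftrightarrow>
    vector_space sc \<and> module.subspace sc V \<and>
    (\<exists>P. (\<forall>p\<in>P. seminorm_on sc V p) \<and> T = seminorm_topology V P)"

text \<open>In a metrizable topological vector space, completeness is the convergence of all Cauchy
  sequences.\<close>

definition frechet_space ::
  "(complex \<Rightarrow> 'a \<Rightarrow> 'a) \<Rightarrow> 'a::ab_group_add set \<Rightarrow> 'a topology \<Rightarrow> bool"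
  where "frechet_space sc V T \<longleftrightarrow>
    locally_convex_space sc V T \<and> metrizable_space T \<and>
    (\<forall>X. range X \<subseteq> V \<longrightarrow>
      (\<forall>U. openin T U \<and> 0 \<in> U \<longrightarrow> (\<exists>N. \<forall>m\<ge>N. \<forall>n\<ge>N. X m - X n \<in> U)) \<longrightarrow>
      (\<exists>l. limitin T X l sequentially))"

text \<open>
  A locally convex space is nuclear if for every continuous seminorm \<open>p\<close> there is a continuous
  seminorm \<open>q \<ge> p\<close> such that the canonical map between the local Banach spaces of \<open>q\<close> and \<open>p\<close> is
  nuclear, i.e. is a series of rank-one maps \<open>f n \<otimes> y n\<close> with summable product of norms. Here \<open>c n\<close>
  bounds the \<open>q\<close>-dual norm of \<open>f n\<close>. The \<open>y n\<close> are taken in \<open>V\<close> itself instead of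
  in the completion with respect to \<open>p\<close>: every element of the completion is an absolutely
  convergent series of elements of the dense subspace, with sum of norms as close to its norm as one
  likes, so both forms agree.
\<close>

definition nuclear_space ::
  "(complex \<Rightarrow> 'a \<Rightarrow> 'a) \<Rightarrow> 'a::ab_group_add set \<Rightarrow> 'a topology \<Rightarrow> bool"
  where "nuclear_space sc V T \<longleftrightarrow>
    locally_convex_space sc V T \<and>
    (\<forall>p. seminorm_on sc V p \<and> continuous_map T euclideanreal p \<longrightarrow>
      (\<exists>q. seminorm_on sc V q \<and> continuous_map T euclideanreal q \<and> (\<forall>x\<in>V. p x \<le> q x) \<and>
        (\<exists>(f :: nat \<Rightarrow> 'a \<Rightarrow> complex) (y :: nat \<Rightarrow> 'a) (c :: nat \<Rightarrow> real).
          (\<forall>n. linear_map_on sc (*) V (f n)) \<and> (\<forall>n. y n \<in> V) \<and> (\<forall>n. 0 \<le> c n) \<and>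
          (\<forall>n. \<forall>x\<in>V. cmod (f n x) \<le> c n * q x) \<and>
          summable (\<lambda>n. c n * p (y n)) \<and>
          (\<forall>x\<in>V. (\<lambda>N. p (x - (\<Sum>n<N. sc (f n x) (y n)))) \<longlonglongrightarrow> 0))))"

section \<open>Topological *-algebras\<close>

locale frechet_star_algebra =
  fixes sc :: "complex \<Rightarrow> 'a::ring \<Rightarrow> 'a"
    and star :: "'a \<Rightarrow> 'a"
    and T :: "'a topology"
  assumes frechet: "frechet_space sc UNIV T"
    and scale_mult_left: "sc c x * y = sc c (x * y)"
    and scale_mult_right: "x * sc c y = sc c (x * y)"
    and star_star: "star (star x) = x"
    and star_add: "star (x + y) = star x + star y"
    and star_scale: "star (sc c x) = sc (cnj c) (star x)"
    and star_mult: "star (x * y) = star y * star x"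
    and continuous_mult_left: "continuous_map T T (\<lambda>x. a * x)"
    and continuous_mult_right: "continuous_map T T (\<lambda>x. x * a)"
    and continuous_star: "continuous_map T T star"

definition fundamental_system ::
  "(complex \<Rightarrow> 'a \<Rightarrow> 'a) \<Rightarrow> 'a::ab_group_add topology \<Rightarrow> (nat \<Rightarrow> 'a \<Rightarrow> real) \<Rightarrow> bool"
  where "fundamental_system sc T p \<longleftrightarrow>
    (\<forall>q. seminorm_on sc UNIV (p q)) \<and> (\<forall>q x. p q x \<le> p (Suc q) x) \<and>
    T = seminorm_topology UNIV (range p)"

text \<open>The domination condition does not depend on the chosen fundamental system.\<close>

definition dominating_norm ::
  "(complex \<Rightarrow> 'a \<Rightarrow> 'a) \<Rightarrow> 'a::ab_group_add topology \<Rightarrow> ('a \<Rightarrow> real) \<Rightarrow> bool"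
  where "dominating_norm sc T nrm \<longleftrightarrow>
    seminorm_on sc UNIV nrm \<and> (\<forall>x. nrm x = 0 \<longrightarrow> x = 0) \<and>
    continuous_map T euclideanreal nrm \<and>
    (\<exists>p. fundamental_system sc T p \<and>
      (\<forall>q. \<exists>r. \<exists>C>0. \<forall>x. (p q x)\<^sup>2 \<le> C * nrm x * p r x))"

definition scalar_product ::
  "(complex \<Rightarrow> 'a \<Rightarrow> 'a) \<Rightarrow> ('a::ab_group_add \<Rightarrow> 'a \<Rightarrow> complex) \<Rightarrow> bool"
  where "scalar_product sc B \<longleftrightarrow>
    (\<forall>x y z. B (x + y) z = B x z + B y z) \<and>
    (\<forall>c x y. B (sc c x) y = c * B x y) \<and>
    (\<forall>x y. B y x = cnj (B x y)) \<and>
    (\<forall>x. x \<noteq> 0 \<longrightarrow> 0 < Re (B x x))"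

definition hilbert_norm :: "('a \<Rightarrow> 'a \<Rightarrow> complex) \<Rightarrow> 'a \<Rightarrow> real"
  where "hilbert_norm B x = sqrt (Re (B x x))"

definition betaDN_algebra ::
  "(complex \<Rightarrow> 'a \<Rightarrow> 'a) \<Rightarrow> ('a \<Rightarrow> 'a) \<Rightarrow> 'a::ring topology \<Rightarrow> bool"
  where "betaDN_algebra sc star T \<longleftrightarrow>
    (\<exists>B. scalar_product sc B \<and> dominating_norm sc T (hilbert_norm B) \<and>
      (\<forall>x y z. B (x * y) z = B y (star x * z)) \<and>
      (\<forall>x. \<exists>C>0. \<forall>y. hilbert_norm B (x * y) \<le> C * hilbert_norm B y))"

section \<open>Sequence spaces\<close>

text \<open>Sequences are indexed from \<open>0\<close>, so the weight at index \<open>j = 1, 2, \<dots>\<close> of the usual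
  presentation sits at \<open>j - 1\<close> here.\<close>

definition seq_scale :: "complex \<Rightarrow> (nat \<Rightarrow> complex) \<Rightarrow> (nat \<Rightarrow> complex)"
  where "seq_scale c \<xi> = (\<lambda>j. c * \<xi> j)"

lemma vector_space_seq_scale: "vector_space seq_scale"
  by unfold_locales (auto simp: seq_scale_def fun_eq_iff algebra_simps)

definition exponent_sequence :: "(nat \<Rightarrow> real) \<Rightarrow> bool"
  where "exponent_sequence \<alpha> \<longleftrightarrow>
    incseq \<alpha> \<and> (\<forall>j. 0 < \<alpha> j) \<and> filterlim \<alpha> at_top sequentially"

definition power_series_space :: "(nat \<Rightarrow> real) \<Rightarrow> (nat \<Rightarrow> complex) set"
  where "power_series_space \<alpha> =
    {\<xi>. \<forall>q::nat. summable (\<lambda>j. (cmod (\<xi> j))\<^sup>2 * exp (2 * real q * \<alpha> j))}"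

definition power_series_norm :: "(nat \<Rightarrow> real) \<Rightarrow> nat \<Rightarrow> (nat \<Rightarrow> complex) \<Rightarrow> real"
  where "power_series_norm \<alpha> q \<xi> = sqrt (\<Sum>j. (cmod (\<xi> j))\<^sup>2 * exp (2 * real q * \<alpha> j))"

definition power_series_topology :: "(nat \<Rightarrow> real) \<Rightarrow> (nat \<Rightarrow> complex) topology"
  where "power_series_topology \<alpha> =
    seminorm_topology (power_series_space \<alpha>) (range (power_series_norm \<alpha>))"

definition ell2 :: "(nat \<Rightarrow> complex) set"
  where "ell2 = {\<xi>. summable (\<lambda>j. (cmod (\<xi> j))\<^sup>2)}"

definition ell2_inner :: "(nat \<Rightarrow> complex) \<Rightarrow> (nat \<Rightarrow> complex) \<Rightarrow> complex"
  where "ell2_inner \<xi> \<eta> = (\<Sum>j. \<xi> j * cnj (\<eta> j))"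

definition ell2_norm :: "(nat \<Rightarrow> complex) \<Rightarrow> real"
  where "ell2_norm \<xi> = sqrt (\<Sum>j. (cmod (\<xi> j))\<^sup>2)"

definition s_space :: "(nat \<Rightarrow> complex) set"
  where "s_space = {\<xi>. \<forall>q::nat. summable (\<lambda>j. (cmod (\<xi> j))\<^sup>2 * real (Suc j) ^ (2 * q))}"

definition s_norm :: "nat \<Rightarrow> (nat \<Rightarrow> complex) \<Rightarrow> real"
  where "s_norm q \<xi> = sqrt (\<Sum>j. (cmod (\<xi> j))\<^sup>2 * real (Suc j) ^ (2 * q))"

definition s_bounded :: "(nat \<Rightarrow> complex) set \<Rightarrow> bool"
  where "s_bounded B \<longleftrightarrow> B \<subseteq> s_space \<and> (\<forall>q. \<exists>C. \<forall>\<xi>\<in>B. s_norm q \<xi> \<le> C)"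

section \<open>The *-algebra of operators on \<open>s\<close> with adjoint on \<open>s\<close>\<close>

type_synonym seq_op = "(nat \<Rightarrow> complex) \<Rightarrow> (nat \<Rightarrow> complex)"

definition op_scale :: "complex \<Rightarrow> seq_op \<Rightarrow> seq_op"
  where "op_scale c x = (\<lambda>\<xi>. seq_scale c (x \<xi>))"

lemma vector_space_op_scale: "vector_space op_scale"
  by unfold_locales (auto simp: op_scale_def seq_scale_def fun_eq_iff algebra_simps)

text \<open>The Hilbert space adjoint of an operator in \<open>\<ell>\<^sub>2\<close> with (dense) domain \<open>s\<close>.\<close>

definition adjoint_domain :: "seq_op \<Rightarrow> (nat \<Rightarrow> complex) set"
  where "adjoint_domain x =
    {\<eta> \<in> ell2. \<exists>\<zeta>\<in>ell2. \<forall>\<xi>\<in>s_space. ell2_inner (x \<xi>) \<eta> = ell2_inner \<xi> \<zeta>}"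

definition hilbert_adjoint :: "seq_op \<Rightarrow> seq_op"
  where "hilbert_adjoint x \<eta> =
    (THE \<zeta>. \<zeta> \<in> ell2 \<and> (\<forall>\<xi>\<in>s_space. ell2_inner (x \<xi>) \<eta> = ell2_inner \<xi> \<zeta>))"

text \<open>Maps on \<open>s\<close> are represented by total functions that vanish outside \<open>s\<close>; this is preserved
  by the pointwise linear operations and by composition.\<close>

definition Lstar :: "seq_op set"
  where "Lstar =
    {x. linear_map_on seq_scale seq_scale s_space x \<and> x ` s_space \<subseteq> s_space \<and>
        (\<forall>\<xi>. \<xi> \<notin> s_space \<longrightarrow> x \<xi> = 0) \<and>
        s_space \<subseteq> adjoint_domain x \<and> hilbert_adjoint x ` s_space \<subseteq> s_space}"

definition Lstar_star :: "seq_op \<Rightarrow> seq_op"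
  where "Lstar_star x = (\<lambda>\<xi>. if \<xi> \<in> s_space then hilbert_adjoint x \<xi> else 0)"

text \<open>The suprema are finite on \<open>Lstar\<close>, whose elements are continuous on \<open>s\<close> by the closed graph
  theorem. Only nonempty \<open>B\<close> are used, since \<open>Sup {}\<close> is unspecified on the reals.\<close>

definition Lstar_seminorm :: "nat \<Rightarrow> (nat \<Rightarrow> complex) set \<Rightarrow> seq_op \<Rightarrow> real"
  where "Lstar_seminorm N B x =
    max (SUP \<xi>\<in>B. s_norm N (x \<xi>)) (SUP \<xi>\<in>B. s_norm N (Lstar_star x \<xi>))"

definition tau_star :: "seq_op topology"
  where "tau_star =
    seminorm_topology Lstar {Lstar_seminorm N B | N B. s_bounded B \<and> B \<noteq> {}}"

definition star_subalgebra :: "seq_op set \<Rightarrow> bool"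
  where "star_subalgebra F \<longleftrightarrow>
    F \<subseteq> Lstar \<and> module.subspace op_scale F \<and>
    (\<forall>x\<in>F. \<forall>y\<in>F. x \<circ> y \<in> F) \<and> (\<forall>x\<in>F. Lstar_star x \<in> F)"

definition complemented :: "seq_op set \<Rightarrow> bool"
  where "complemented F \<longleftrightarrow>
    (\<exists>P. linear_map_on op_scale op_scale Lstar P \<and> continuous_map tau_star tau_star P \<and>
      (\<forall>x\<in>Lstar. P (P x) = P x) \<and> P ` Lstar = F)"

definition extends_to_bounded :: "seq_op \<Rightarrow> bool"
  where "extends_to_bounded x \<longleftrightarrow>
    (\<exists>X. linear_map_on seq_scale seq_scale ell2 X \<and> X ` ell2 \<subseteq> ell2 \<and>
      (\<exists>C. \<forall>\<xi>\<in>ell2. ell2_norm (X \<xi>) \<le> C * ell2_norm \<xi>) \<and>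
      (\<forall>\<xi>\<in>s_space. X \<xi> = x \<xi>))"

section \<open>Isomorphisms\<close>

definition frechet_isomorphic_power_series ::
  "(complex \<Rightarrow> 'a \<Rightarrow> 'a) \<Rightarrow> 'a::ab_group_add topology \<Rightarrow> (nat \<Rightarrow> real) \<Rightarrow> bool"
  where "frechet_isomorphic_power_series sc T \<alpha> \<longleftrightarrow>
    (\<exists>\<Phi>. linear_map_on sc seq_scale UNIV \<Phi> \<and> homeomorphic_map T (power_series_topology \<alpha>) \<Phi>)"

definition star_algebra_isomorphic ::
  "(complex \<Rightarrow> 'a \<Rightarrow> 'a) \<Rightarrow> ('a \<Rightarrow> 'a) \<Rightarrow> 'a::ring topology \<Rightarrow> seq_op set \<Rightarrow> bool"
  where "star_algebra_isomorphic sc star T F \<longleftrightarrow>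
    (\<exists>\<Phi>. linear_map_on sc op_scale UNIV \<Phi> \<and>
      (\<forall>x y. \<Phi> (x * y) = \<Phi> x \<circ> \<Phi> y) \<and> (\<forall>x. \<Phi> (star x) = Lstar_star (\<Phi> x)) \<and>
      homeomorphic_map T (subtopology tau_star F) \<Phi>)"

end

theory Submission
  imports Defs
begin


text \<open>
  (iii) \<open>\<Longrightarrow>\<close> (i): Apply Gram--Schmidt in the dominating scalar product to the unit vectors of the power
  series space. The \<open>n\<close>-th coefficient of \<open>x\<close> is at most the norm of the \<open>n\<close>-th tail of \<open>x\<close>, hence
  decays like \<open>e\<^sup>-\<^sup>m\<^sup>\<alpha>\<^sup>n\<close> for all \<open>m\<close>; domination and a Bernstein inequality on the span of the first
  \<open>n\<close> vectors show that the seminorms of the \<open>n\<close>-th basis vector grow at most like \<open>e\<^sup>d\<^sup>\<alpha>\<^sup>n\<close>. By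
  nuclearity the coefficient map is an isomorphism onto the power series space that is isometric for
  the \<open>\<ell>\<^sub>2\<close> norm, and the power series space sits in \<open>s\<close> as a coordinate subspace. Multiplication
  operators then form the required subalgebra, and \<open>y \<mapsto> y 1\<close> is the projection.

  (ii) \<open>\<Longrightarrow>\<close> (iii): A weighted Hilbert--Schmidt scalar product works, by
  \<open>|\<xi>|\<^sub>N\<^sup>2 \<le> |\<xi>|\<^sub>0 |\<xi>|\<^sub>2\<^sub>N\<close> and normality of the operators.

  (i) \<open>\<Longrightarrow>\<close> (ii): The range of a continuous projection on a Hausdorff space is closed.
\<close>

section \<open>Seminorm topologies\<close>

text \<open>The bound \<open>nrm (x * y) \<le> C * nrm y\<close> and the identity
  \<open>B (x * y) z = B y (star x * z)\<close> both live in the Hilbert norm. An embedding that is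
  isometric from this norm into \<open>ell2\<close> turns the first into boundedness on
  \<open>ell2\<close> and the second into the Hilbert space adjoint. The given isomorphism with the
  power series space knows nothing of the scalar product, which is why a new basis is built.
  Continuity of the norm gives the decay of the coefficients, domination limits the growth of the
  basis vectors.

  Multiplication is only separately continuous, whereas \<open>tau_star\<close> demands estimates
  uniform on bounded sets. Uniform boundedness for families of seminorms bridges this gap. It also
  yields the continuity of the operators in \<open>Lstar\<close> and of the Hilbert-Schmidt norm,
  both treated as suprema of finite sections.

  Nuclearity enters as square summability of \<open>exp (- m * \<alpha> j)\<close> for some
  \<open>m\<close>: sums over the basis are controlled by it at the price of \<open>m\<close> extra
  levels of the seminorms.\<close>

lemma seminorm_onD:
  assumes "seminorm_on sc V p"
  shows "x \<in> V \<Longrightarrow> 0 \<le> p x" "x \<in> V \<Longrightarrow> p (sc c x) = cmod c * p x"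
    "x \<in> V \<Longrightarrow> y \<in> V \<Longrightarrow> p (x + y) \<le> p x + p y"
  using assms by (auto simp: seminorm_on_def)

lemma linear_map_onD:
  assumes "linear_map_on sc1 sc2 V f"
  shows "x \<in> V \<Longrightarrow> y \<in> V \<Longrightarrow> f (x + y) = f x + f y" "x \<in> V \<Longrightarrow> f (sc1 c x) = sc2 c (f x)"
  using assms by (auto simp: linear_map_on_def)

locale complex_subspace = vector_space sc
  for sc :: "complex \<Rightarrow> 'a::ab_group_add \<Rightarrow> 'a" +
  fixes V :: "'a set"
  assumes subspace_V: "subspace V"
begin

lemma zero_mem: "0 \<in> V"
  and add_mem: "x \<in> V \<Longrightarrow> y \<in> V \<Longrightarrow> x + y \<in> V"
  and diff_mem: "x \<in> V \<Longrightarrow> y \<in> V \<Longrightarrow> x - y \<in> V"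
  and minus_mem: "x \<in> V \<Longrightarrow> - x \<in> V"
  and scale_mem: "x \<in> V \<Longrightarrow> sc c x \<in> V"
  and sum_mem: "(\<And>i. i \<in> I \<Longrightarrow> f i \<in> V) \<Longrightarrow> sum f I \<in> V"
  using subspace_V by (auto intro: subspace_0 subspace_add subspace_diff subspace_scale subspace_sum
      subspace_neg)

lemma linear_zero: "linear_map_on sc sc2 V f \<Longrightarrow> vector_space sc2 \<Longrightarrow> f 0 = 0"
  using linear_map_onD(2)[of sc sc2 V f 0 0] zero_mem
  by (simp add: module.scale_zero_left module_iff_vector_space)

lemma linear_diff:
  assumes "linear_map_on sc sc2 V f" "x \<in> V" "y \<in> V"
  shows "f (x - y) = f x - f y"
  using linear_map_onD(1)[OF assms(1), of "x - y" y] assms diff_mem by (simp add: algebra_simps)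

lemma linear_sum:
  assumes "linear_map_on sc sc2 V f" "vector_space sc2" "\<And>i. i \<in> I \<Longrightarrow> g i \<in> V"
  shows "f (sum g I) = (\<Sum>i\<in>I. f (g i))"
  using assms(3)
proof (induction I rule: infinite_finite_induct)
  case (insert i I)
  then show ?case
    using linear_map_onD(1)[OF assms(1), of "g i" "sum g I"] sum_mem[of I g] by auto
qed (auto simp: linear_zero[OF assms(1,2)])

context
  fixes p
  assumes p: "seminorm_on sc V p"
begin

lemma seminorm_zero: "p 0 = 0"
  using seminorm_onD(2)[OF p zero_mem, of 0] by simp

lemma seminorm_minus: "x \<in> V \<Longrightarrow> p (- x) = p x"
  using seminorm_onD(2)[OF p, of x "-1"] by simp

lemma seminorm_diff: "x \<in> V \<Longrightarrow> y \<in> V \<Longrightarrow> p (x - y) \<le> p x + p y"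
  using seminorm_onD(3)[OF p, of x "- y"] seminorm_minus minus_mem by simp

lemma seminorm_commute: "x \<in> V \<Longrightarrow> y \<in> V \<Longrightarrow> p (x - y) = p (y - x)"
  using seminorm_minus[of "x - y"] diff_mem by simp

lemma seminorm_triangle: "x \<in> V \<Longrightarrow> y \<in> V \<Longrightarrow> z \<in> V \<Longrightarrow> p (x - z) \<le> p (x - y) + p (y - z)"
  using seminorm_onD(3)[OF p, of "x - y" "y - z"] diff_mem by simp

lemma seminorm_reverse: "x \<in> V \<Longrightarrow> y \<in> V \<Longrightarrow> \<bar>p x - p y\<bar> \<le> p (x - y)"
  using seminorm_onD(3)[OF p, of "x - y" y] seminorm_onD(3)[OF p, of "y - x" x] seminorm_commute
    diff_mem by (fastforce simp: abs_le_iff)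

lemma seminorm_sum: "(\<And>i. i \<in> I \<Longrightarrow> f i \<in> V) \<Longrightarrow> p (sum f I) \<le> (\<Sum>i\<in>I. p (f i))"
proof (induction I rule: infinite_finite_induct)
  case (insert i I)
  then show ?case
    using seminorm_onD(3)[OF p, of "f i" "sum f I"] sum_mem[of I f] by force
qed (auto simp: seminorm_zero)

end

end

section \<open>Directed families of seminorms: neighbourhoods and continuity\<close>

locale directed_seminorms = complex_subspace sc V
  for sc :: "complex \<Rightarrow> 'a::ab_group_add \<Rightarrow> 'a" and V +
  fixes P :: "('a \<Rightarrow> real) set"
  assumes seminorm_P: "p \<in> P \<Longrightarrow> seminorm_on sc V p"
    and P_nonempty: "P \<noteq> {}"
    and directed: "p \<in> P \<Longrightarrow> q \<in> P \<Longrightarrow> \<exists>r\<in>P. \<forall>x\<in>V. p x \<le> r x \<and> q x \<le> r x"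
begin

abbreviation "top_P \<equiv> seminorm_topology V P"

lemma openin_ball:
  assumes "p \<in> P" "x \<in> V"
  shows "openin top_P {y \<in> V. p (y - x) < \<epsilon>}"
proof (cases "\<epsilon> > 0")
  case True
  then show ?thesis
    unfolding seminorm_topology_def openin_topology_generated_by_iff using assms
    by (intro generate_topology_on.Basis) blast
next
  case False
  then have "{y \<in> V. p (y - x) < \<epsilon>} = {}"
    using seminorm_onD(1)[OF seminorm_P[OF assms(1)] diff_mem[OF _ assms(2)]] by fastforce
  then show ?thesis
    by (metis openin_empty)
qed

text \<open>The defining balls are a priori only a subbase. Directedness makes them a neighbourhood
  base: a ball of a seminorm dominating two others fits into the intersection of their
  balls.\<close>

lemma openin_top_P_iff:
  "openin top_P U \<longleftrightarrow> U \<subseteq> V \<and> (\<forall>x\<in>U. \<exists>p\<in>P. \<exists>\<epsilon>>0. {y \<in> V. p (y - x) < \<epsilon>} \<subseteq> U)"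
proof
  assume op: "openin top_P U"
  show "U \<subseteq> V \<and> (\<forall>x\<in>U. \<exists>p\<in>P. \<exists>\<epsilon>>0. {y \<in> V. p (y - x) < \<epsilon>} \<subseteq> U)"
    using op unfolding seminorm_topology_def openin_topology_generated_by_iff
  proof (induction rule: generate_topology_on.induct)
    case (Int a b)
    have "\<exists>p\<in>P. \<exists>\<epsilon>>0. {y \<in> V. p (y - x) < \<epsilon>} \<subseteq> a \<inter> b" if x: "x \<in> a" "x \<in> b" for x
    proof -
      obtain p \<epsilon> where p: "p \<in> P" "\<epsilon> > 0" "{y \<in> V. p (y - x) < \<epsilon>} \<subseteq> a"
        using Int.IH(1) x(1) by blast
      obtain q \<delta> where q: "q \<in> P" "\<delta> > 0" "{y \<in> V. q (y - x) < \<delta>} \<subseteq> b"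
        using Int.IH(2) x(2) by blast
      obtain r where r: "r \<in> P" "\<And>x. x \<in> V \<Longrightarrow> p x \<le> r x" "\<And>x. x \<in> V \<Longrightarrow> q x \<le> r x"
        using directed[OF p(1) q(1)] by blast
      have "x \<in> V"
        using Int.IH(1) x(1) by blast
      have "{y \<in> V. r (y - x) < min \<epsilon> \<delta>} \<subseteq> a \<inter> b"
      proof
        fix y assume y: "y \<in> {y \<in> V. r (y - x) < min \<epsilon> \<delta>}"
        then have "p (y - x) < \<epsilon>" "q (y - x) < \<delta>" "y \<in> V"
          using r(2,3)[of "y - x"] diff_mem[of y x] \<open>x \<in> V\<close> by auto
        then show "y \<in> a \<inter> b"
          using p(3) q(3) by blast
      qed
      then show ?thesis
        using r(1) p(2) q(2) by (intro bexI[of _ r] exI[of _ "min \<epsilon> \<delta>"]) auto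
    qed
    then show ?case
      using Int.IH by blast
  next
    case (UN K)
    then show ?case
      by (meson Union_iff Union_least Union_upper subset_trans)
  next
    case (Basis s)
    have "\<exists>p\<in>P. \<exists>\<epsilon>>0. {y \<in> V. p (y - x) < \<epsilon>} \<subseteq> s" if x: "x \<in> s" for x
    proof -
      consider "s = V" | p z \<epsilon> where "p \<in> P" "z \<in> V" "\<epsilon> > 0" "s = {y \<in> V. p (y - z) < \<epsilon>}"
        using Basis by blast
      then show "\<exists>p\<in>P. \<exists>\<epsilon>>0. {y \<in> V. p (y - x) < \<epsilon>} \<subseteq> s"
      proof cases
        case 1
        then show ?thesis
          using P_nonempty zero_less_one by blast
      next
        case 2
        have "{y \<in> V. p (y - x) < \<epsilon> - p (x - z)} \<subseteq> s"
        proof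
          fix y assume "y \<in> {y \<in> V. p (y - x) < \<epsilon> - p (x - z)}"
          then show "y \<in> s"
            using seminorm_triangle[OF seminorm_P[OF 2(1)], of y x z] 2 x by auto
        qed
        then show ?thesis
          using 2 x by (intro bexI[of _ p] exI[of _ "\<epsilon> - p (x - z)"]) auto
      qed
    qed
    then show ?case
      using Basis by blast
  qed simp
next
  assume U: "U \<subseteq> V \<and> (\<forall>x\<in>U. \<exists>p\<in>P. \<exists>\<epsilon>>0. {y \<in> V. p (y - x) < \<epsilon>} \<subseteq> U)"
  show "openin top_P U"
  proof (subst openin_subopen, intro ballI)
    fix x assume x: "x \<in> U"
    then obtain p \<epsilon> where "p \<in> P" "\<epsilon> > 0" "{y \<in> V. p (y - x) < \<epsilon>} \<subseteq> U"
      using U by blast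
    then show "\<exists>T. openin top_P T \<and> x \<in> T \<and> T \<subseteq> U"
      using openin_ball[of p x \<epsilon>] x U seminorm_zero[OF seminorm_P[of p]]
      by (intro exI[of _ "{y \<in> V. p (y - x) < \<epsilon>}"]) auto
  qed
qed

text \<open>Homogeneity: scale \<open>x\<close> into a ball contained in \<open>U\<close>, apply the
  bound \<open>1\<close> there and scale back.\<close>

lemma seminorm_bound_of_nbhd:
  assumes g: "seminorm_on sc V g" and U: "openin top_P U" "0 \<in> U" "\<And>x. x \<in> U \<Longrightarrow> g x \<le> 1"
  shows "\<exists>p\<in>P. \<exists>C>0. \<forall>x\<in>V. g x \<le> C * p x"
proof -
  obtain p \<epsilon> where p: "p \<in> P" "\<epsilon> > 0" "{y \<in> V. p (y - 0) < \<epsilon>} \<subseteq> U"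
    using U unfolding openin_top_P_iff by blast
  have "g x \<le> 2 / \<epsilon> * p x" if x: "x \<in> V" for x
  proof (rule field_le_epsilon)
    fix \<delta>' :: real assume \<delta>': "\<delta>' > 0"
    define \<delta> where "\<delta> = \<delta>' * \<epsilon> / 2"
    have \<delta>: "\<delta> > 0"
      using \<delta>' p by (simp add: \<delta>_def)
    have px: "p x \<ge> 0"
      using seminorm_onD(1)[OF seminorm_P] p x by blast
    \<comment> \<open>The summand \<open>\<delta>\<close> keeps \<open>t\<close> finite when
      \<open>p x = 0\<close>. It was chosen so that scaling back produces exactly the error
      \<open>\<delta>'\<close>.\<close>
    define t where "t = \<epsilon> / (2 * (p x + \<delta>))"
    have t: "t > 0"
      using p px \<delta> by (auto simp: t_def)
    have "p (sc t x) = t * p x"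
      using seminorm_onD(2)[OF seminorm_P[OF p(1)] x] t by simp
    also have "\<dots> < \<epsilon>"
      using p px \<delta> by (auto simp: t_def field_simps) (simp add: add_increasing2 add_strict_increasing2 mult_pos_pos)
    finally have "g (sc t x) \<le> 1"
      using U(3) p(3) scale_mem[OF x] by auto
    then have "t * g x \<le> 1"
      using seminorm_onD(2)[OF g x] t by simp
    then have "g x \<le> 1 / t"
      using t by (simp add: field_simps)
    also have "\<dots> = 2 / \<epsilon> * p x + \<delta>'"
      using p px \<delta> by (simp add: t_def \<delta>_def field_simps)
    finally show "g x \<le> 2 / \<epsilon> * p x + \<delta>'" .
  qed
  then show ?thesis
    using p by (intro bexI[of _ p] exI[of _ "2 / \<epsilon>"]) auto
qed

lemma continuous_seminorm_iff:
  assumes g: "seminorm_on sc V g"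
  shows "continuous_map top_P euclideanreal g \<longleftrightarrow> (\<exists>p\<in>P. \<exists>C>0. \<forall>x\<in>V. g x \<le> C * p x)"
proof
  assume cont: "continuous_map top_P euclideanreal g"
  have "openin top_P {x \<in> V. g x \<in> {..<1}}"
    using openin_continuous_map_preimage[OF cont, of "{..<1}"] by simp
  then show "\<exists>p\<in>P. \<exists>C>0. \<forall>x\<in>V. g x \<le> C * p x"
    using zero_mem seminorm_zero[OF g]
    by (intro seminorm_bound_of_nbhd[OF g, of "{x \<in> V. g x \<in> {..<1}}"]) auto
next
  assume "\<exists>p\<in>P. \<exists>C>0. \<forall>x\<in>V. g x \<le> C * p x"
  then obtain p C where p: "p \<in> P" "C > 0" "\<And>x. x \<in> V \<Longrightarrow> g x \<le> C * p x"
    by blast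
  show "continuous_map top_P euclideanreal g"
    unfolding continuous_map openin_top_P_iff
  proof (intro conjI allI impI ballI)
    fix U x assume "openin euclideanreal U" "x \<in> {x \<in> topspace top_P. g x \<in> U}"
    then have x: "x \<in> V" "g x \<in> U" and "open U"
      by auto
    then obtain e where e: "e > 0" "\<And>y. dist y (g x) < e \<Longrightarrow> y \<in> U"
      by (metis open_dist)
    have "g y \<in> U" if "y \<in> V" "p (y - x) < e / C" for y
    proof (rule e(2))
      have "\<bar>g y - g x\<bar> \<le> C * p (y - x)"
        using seminorm_reverse[OF g that(1) x(1)] p(3)[OF diff_mem[OF that(1) x(1)]] by simp
      also have "\<dots> < e"
        using that p by (simp add: field_simps)
      finally show "dist (g y) (g x) < e"
        by (simp add: dist_real_def)
    qed
    then show "\<exists>p\<in>P. \<exists>\<epsilon>>0. {y \<in> V. p (y - x) < \<epsilon>} \<subseteq> {x \<in> topspace top_P. g x \<in> U}"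
      using p e by (intro bexI[of _ p] exI[of _ "e / C"]) auto
  qed auto
qed

end

lemma continuous_linear_iff:
  assumes "directed_seminorms sc V P" "directed_seminorms sc2 W Q"
    and lin: "linear_map_on sc sc2 V f" and fV: "f ` V \<subseteq> W"
  shows "continuous_map (seminorm_topology V P) (seminorm_topology W Q) f \<longleftrightarrow>
    (\<forall>q\<in>Q. \<exists>p\<in>P. \<exists>C>0. \<forall>x\<in>V. q (f x) \<le> C * p x)" (is "?L \<longleftrightarrow> ?R")
proof -
  interpret P: directed_seminorms sc V P by fact
  interpret Q: directed_seminorms sc2 W Q by fact
  have f0: "f 0 = 0"
    using P.linear_zero[OF lin Q.vector_space_axioms] .
  show ?thesis
  proof
    assume L: ?L
    show ?R
    proof
      fix q assume q: "q \<in> Q"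
      have "seminorm_on sc V (\<lambda>x. q (f x))"
        using seminorm_onD[OF Q.seminorm_P[OF q]] linear_map_onD[OF lin] fV
        by (auto simp: seminorm_on_def image_subset_iff)
      moreover have "openin (seminorm_topology V P) {x \<in> V. f x \<in> {y \<in> W. q (y - 0) < 1}}"
        using openin_continuous_map_preimage[OF L Q.openin_ball[OF q Q.zero_mem]] by simp
      ultimately show "\<exists>p\<in>P. \<exists>C>0. \<forall>x\<in>V. q (f x) \<le> C * p x"
        using P.zero_mem Q.zero_mem f0 Q.seminorm_zero[OF Q.seminorm_P[OF q]]
        by (intro P.seminorm_bound_of_nbhd[of _ "{x \<in> V. f x \<in> {y \<in> W. q (y - 0) < 1}}"]) auto
    qed
  next
    assume R: ?R
    show ?L
      unfolding continuous_map P.openin_top_P_iff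
    proof (intro conjI allI impI ballI)
      fix U x assume U: "openin (seminorm_topology W Q) U"
        and "x \<in> {x \<in> topspace (seminorm_topology V P). f x \<in> U}"
      then have x: "x \<in> V" "f x \<in> U"
        by auto
      then obtain q \<epsilon> where q: "q \<in> Q" "\<epsilon> > 0" "{y \<in> W. q (y - f x) < \<epsilon>} \<subseteq> U"
        using U unfolding Q.openin_top_P_iff by blast
      then obtain p C where p: "p \<in> P" "C > 0" "\<And>x. x \<in> V \<Longrightarrow> q (f x) \<le> C * p x"
        using R by blast
      have "f y \<in> U" if "y \<in> V" "p (y - x) < \<epsilon> / C" for y
      proof -
        have "q (f y - f x) \<le> C * p (y - x)"
          using p(3)[of "y - x"] P.linear_diff[OF lin, of y x] that x P.diff_mem by simp
        also have "\<dots> < \<epsilon>"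
          using that p by (simp add: field_simps)
        finally show ?thesis
          using q(3) fV that(1) by auto
      qed
      then show "\<exists>p\<in>P. \<exists>\<epsilon>>0. {y \<in> V. p (y - x) < \<epsilon>} \<subseteq> {x \<in> topspace (seminorm_topology V P). f x \<in> U}"
        using p q by (intro bexI[of _ p] exI[of _ "\<epsilon> / C"]) auto
    qed (use fV in auto)
  qed
qed

text \<open>Completeness is encoded as convergence of the absolutely convergent series.\<close>

locale frechet_seminorms = complex_subspace sc V
  for sc :: "complex \<Rightarrow> 'a::ab_group_add \<Rightarrow> 'a" and V +
  fixes p :: "nat \<Rightarrow> 'a \<Rightarrow> real"
  assumes seminorm_p: "seminorm_on sc V (p q)"
    and p_Suc: "x \<in> V \<Longrightarrow> p q x \<le> p (Suc q) x"
    and series_converges: "\<lbrakk>\<And>k. X k \<in> V; \<And>q. summable (\<lambda>k. p q (X k))\<rbrakk> \<Longrightarrow>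
      \<exists>l\<in>V. \<forall>q. (\<lambda>n. p q (l - (\<Sum>k<n. X k))) \<longlonglongrightarrow> 0"
begin

lemma p_mono: "x \<in> V \<Longrightarrow> q \<le> r \<Longrightarrow> p q x \<le> p r x"
  using lift_Suc_mono_le[of "\<lambda>q. p q x"] p_Suc by blast

sublocale directed_seminorms sc V "range p"
proof
  fix f g assume "f \<in> range p" "g \<in> range p"
  then obtain m n where "f = p m" "g = p n"
    by blast
  then show "\<exists>r\<in>range p. \<forall>x\<in>V. f x \<le> r x \<and> g x \<le> r x"
    using p_mono by (intro bexI[of _ "p (max m n)"]) auto
qed (auto simp: seminorm_p)

text \<open>The proof uses nested balls: if the family admits no common bound
  \<open>C * p r\<close>, one can repeatedly shrink a ball so that some \<open>f i\<close> is at least \<open>n\<close> on the \<open>n\<close>-th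
  ball.\<close>

theorem uniform_boundedness:
  assumes f: "\<And>i. i \<in> I \<Longrightarrow> seminorm_on sc V (f i)"
    and f_cont: "\<And>i. i \<in> I \<Longrightarrow> \<exists>r C. \<forall>x\<in>V. f i x \<le> C * p r x"
    and f_bdd: "\<And>x. x \<in> V \<Longrightarrow> \<exists>M. \<forall>i\<in>I. f i x \<le> M"
  shows "\<exists>r. \<exists>C>0. \<forall>i\<in>I. \<forall>x\<in>V. f i x \<le> C * p r x"
proof (rule ccontr)
  assume neg: "\<not> ?thesis"
  \<comment> \<open>A state is a closed ball: centre \<open>s\<close>, index \<open>k\<close> of the
    seminorm, radius \<open>\<delta>\<close>. The guard \<open>n > 0\<close> makes every ball
    admissible at the start.\<close>
  define Inv where "Inv = (\<lambda>(n::nat) (s, k, \<delta>). s \<in> V \<and> \<delta> > (0::real) \<and> n \<le> k \<and>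
    (n > 0 \<longrightarrow> (\<exists>i\<in>I. \<forall>y\<in>V. p k (y - s) \<le> \<delta> \<longrightarrow> real n \<le> f i y)))"
  define Step where "Step = (\<lambda>(n::nat) (s, k, \<delta>) (s', k', \<delta>'). k \<le> (k'::nat) \<and> \<delta>' \<le> \<delta> / 2 \<and>
    p k (s' - s) \<le> \<delta> / (2::real))"
  have "\<exists>z. \<forall>n. Inv n (z n) \<and> Step n (z n) (z (Suc n))"
  proof (rule dependent_nat_choice)
    show "\<exists>z. Inv 0 z"
      using zero_mem by (auto simp: Inv_def intro!: exI[of _ 1])
  next
    fix z n assume "Inv n z"
    obtain s k \<delta> where z: "z = (s, k, \<delta>)"
      by (cases z)
    have s: "s \<in> V" "\<delta> > 0"
      using \<open>Inv n z\<close> by (auto simp: Inv_def z)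
    \<comment> \<open>\<open>K\<close> exceeds the target \<open>n + 1\<close> by one, which covers
      the variation of \<open>f i\<close> on the next ball. A vector \<open>v\<close> with
      \<open>f i v = K\<close> and \<open>p k v \<le> \<delta> / 2\<close> exists because
      \<open>2 * K / \<delta>\<close> fails as a common bound.\<close>
    define K where "K = real n + 2"
    have "2 * K / \<delta> > 0"
      using s by (simp add: K_def)
    then obtain i u where i: "i \<in> I" "u \<in> V" "2 * K / \<delta> * p k u < f i u"
      using neg by (metis linorder_not_le)
    have pu: "p k u \<ge> 0"
      using seminorm_onD(1)[OF seminorm_p i(2)] .
    have fu: "f i u > 0"
      using i(3) pu \<open>2 * K / \<delta> > 0\<close> by (meson le_less_trans less_le mult_nonneg_nonneg)
    define v where "v = sc (complex_of_real (K / f i u)) u"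
    have v: "v \<in> V"
      using i scale_mem by (simp add: v_def)
    have fv: "f i v = K"
      using seminorm_onD(2)[OF f[OF i(1)] i(2), of "complex_of_real (K / f i u)"] fu
      by (simp add: v_def K_def norm_divide del: of_real_add of_real_divide)
    have "p k v = K / f i u * p k u"
      using seminorm_onD(2)[OF seminorm_p i(2), of k "complex_of_real (K / f i u)"] fu
      by (simp add: v_def K_def norm_divide del: of_real_add of_real_divide)
    also have "\<dots> \<le> \<delta> / 2"
      using i(3) fu s by (simp add: field_simps)
    finally have pv: "p k v \<le> \<delta> / 2" .
    \<comment> \<open>The value of \<open>f i\<close> at \<open>s\<close> is unknown, so
      \<open>s + v\<close> alone need not be large. The two points differ by \<open>2 v\<close>,
      hence at least one of them has value at least \<open>K\<close>.\<close>
    have "2 * K \<le> f i (s + v) + f i (s - v)"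
    proof -
      have "v + v = sc 2 v"
        using scale_left_distrib[of 1 1 v] by simp
      then have "2 * K = f i (v + v)"
        using seminorm_onD(2)[OF f[OF i(1)] v, of 2] fv by simp
      also have "\<dots> = f i ((s + v) - (s - v))"
        by (simp add: algebra_simps)
      also have "\<dots> \<le> f i (s + v) + f i (s - v)"
        by (rule seminorm_diff[OF f[OF i(1)] add_mem[OF s(1) v] diff_mem[OF s(1) v]])
      finally show ?thesis .
    qed
    then obtain s' where s': "s' \<in> V" "p k (s' - s) \<le> \<delta> / 2" "f i s' \<ge> K"
    proof (cases "f i (s + v) \<ge> K")
      case True
      then show thesis
        using that[of "s + v"] s v add_mem pv by simp
    next
      case False
      then show thesis
        using that[of "s - v"] s v diff_mem pv seminorm_minus[OF seminorm_p v]
          \<open>2 * K \<le> f i (s + v) + f i (s - v)\<close> by simp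
    qed
    obtain l A' where "\<forall>x\<in>V. f i x \<le> A' * p l x"
      using f_cont[OF i(1)] by blast
    define A where "A = max A' 1"
    have A: "A > 0" "f i x \<le> A * p l x" if "x \<in> V" for x
      using \<open>\<forall>x\<in>V. f i x \<le> A' * p l x\<close> that mult_right_mono[of A' A "p l x"]
        seminorm_onD(1)[OF seminorm_p that, of l] by (force simp: A_def)+
    \<comment> \<open>\<open>k'\<close> dominates the continuity index \<open>l\<close> of
      \<open>f i\<close>; including \<open>Suc n\<close> drives the indices to infinity, so that the
      centres become Cauchy in every seminorm.\<close>
    define k' where "k' = max k (max l (Suc n))"
    define \<delta>' where "\<delta>' = min (\<delta> / 2) (1 / A)"
    have "real (Suc n) \<le> f i y" if y: "y \<in> V" "p k' (y - s') \<le> \<delta>'" for y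
    proof -
      have "f i (y - s') \<le> A * p l (y - s')"
        using A y s' diff_mem by blast
      also have "\<dots> \<le> A * p k' (y - s')"
        using A(1)[OF zero_mem] p_mono[of "y - s'" l k'] y s' diff_mem by (auto simp: k'_def)
      also have "\<dots> \<le> 1"
        using y(2) A(1)[OF zero_mem] by (simp add: \<delta>'_def field_simps)
      finally show ?thesis
        using seminorm_reverse[OF f[OF i(1)] y(1) s'(1)] s'(3) by (auto simp: K_def)
    qed
    then have "Inv (Suc n) (s', k', \<delta>')"
      using s' s A(1)[OF zero_mem] i(1) by (auto simp: Inv_def k'_def \<delta>'_def)
    moreover have "Step n z (s', k', \<delta>')"
      using s' by (auto simp: Step_def z k'_def \<delta>'_def)
    ultimately show "\<exists>y. Inv (Suc n) y \<and> Step n z y"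
      by blast
  qed
  then obtain z where z: "\<And>n. Inv n (z n)" "\<And>n. Step n (z n) (z (Suc n))"
    by blast
  define s where "s = (\<lambda>n. fst (z n))"
  define k where "k = (\<lambda>n. fst (snd (z n)))"
  define \<delta> where "\<delta> = (\<lambda>n. snd (snd (z n)))"
  have sV: "s n \<in> V" and \<delta>_pos: "\<delta> n > 0" and k_ge: "n \<le> k n"
    and large: "n > 0 \<Longrightarrow> \<exists>i\<in>I. \<forall>y\<in>V. p (k n) (y - s n) \<le> \<delta> n \<longrightarrow> real n \<le> f i y" for n
    using z(1)[of n] by (auto simp: Inv_def s_def k_def \<delta>_def split: prod.splits)
  have k_Suc: "k n \<le> k (Suc n)" and \<delta>_Suc: "\<delta> (Suc n) \<le> \<delta> n / 2"
    and s_Suc: "p (k n) (s (Suc n) - s n) \<le> \<delta> n / 2" for n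
    using z(2)[of n] by (auto simp: Step_def s_def k_def \<delta>_def split: prod.splits)
  have k_mono: "m \<le> n \<Longrightarrow> k m \<le> k n" for m n
    using lift_Suc_mono_le[of k] k_Suc by blast
  have \<delta>_le: "\<delta> (m + n) \<le> \<delta> m * (1 / 2) ^ n" for m n
  proof (induction n)
    case (Suc n)
    then show ?case
      using \<delta>_Suc[of "m + n"] by simp
  qed simp
  have step_le: "p q (s (Suc n) - s n) \<le> \<delta> 0 * (1 / 2) ^ n" if "q \<le> n" for q n
  proof -
    have "p q (s (Suc n) - s n) \<le> p (k n) (s (Suc n) - s n)"
      using that k_ge[of n] by (intro p_mono diff_mem sV) auto
    then show ?thesis
      using s_Suc[of n] \<delta>_le[of 0 n] \<delta>_pos[of n] by simp
  qed
  have "summable (\<lambda>n. p q (s (Suc n) - s n))" for q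
  proof (rule summable_comparison_test'[of "\<lambda>n. \<delta> 0 * (1 / 2) ^ n" q])
    show "summable (\<lambda>n. \<delta> 0 * (1 / 2) ^ n)"
      by (intro summable_mult summable_geometric) auto
    show "norm (p q (s (Suc n) - s n)) \<le> \<delta> 0 * (1 / 2) ^ n" if "n \<ge> q" for n
      using step_le[OF that] seminorm_onD(1)[OF seminorm_p diff_mem[OF sV sV]] by simp
  qed
  then obtain l where l: "l \<in> V" "\<And>q. (\<lambda>n. p q (l - (\<Sum>k<n. s (Suc k) - s k))) \<longlonglongrightarrow> 0"
    using series_converges[of "\<lambda>n. s (Suc n) - s n"] sV diff_mem by blast
  define L where "L = l + s 0"
  have LV: "L \<in> V"
    using l sV add_mem by (simp add: L_def)
  have L: "(\<lambda>n. p q (L - s n)) \<longlonglongrightarrow> 0" for q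
    using l(2)[of q] by (simp add: sum_lessThan_telescope L_def algebra_simps)
  \<comment> \<open>Each step is at most half the current radius and the radii halve, so the
    displacements sum to less than \<open>\<delta> m\<close> and the limit stays in every closed
    ball.\<close>
  have near: "p (k m) (s (m + n) - s m) \<le> \<delta> m * (1 - (1 / 2) ^ n)" for m n
  proof (induction n)
    case (Suc n)
    have "p (k m) (s (m + Suc n) - s m) \<le> p (k m) (s (Suc (m + n)) - s (m + n)) + p (k m) (s (m + n) - s m)"
      using seminorm_triangle[OF seminorm_p sV sV sV, of "k m"] by simp
    moreover have "p (k m) (s (Suc (m + n)) - s (m + n)) \<le> p (k (m + n)) (s (Suc (m + n)) - s (m + n))"
      using k_mono[of m "m + n"] by (intro p_mono diff_mem sV) auto
    moreover have "\<delta> m * (1 / 2) ^ n / 2 + \<delta> m * (1 - (1 / 2) ^ n) = \<delta> m * (1 - (1 / 2) ^ Suc n)"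
      by (simp add: field_simps)
    ultimately show ?case
      using Suc s_Suc[of "m + n"] \<delta>_le[of m n] by linarith
  qed (use seminorm_zero[OF seminorm_p] in auto)
  have "p (k m) (L - s m) \<le> \<delta> m" for m
  proof (rule LIMSEQ_le_const)
    show "(\<lambda>n. p (k m) (L - s (n + m)) + \<delta> m) \<longlonglongrightarrow> \<delta> m"
      using tendsto_add[OF LIMSEQ_ignore_initial_segment[OF L] tendsto_const[of "\<delta> m"]] by simp
    have "p (k m) (L - s m) \<le> p (k m) (L - s (n + m)) + \<delta> m" for n
    proof -
      have "\<delta> m * (1 - (1 / 2) ^ n) \<le> \<delta> m * 1"
        using \<delta>_pos[of m] by (intro mult_left_mono) auto
      then show ?thesis
        using seminorm_triangle[OF seminorm_p LV sV sV, of "k m" m "n + m"] near[of m n]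
        by (simp add: add.commute)
    qed
    then show "\<exists>N. \<forall>n\<ge>N. p (k m) (L - s m) \<le> p (k m) (L - s (n + m)) + \<delta> m"
      by blast
  qed
  then have big: "n > 0 \<Longrightarrow> \<exists>i\<in>I. real n \<le> f i L" for n
    using large[of n] LV by blast
  obtain M where M: "\<forall>i\<in>I. f i L \<le> M"
    using f_bdd[OF LV] by blast
  obtain n where "M < real n"
    using reals_Archimedean2 by blast
  then show False
    using big[of "Suc n"] M by force
qed

end


section \<open>Weighted sequence spaces\<close>

text \<open>One notion for \<open>ell2\<close> (weight \<open>1\<close>), for the power series norms
  and for the norms of \<open>s\<close>.\<close>

definition wl2 :: "(nat \<Rightarrow> real) \<Rightarrow> (nat \<Rightarrow> complex) set"
  where "wl2 w = {\<xi>. summable (\<lambda>j. (cmod (\<xi> j) * w j)\<^sup>2)}"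

definition wnorm :: "(nat \<Rightarrow> real) \<Rightarrow> (nat \<Rightarrow> complex) \<Rightarrow> real"
  where "wnorm w \<xi> = sqrt (\<Sum>j. (cmod (\<xi> j) * w j)\<^sup>2)"

lemma wnorm_nonneg: "\<xi> \<in> wl2 w \<Longrightarrow> 0 \<le> wnorm w \<xi>"
  by (simp add: wnorm_def wl2_def suminf_nonneg)

lemma L2_set_le_wnorm:
  assumes "\<xi> \<in> wl2 w" "finite A"
  shows "L2_set (\<lambda>j. cmod (\<xi> j) * w j) A \<le> wnorm w \<xi>"
  using assms unfolding L2_set_def wnorm_def wl2_def
  by (intro real_sqrt_le_mono sum_le_suminf) auto

text \<open>Reduces membership and norm estimates to finite sections, where the Minkowski and
  Cauchy-Schwarz inequalities for \<open>L2_set\<close> apply.\<close>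

lemma wl2_bound:
  assumes "\<And>n. L2_set (\<lambda>j. cmod (\<xi> j) * w j) {..<n} \<le> C"
  shows "\<xi> \<in> wl2 w" "wnorm w \<xi> \<le> C"
proof -
  have C: "C \<ge> 0"
    using order_trans[OF L2_set_nonneg assms] .
  have bound: "(\<Sum>j<n. (cmod (\<xi> j) * w j)\<^sup>2) \<le> C\<^sup>2" for n
  proof -
    have "sqrt (\<Sum>j<n. (cmod (\<xi> j) * w j)\<^sup>2) \<le> C"
      using assms[of n] by (simp add: L2_set_def)
    then show ?thesis
      by (rule sqrt_le_D)
  qed
  show *: "\<xi> \<in> wl2 w"
    unfolding wl2_def using bound by (intro CollectI summableI_nonneg_bounded) auto
  then have "(\<Sum>j. (cmod (\<xi> j) * w j)\<^sup>2) \<le> C\<^sup>2"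
    unfolding wl2_def using bound by (intro suminf_le_const) auto
  then show "wnorm w \<xi> \<le> C"
    unfolding wnorm_def using C by (intro real_le_lsqrt) auto
qed

lemma wl2_component:
  assumes "\<xi> \<in> wl2 w"
  shows "cmod (\<xi> j) * w j \<le> wnorm w \<xi>"
  using member_le_L2_set[of "{j}" j "\<lambda>j. cmod (\<xi> j) * w j"] L2_set_le_wnorm[OF assms, of "{j}"]
  by simp

text \<open>A Fatou property: finite sections converge, and their bound survives. Completeness and
  the extension of estimates from truncations rest on it.\<close>

lemma wl2_pointwise_limit:
  assumes \<xi>: "\<And>n. \<xi> n \<in> wl2 w" "\<And>n. n \<ge> N \<Longrightarrow> wnorm w (\<xi> n) \<le> C"
    and lim: "\<And>j. (\<lambda>n. \<xi> n j) \<longlonglongrightarrow> \<eta> j"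
  shows "\<eta> \<in> wl2 w" "wnorm w \<eta> \<le> C"
proof -
  have "L2_set (\<lambda>j. cmod (\<eta> j) * w j) {..<k} \<le> C" for k
  proof (rule LIMSEQ_le_const2)
    show "(\<lambda>n. L2_set (\<lambda>j. cmod (\<xi> n j) * w j) {..<k}) \<longlonglongrightarrow> L2_set (\<lambda>j. cmod (\<eta> j) * w j) {..<k}"
      unfolding L2_set_def by (intro tendsto_intros lim)
    show "\<exists>N. \<forall>n\<ge>N. L2_set (\<lambda>j. cmod (\<xi> n j) * w j) {..<k} \<le> C"
      using order_trans[OF L2_set_le_wnorm[OF \<xi>(1)] \<xi>(2)] by blast
  qed
  then show "\<eta> \<in> wl2 w" "wnorm w \<eta> \<le> C"
    using wl2_bound by blast+
qed

lemma wl2_mono: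
  assumes "\<And>j. 0 \<le> v j" "\<And>j. v j \<le> C * w j" "\<xi> \<in> wl2 w" "0 \<le> C"
  shows "\<xi> \<in> wl2 v" "wnorm v \<xi> \<le> C * wnorm w \<xi>"
proof -
  have "L2_set (\<lambda>j. cmod (\<xi> j) * v j) {..<n} \<le> C * wnorm w \<xi>" for n
  proof -
    have "L2_set (\<lambda>j. cmod (\<xi> j) * v j) {..<n} \<le> L2_set (\<lambda>j. C * (cmod (\<xi> j) * w j)) {..<n}"
    proof (rule L2_set_mono)
      show "cmod (\<xi> j) * v j \<le> C * (cmod (\<xi> j) * w j)" for j
        using mult_left_mono[OF assms(2), of "cmod (\<xi> j)" j] by (simp add: algebra_simps)
    qed (use assms in auto)
    also have "\<dots> = C * L2_set (\<lambda>j. cmod (\<xi> j) * w j) {..<n}"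
      using L2_set_right_distrib[OF assms(4)] by metis
    also have "\<dots> \<le> C * wnorm w \<xi>"
      using L2_set_le_wnorm[OF assms(3), of "{..<n}"] assms(4) by (intro mult_left_mono) auto
    finally show ?thesis .
  qed
  then show "\<xi> \<in> wl2 v" "wnorm v \<xi> \<le> C * wnorm w \<xi>"
    using wl2_bound by blast+
qed

lemma wl2_add:
  assumes "\<And>j. 0 \<le> w j" "\<xi> \<in> wl2 w" "\<eta> \<in> wl2 w"
  shows "\<xi> + \<eta> \<in> wl2 w" "wnorm w (\<xi> + \<eta>) \<le> wnorm w \<xi> + wnorm w \<eta>"
proof -
  have "L2_set (\<lambda>j. cmod ((\<xi> + \<eta>) j) * w j) {..<n} \<le> wnorm w \<xi> + wnorm w \<eta>" for n
  proof -
    have "L2_set (\<lambda>j. cmod ((\<xi> + \<eta>) j) * w j) {..<n} \<le>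
        L2_set (\<lambda>j. cmod (\<xi> j) * w j + cmod (\<eta> j) * w j) {..<n}"
    proof (rule L2_set_mono)
      show "cmod ((\<xi> + \<eta>) j) * w j \<le> cmod (\<xi> j) * w j + cmod (\<eta> j) * w j" for j
        using mult_right_mono[OF norm_triangle_ineq assms(1)] by (simp add: distrib_right)
    qed (use assms in auto)
    also note L2_set_triangle_ineq
    finally show ?thesis
      using L2_set_le_wnorm[OF assms(2), of "{..<n}"] L2_set_le_wnorm[OF assms(3), of "{..<n}"]
      by simp
  qed
  then show "\<xi> + \<eta> \<in> wl2 w" "wnorm w (\<xi> + \<eta>) \<le> wnorm w \<xi> + wnorm w \<eta>"
    using wl2_bound by blast+
qed

lemma wl2_scale:
  shows "\<xi> \<in> wl2 w \<Longrightarrow> seq_scale c \<xi> \<in> wl2 w" "\<xi> \<in> wl2 w \<Longrightarrow> wnorm w (seq_scale c \<xi>) = cmod c * wnorm w \<xi>"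
proof -
  have eq: "(\<lambda>j. (cmod (seq_scale c \<xi> j) * w j)\<^sup>2) = (\<lambda>j. (cmod c)\<^sup>2 * (cmod (\<xi> j) * w j)\<^sup>2)"
    by (auto simp: seq_scale_def norm_mult power_mult_distrib)
  assume \<xi>: "\<xi> \<in> wl2 w"
  then show "seq_scale c \<xi> \<in> wl2 w"
    unfolding wl2_def by (auto simp: eq intro: summable_mult)
  have "(\<Sum>j. (cmod c)\<^sup>2 * (cmod (\<xi> j) * w j)\<^sup>2) = (cmod c)\<^sup>2 * (\<Sum>j. (cmod (\<xi> j) * w j)\<^sup>2)"
    using \<xi> by (intro suminf_mult) (simp add: wl2_def)
  then show "wnorm w (seq_scale c \<xi>) = cmod c * wnorm w \<xi>"
    by (simp add: wnorm_def eq real_sqrt_mult)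
qed

lemma wnorm_zero: "0 \<in> wl2 w" "wnorm w 0 = 0"
  by (auto simp: wl2_def wnorm_def)

lemma wl2_sum_le:
  assumes "\<xi> \<in> wl2 w" "\<And>j. 0 \<le> w j"
  shows "(\<Sum>j<n. \<bar>a j\<bar> * (cmod (\<xi> j) * w j)) \<le> L2_set a {..<n} * wnorm w \<xi>"
proof -
  have "(\<Sum>j<n. \<bar>a j\<bar> * (cmod (\<xi> j) * w j)) = (\<Sum>j<n. \<bar>a j\<bar> * \<bar>cmod (\<xi> j) * w j\<bar>)"
    using assms by simp
  also have "\<dots> \<le> L2_set a {..<n} * L2_set (\<lambda>j. cmod (\<xi> j) * w j) {..<n}"
    by (rule L2_set_mult_ineq)
  also have "\<dots> \<le> L2_set a {..<n} * wnorm w \<xi>"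
    using L2_set_le_wnorm[OF assms(1)] by (intro mult_left_mono) auto
  finally show ?thesis .
qed

section \<open>Truncations and unit sequences\<close>

definition trunc :: "nat \<Rightarrow> (nat \<Rightarrow> complex) \<Rightarrow> nat \<Rightarrow> complex"
  where "trunc n \<xi> = (\<lambda>j. if j < n then \<xi> j else 0)"

definition unit_seq :: "nat \<Rightarrow> nat \<Rightarrow> complex"
  where "unit_seq k = (\<lambda>j. if j = k then 1 else 0)"

lemma trunc_eq_sum: "trunc n \<xi> = (\<Sum>k<n. seq_scale (\<xi> k) (unit_seq k))"
proof
  fix j
  have "(\<Sum>k<n. seq_scale (\<xi> k) (unit_seq k)) j = (\<Sum>k<n. seq_scale (\<xi> k) (unit_seq k) j)"
    by (induction n) auto
  also have "\<dots> = (\<Sum>k<n. if j = k then \<xi> k else 0)"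
    by (intro sum.cong) (auto simp: seq_scale_def unit_seq_def)
  finally show "trunc n \<xi> j = (\<Sum>k<n. seq_scale (\<xi> k) (unit_seq k)) j"
    by (simp add: trunc_def)
qed

lemma finite_support_wl2:
  assumes "\<And>j. j \<ge> n \<Longrightarrow> \<xi> j = 0"
  shows "\<xi> \<in> wl2 w"
  unfolding wl2_def using assms by (intro CollectI summable_finite[of "{..<n}"]) auto

lemma trunc_wl2: "trunc n \<xi> \<in> wl2 w"
  by (rule finite_support_wl2[of n]) (auto simp: trunc_def)

lemma unit_seq_wl2: "unit_seq k \<in> wl2 w"
  by (rule finite_support_wl2[of "Suc k"]) (auto simp: unit_seq_def)

lemma wnorm_unit_seq:
  assumes "0 \<le> w k"
  shows "wnorm w (unit_seq k) = w k"
proof -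
  have "(\<Sum>j. (cmod (unit_seq k j) * w j)\<^sup>2) = (\<Sum>j\<in>{k}. (cmod (unit_seq k j) * w j)\<^sup>2)"
    by (rule suminf_finite) (auto simp: unit_seq_def)
  then show ?thesis
    using assms by (simp add: wnorm_def unit_seq_def)
qed

lemma wnorm_trunc_le: "\<xi> \<in> wl2 w \<Longrightarrow> (\<And>j. 0 \<le> w j) \<Longrightarrow> wnorm w (trunc n \<xi>) \<le> wnorm w \<xi>"
  by (rule wl2_bound(2), rule order_trans[OF L2_set_mono L2_set_le_wnorm]) (auto simp: trunc_def)

lemma wnorm_trunc_tendsto:
  assumes \<xi>: "\<xi> \<in> wl2 w"
  shows "(\<lambda>n. wnorm w (\<xi> - trunc n \<xi>)) \<longlonglongrightarrow> 0"
proof -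
  let ?f = "\<lambda>j. (cmod (\<xi> j) * w j)\<^sup>2"
  have sm: "summable ?f"
    using \<xi> by (simp add: wl2_def)
  have "wnorm w (\<xi> - trunc n \<xi>) = sqrt (\<Sum>j. ?f (j + n))" for n
  proof -
    have "summable (\<lambda>j. (cmod ((\<xi> - trunc n \<xi>) j) * w j)\<^sup>2)"
      by (rule summable_comparison_test'[OF sm, of 0]) (auto simp: trunc_def)
    then have "(\<Sum>j. (cmod ((\<xi> - trunc n \<xi>) j) * w j)\<^sup>2) =
        (\<Sum>j. (cmod ((\<xi> - trunc n \<xi>) (j + n)) * w (j + n))\<^sup>2) +
        (\<Sum>j<n. (cmod ((\<xi> - trunc n \<xi>) j) * w j)\<^sup>2)"
      by (rule suminf_split_initial_segment)
    then show ?thesis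
      by (simp add: wnorm_def trunc_def)
  qed
  moreover have "(\<lambda>n. sqrt (\<Sum>j. ?f (j + n))) \<longlonglongrightarrow> sqrt 0"
    by (intro tendsto_real_sqrt suminf_exist_split2 sm)
  ultimately show ?thesis
    by simp
qed

section \<open>Koethe echelon spaces of order 2\<close>

definition koethe_space :: "(nat \<Rightarrow> nat \<Rightarrow> real) \<Rightarrow> (nat \<Rightarrow> complex) set"
  where "koethe_space w = {\<xi>. \<forall>q. \<xi> \<in> wl2 (w q)}"

text \<open>The normalization \<open>w 0 j = 1\<close> makes the lowest norm the \<open>ell2\<close>
  norm, so that every norm of the space controls each single coordinate.\<close>

locale koethe_weights =
  fixes w :: "nat \<Rightarrow> nat \<Rightarrow> real"
  assumes w_0: "w 0 j = 1"
    and w_Suc: "w q j \<le> w (Suc q) j"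
begin

lemma w_ge_1: "1 \<le> w q j"
  by (induction q) (use w_0 w_Suc order_trans in fastforce)+

lemma w_nonneg: "0 \<le> w q j"
  using w_ge_1[of q j] by simp

lemma trunc_mem: "trunc n \<xi> \<in> koethe_space w"
  and unit_seq_mem: "unit_seq k \<in> koethe_space w"
  by (auto simp: koethe_space_def trunc_wl2 unit_seq_wl2)

lemma component_le: "\<xi> \<in> koethe_space w \<Longrightarrow> cmod (\<xi> j) \<le> wnorm (w q) \<xi>"
  using wl2_component[of \<xi> "w q" j] mult_left_mono[OF w_ge_1, of "cmod (\<xi> j)" q j]
  by (simp add: koethe_space_def)

lemma koethe_complex_subspace: "complex_subspace seq_scale (koethe_space w)"
proof -
  interpret vector_space seq_scale
    by (rule vector_space_seq_scale)
  show ?thesis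
    by unfold_locales
      (auto simp: subspace_def koethe_space_def wnorm_zero wl2_scale intro: wl2_add w_nonneg)
qed

sublocale frechet_seminorms seq_scale "koethe_space w" "\<lambda>q. wnorm (w q)"
proof -
  interpret complex_subspace seq_scale "koethe_space w"
    by (rule koethe_complex_subspace)
  have semi: "seminorm_on seq_scale (koethe_space w) (wnorm (w q))" for q
    unfolding seminorm_on_def koethe_space_def
    using wnorm_nonneg wl2_scale wl2_add(2)[of "w q", OF w_nonneg] by blast
  show "frechet_seminorms seq_scale (koethe_space w) (\<lambda>q. wnorm (w q))"
  proof (unfold_locales, rule semi)
    fix \<xi> q assume "\<xi> \<in> koethe_space w"
    then show "wnorm (w q) \<xi> \<le> wnorm (w (Suc q)) \<xi>"
      using wl2_mono(2)[of "w q" 1 "w (Suc q)" \<xi>] w_nonneg w_Suc by (simp add: koethe_space_def)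
  next
    fix X :: "nat \<Rightarrow> nat \<Rightarrow> complex"
    assume X: "\<And>k. X k \<in> koethe_space w" and sm: "\<And>q. summable (\<lambda>k. wnorm (w q) (X k))"
    have smj: "summable (\<lambda>k. X k j)" for j
    proof (rule summable_comparison_test'[OF sm[of 0], of 0])
      show "norm (X k j) \<le> wnorm (w 0) (X k)" for k
        using component_le[OF X] .
    qed
    define l where "l = (\<lambda>j. \<Sum>k. X k j)"
    have sum_apply: "(\<Sum>k\<in>A. X k) j = (\<Sum>k\<in>A. X k j)" for A j
      by (induction A rule: infinite_finite_induct) auto
    \<comment> \<open>The remainder from \<open>n\<close> on is the coordinatewise limit of finite
      sums, so its norm is at most the tail of the series of norms.\<close>
    have tail: "l - (\<Sum>k<n. X k) \<in> wl2 (w q) \<and>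
        wnorm (w q) (l - (\<Sum>k<n. X k)) \<le> (\<Sum>k. wnorm (w q) (X (k + n)))" for n q
    proof -
      have smn: "summable (\<lambda>k. wnorm (w q) (X (k + n)))"
        using summable_ignore_initial_segment[OF sm] .
      have mem: "(\<Sum>k<m. X (k + n)) \<in> wl2 (w q)" for m
        using sum_mem[of "{..<m}" "\<lambda>k. X (k + n)"] X by (simp add: koethe_space_def)
      have le: "wnorm (w q) (\<Sum>k<m. X (k + n)) \<le> (\<Sum>k. wnorm (w q) (X (k + n)))" for m
        by (rule order_trans[OF seminorm_sum[OF semi] sum_le_suminf[OF smn]])
          (auto intro: X seminorm_onD(1)[OF semi])
      have lim: "(\<lambda>m. (\<Sum>k<m. X (k + n)) j) \<longlonglongrightarrow> (l - (\<Sum>k<n. X k)) j" for j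
      proof -
        have "(\<lambda>k. X (k + n) j) sums (l j - (\<Sum>k<n. X k j))"
          unfolding l_def using sums_split_initial_segment[OF summable_sums[OF smj]] .
        moreover have "(\<Sum>k<m. X (k + n)) j = (\<Sum>k<m. X (k + n) j)" for m
          by (induction m) auto
        ultimately show ?thesis
          by (simp add: sums_def sum_apply)
      qed
      show ?thesis
        using wl2_pointwise_limit[OF mem le lim] by blast
    qed
    have "l \<in> koethe_space w"
      using tail[where n = 0] by (simp add: koethe_space_def)
    moreover have "(\<lambda>n. wnorm (w q) (l - (\<Sum>k<n. X k))) \<longlonglongrightarrow> 0" for q
      by (rule tendsto_sandwich[OF _ _ tendsto_const suminf_exist_split2[OF sm[of q]]])
        (use tail wnorm_nonneg in \<open>blast intro: always_eventually\<close>)+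
    ultimately show "\<exists>l\<in>koethe_space w. \<forall>q. (\<lambda>n. wnorm (w q) (l - (\<Sum>k<n. X k))) \<longlonglongrightarrow> 0"
      by blast
  qed
qed

end

lemma power_series_weights:
  assumes "\<And>j. 0 \<le> \<alpha> j"
  shows "koethe_weights (\<lambda>q j. exp (real q * \<alpha> j))"
  by unfold_locales (auto simp: assms algebra_simps)

lemma power_series_weight_eq: "a\<^sup>2 * exp (2 * real q * \<alpha> j) = (a * exp (real q * \<alpha> j))\<^sup>2"
  by (simp add: power_mult_distrib exp_double[symmetric] mult.assoc)

lemma power_series_space_eq: "power_series_space \<alpha> = koethe_space (\<lambda>q j. exp (real q * \<alpha> j))"
  and power_series_norm_eq: "power_series_norm \<alpha> q = wnorm (\<lambda>j. exp (real q * \<alpha> j))"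
  by (auto simp: power_series_space_def koethe_space_def wl2_def power_series_norm_def wnorm_def
      power_series_weight_eq fun_eq_iff)

abbreviation s_weight :: "nat \<Rightarrow> nat \<Rightarrow> real"
  where "s_weight q j \<equiv> real (Suc j) ^ q"

lemma s_space_eq: "s_space = koethe_space s_weight"
  and s_norm_eq: "s_norm q = wnorm (s_weight q)"
  by (auto simp: s_space_def koethe_space_def wl2_def s_norm_def wnorm_def
      power_mult_distrib power_mult[symmetric] mult.commute fun_eq_iff)

interpretation s: koethe_weights s_weight
  rewrites "koethe_space s_weight = s_space" and "wnorm (s_weight q) = s_norm q"
  by (unfold_locales, auto simp: s_space_eq s_norm_eq)


section \<open>The Hilbert space \<open>\<ell>\<^sub>2\<close>\<close>

lemma ell2_eq: "ell2 = wl2 (\<lambda>_. 1)"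
  and ell2_norm_eq: "ell2_norm = wnorm (\<lambda>_. 1)"
  by (auto simp: ell2_def wl2_def ell2_norm_def wnorm_def fun_eq_iff)

lemma s_norm_0: "s_norm 0 = ell2_norm"
  by (simp add: s_norm_eq ell2_norm_eq)

lemma s_space_wl2: "\<xi> \<in> s_space \<Longrightarrow> \<xi> \<in> wl2 (s_weight q)"
  by (simp add: s_space_eq koethe_space_def)

lemma s_subset_ell2: "\<xi> \<in> s_space \<Longrightarrow> \<xi> \<in> ell2"
  using s_space_wl2[of \<xi> 0] by (simp add: ell2_eq)

lemma ell2_norm_nonneg: "\<xi> \<in> ell2 \<Longrightarrow> 0 \<le> ell2_norm \<xi>"
  by (simp add: ell2_eq ell2_norm_eq wnorm_nonneg)

lemma ell2_complex_subspace: "complex_subspace seq_scale ell2"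
  by unfold_locales (auto simp: s.subspace_def ell2_eq wnorm_zero wl2_scale intro: wl2_add)

interpretation ell2: complex_subspace seq_scale ell2
  by (rule ell2_complex_subspace)

lemma seminorm_ell2_norm: "seminorm_on seq_scale ell2 ell2_norm"
  by (auto simp: seminorm_on_def ell2_eq ell2_norm_eq wnorm_nonneg wl2_scale intro: wl2_add)

lemma ell2_product:
  assumes "\<xi> \<in> ell2" "\<eta> \<in> ell2"
  shows "summable (\<lambda>j. cmod (\<xi> j * cnj (\<eta> j)))"
    "(\<Sum>j. cmod (\<xi> j * cnj (\<eta> j))) \<le> ell2_norm \<xi> * ell2_norm \<eta>"
proof -
  have le: "(\<Sum>j<n. cmod (\<xi> j * cnj (\<eta> j))) \<le> ell2_norm \<xi> * ell2_norm \<eta>" for n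
  proof -
    have "(\<Sum>j<n. \<bar>cmod (\<xi> j)\<bar> * (cmod (\<eta> j) * 1)) \<le> L2_set (\<lambda>j. cmod (\<xi> j)) {..<n} * wnorm (\<lambda>_. 1) \<eta>"
      using assms by (intro wl2_sum_le) (auto simp: ell2_eq)
    also have "\<dots> \<le> wnorm (\<lambda>_. 1) \<xi> * wnorm (\<lambda>_. 1) \<eta>"
      using assms L2_set_le_wnorm[of \<xi> "\<lambda>_. 1" "{..<n}"]
      by (intro mult_right_mono) (auto simp: ell2_eq wnorm_nonneg)
    finally show ?thesis
      by (simp add: norm_mult ell2_norm_eq)
  qed
  show "summable (\<lambda>j. cmod (\<xi> j * cnj (\<eta> j)))"
    using le by (intro summableI_nonneg_bounded) auto
  then show "(\<Sum>j. cmod (\<xi> j * cnj (\<eta> j))) \<le> ell2_norm \<xi> * ell2_norm \<eta>"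
    using le by (intro suminf_le_const) auto
qed

lemma ell2_inner_summable:
  assumes "\<xi> \<in> ell2" "\<eta> \<in> ell2"
  shows "summable (\<lambda>j. \<xi> j * cnj (\<eta> j))"
  using summable_norm_cancel[OF ell2_product(1)[OF assms]] .

lemma Cauchy_Schwarz_ell2:
  assumes "\<xi> \<in> ell2" "\<eta> \<in> ell2"
  shows "cmod (ell2_inner \<xi> \<eta>) \<le> ell2_norm \<xi> * ell2_norm \<eta>"
  using order_trans[OF summable_norm ell2_product(2)] ell2_product(1) assms
  by (simp add: ell2_inner_def)

lemma ell2_inner_add_left:
  assumes "\<xi> \<in> ell2" "\<xi>' \<in> ell2" "\<eta> \<in> ell2"
  shows "ell2_inner (\<xi> + \<xi>') \<eta> = ell2_inner \<xi> \<eta> + ell2_inner \<xi>' \<eta>"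
  using suminf_add[OF ell2_inner_summable[OF assms(1,3)] ell2_inner_summable[OF assms(2,3)]]
  by (simp add: ell2_inner_def algebra_simps)

lemma ell2_inner_scale_left:
  assumes "\<xi> \<in> ell2" "\<eta> \<in> ell2"
  shows "ell2_inner (seq_scale c \<xi>) \<eta> = c * ell2_inner \<xi> \<eta>"
  using suminf_mult[OF ell2_inner_summable[OF assms], of c]
  by (simp add: ell2_inner_def seq_scale_def algebra_simps)

lemma ell2_inner_commute:
  assumes "\<xi> \<in> ell2" "\<eta> \<in> ell2"
  shows "ell2_inner \<eta> \<xi> = cnj (ell2_inner \<xi> \<eta>)"
proof -
  have "(\<lambda>j. cnj (\<xi> j * cnj (\<eta> j))) sums cnj (ell2_inner \<xi> \<eta>)"
    unfolding ell2_inner_def using summable_sums[OF ell2_inner_summable[OF assms]] by (simp only: sums_cnj)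
  then show ?thesis
    by (simp add: ell2_inner_def sums_iff mult.commute)
qed

lemma ell2_inner_add_right:
  assumes "\<xi> \<in> ell2" "\<eta> \<in> ell2" "\<eta>' \<in> ell2"
  shows "ell2_inner \<xi> (\<eta> + \<eta>') = ell2_inner \<xi> \<eta> + ell2_inner \<xi> \<eta>'"
  using assms ell2_inner_add_left[of \<eta> \<eta>' \<xi>] ell2.add_mem[of \<eta> \<eta>']
  by (simp add: ell2_inner_commute[of _ \<xi>])

lemma ell2_inner_scale_right:
  assumes "\<xi> \<in> ell2" "\<eta> \<in> ell2"
  shows "ell2_inner \<xi> (seq_scale c \<eta>) = cnj c * ell2_inner \<xi> \<eta>"
  using assms ell2_inner_scale_left[of \<eta> \<xi> c] ell2.scale_mem[of \<eta> c]
  by (simp add: ell2_inner_commute[of _ \<xi>])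

lemma ell2_inner_self:
  assumes "\<xi> \<in> ell2"
  shows "ell2_inner \<xi> \<xi> = complex_of_real ((ell2_norm \<xi>)\<^sup>2)"
proof -
  have sm: "summable (\<lambda>j. (cmod (\<xi> j))\<^sup>2)"
    using assms by (simp add: ell2_def)
  have "(\<Sum>j. complex_of_real ((cmod (\<xi> j))\<^sup>2)) = complex_of_real (\<Sum>j. (cmod (\<xi> j))\<^sup>2)"
    by (rule suminf_of_real[OF sm, symmetric])
  moreover have "0 \<le> (\<Sum>j. (cmod (\<xi> j))\<^sup>2)"
    using sm by (simp add: suminf_nonneg)
  ultimately show ?thesis
    by (simp add: ell2_inner_def ell2_norm_def complex_norm_square[symmetric])
qed

lemma ell2_inner_unit_seq: "ell2_inner \<xi> (unit_seq k) = \<xi> k" "ell2_inner (unit_seq k) \<xi> = cnj (\<xi> k)"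
proof -
  have "ell2_inner \<xi> (unit_seq k) = (\<Sum>j\<in>{k}. \<xi> j * cnj (unit_seq k j))"
    unfolding ell2_inner_def by (rule suminf_finite) (auto simp: unit_seq_def)
  moreover have "ell2_inner (unit_seq k) \<xi> = (\<Sum>j\<in>{k}. unit_seq k j * cnj (\<xi> j))"
    unfolding ell2_inner_def by (rule suminf_finite) (auto simp: unit_seq_def)
  ultimately show "ell2_inner \<xi> (unit_seq k) = \<xi> k" "ell2_inner (unit_seq k) \<xi> = cnj (\<xi> k)"
    by (simp_all add: unit_seq_def)
qed

lemma ell2_inner_trunc_tendsto:
  assumes "\<xi> \<in> ell2" "\<eta> \<in> ell2"
  shows "(\<lambda>n. ell2_inner (trunc n \<xi>) \<eta>) \<longlonglongrightarrow> ell2_inner \<xi> \<eta>"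
proof -
  have "ell2_inner (trunc n \<xi>) \<eta> = (\<Sum>j<n. \<xi> j * cnj (\<eta> j))" for n
    unfolding ell2_inner_def
    by (subst suminf_finite[of "{..<n}"]) (auto simp: trunc_def)
  then show ?thesis
    using summable_LIMSEQ[OF ell2_inner_summable[OF assms]] by (simp add: ell2_inner_def)
qed

text \<open>Cauchy-Schwarz, with the whole weight put on one of the two factors
  \<open>cmod (\<xi> j)\<close>.\<close>

lemma s_norm_interpolation:
  assumes "\<xi> \<in> s_space"
  shows "(s_norm N \<xi>)\<^sup>2 \<le> ell2_norm \<xi> * s_norm (2 * N) \<xi>"
proof -
  have "(\<Sum>j. (cmod (\<xi> j) * s_weight N j)\<^sup>2) \<le> ell2_norm \<xi> * s_norm (2 * N) \<xi>"
  proof (rule suminf_le_const)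
    show "summable (\<lambda>j. (cmod (\<xi> j) * s_weight N j)\<^sup>2)"
      using s_space_wl2[OF assms, of N] by (simp add: wl2_def)
    fix n
    have "(\<Sum>j<n. (cmod (\<xi> j) * s_weight N j)\<^sup>2) = (\<Sum>j<n. \<bar>cmod (\<xi> j)\<bar> * (cmod (\<xi> j) * s_weight (2 * N) j))"
      by (intro sum.cong) (auto simp: power_mult_distrib power2_eq_square mult_2 power_add)
    also have "\<dots> \<le> L2_set (\<lambda>j. cmod (\<xi> j)) {..<n} * s_norm (2 * N) \<xi>"
      unfolding s_norm_eq by (intro wl2_sum_le s_space_wl2[OF assms]) auto
    also have "\<dots> \<le> ell2_norm \<xi> * s_norm (2 * N) \<xi>"
      using L2_set_le_wnorm[of \<xi> "\<lambda>_. 1" "{..<n}"] s_subset_ell2[OF assms]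
        wnorm_nonneg[OF s_space_wl2[OF assms]]
      by (intro mult_right_mono) (auto simp: ell2_eq ell2_norm_eq s_norm_eq)
    finally show "(\<Sum>j<n. (cmod (\<xi> j) * s_weight N j)\<^sup>2) \<le> ell2_norm \<xi> * s_norm (2 * N) \<xi>" .
  qed
  moreover have "0 \<le> (\<Sum>j. (cmod (\<xi> j) * s_weight N j)\<^sup>2)"
    using s_space_wl2[OF assms, of N] by (simp add: wl2_def suminf_nonneg)
  ultimately show ?thesis
    by (simp add: s_norm_eq wnorm_def)
qed

section \<open>The *-algebra \<open>L\<^sup>*(s)\<close>\<close>

text \<open>The unit sequences lie in \<open>s_space\<close>, and testing against them fixes every
  coordinate of the adjoint vector.\<close>

lemma hilbert_adjoint_eqI:
  assumes "\<zeta> \<in> ell2" "\<And>\<xi>. \<xi> \<in> s_space \<Longrightarrow> ell2_inner (x \<xi>) \<eta> = ell2_inner \<xi> \<zeta>"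
  shows "hilbert_adjoint x \<eta> = \<zeta>"
  unfolding hilbert_adjoint_def
proof (rule the_equality)
  fix \<zeta>' assume *: "\<zeta>' \<in> ell2 \<and> (\<forall>\<xi>\<in>s_space. ell2_inner (x \<xi>) \<eta> = ell2_inner \<xi> \<zeta>')"
  show "\<zeta>' = \<zeta>"
  proof
    fix k
    have "ell2_inner (unit_seq k) \<zeta> = ell2_inner (unit_seq k) \<zeta>'"
      using assms(2)[of "unit_seq k"] * s.unit_seq_mem by simp
    then show "\<zeta>' k = \<zeta> k"
      by (simp add: ell2_inner_unit_seq)
  qed
qed (use assms in blast)

text \<open>A formal adjoint \<open>y\<close> that maps \<open>s_space\<close> into itself is the
  Hilbert space adjoint there. Exhibiting one therefore settles membership in \<open>Lstar\<close>
  and computes the involution at once.\<close>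

lemma LstarI:
  assumes "linear_map_on seq_scale seq_scale s_space x" "x ` s_space \<subseteq> s_space"
    "\<And>\<xi>. \<xi> \<notin> s_space \<Longrightarrow> x \<xi> = 0"
    "\<And>\<eta>. \<eta> \<in> s_space \<Longrightarrow> y \<eta> \<in> s_space"
    "\<And>\<xi> \<eta>. \<xi> \<in> s_space \<Longrightarrow> \<eta> \<in> s_space \<Longrightarrow> ell2_inner (x \<xi>) \<eta> = ell2_inner \<xi> (y \<eta>)"
  shows "x \<in> Lstar" "\<eta> \<in> s_space \<Longrightarrow> Lstar_star x \<eta> = y \<eta>"
proof -
  have *: "hilbert_adjoint x \<eta> = y \<eta>" if "\<eta> \<in> s_space" for \<eta>
    using assms that by (intro hilbert_adjoint_eqI) (auto simp: s_subset_ell2)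
  then show "\<eta> \<in> s_space \<Longrightarrow> Lstar_star x \<eta> = y \<eta>"
    by (simp add: Lstar_star_def)
  have "s_space \<subseteq> adjoint_domain x"
    using assms(4,5) by (auto simp: adjoint_domain_def s_subset_ell2 intro!: bexI[of _ "y _"])
  then show "x \<in> Lstar"
    unfolding Lstar_def using assms * by auto
qed

lemma LstarD:
  assumes "x \<in> Lstar"
  shows "linear_map_on seq_scale seq_scale s_space x" "\<xi> \<in> s_space \<Longrightarrow> x \<xi> \<in> s_space"
    "\<xi> \<notin> s_space \<Longrightarrow> x \<xi> = 0" "\<eta> \<in> s_space \<Longrightarrow> Lstar_star x \<eta> \<in> s_space"
  using assms by (auto simp: Lstar_def Lstar_star_def)

lemma Lstar_adjoint:
  assumes "x \<in> Lstar" "\<xi> \<in> s_space" "\<eta> \<in> s_space"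
  shows "ell2_inner (x \<xi>) \<eta> = ell2_inner \<xi> (Lstar_star x \<eta>)"
proof -
  have "\<eta> \<in> adjoint_domain x"
    using assms by (auto simp: Lstar_def)
  then obtain \<zeta> where \<zeta>: "\<zeta> \<in> ell2" "\<And>\<xi>. \<xi> \<in> s_space \<Longrightarrow> ell2_inner (x \<xi>) \<eta> = ell2_inner \<xi> \<zeta>"
    by (auto simp: adjoint_domain_def)
  have "Lstar_star x \<eta> = \<zeta>"
    using hilbert_adjoint_eqI[OF \<zeta>] assms(3) by (simp add: Lstar_star_def)
  then show ?thesis
    using \<zeta>(2) assms(2) by simp
qed

text \<open>Makes each coordinate of \<open>x \<xi>\<close> an inner product with a fixed vector,
  hence continuous for the \<open>ell2\<close> norm and defined for all of
  \<open>ell2\<close>.\<close>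

lemma Lstar_component:
  assumes "x \<in> Lstar" "\<xi> \<in> s_space"
  shows "x \<xi> i = ell2_inner \<xi> (Lstar_star x (unit_seq i))"
  using Lstar_adjoint[OF assms s.unit_seq_mem[of i]] by (simp add: ell2_inner_unit_seq)

lemma Lstar_adjoint':
  assumes "x \<in> Lstar" "\<xi> \<in> s_space" "\<eta> \<in> s_space"
  shows "ell2_inner (Lstar_star x \<xi>) \<eta> = ell2_inner \<xi> (x \<eta>)"
proof -
  have m: "\<xi> \<in> ell2" "\<eta> \<in> ell2" "x \<eta> \<in> ell2" "Lstar_star x \<xi> \<in> ell2"
    using LstarD(2,4)[OF assms(1)] s_subset_ell2 assms by auto
  have "ell2_inner (Lstar_star x \<xi>) \<eta> = cnj (ell2_inner \<eta> (Lstar_star x \<xi>))"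
    using ell2_inner_commute[OF m(2,4)] .
  also have "\<dots> = cnj (ell2_inner (x \<eta>) \<xi>)"
    using Lstar_adjoint[OF assms(1,3,2)] by simp
  also have "\<dots> = ell2_inner \<xi> (x \<eta>)"
    using ell2_inner_commute[OF m(3,1)] by simp
  finally show ?thesis .
qed

lemma Lstar_star_linear:
  assumes "x \<in> Lstar"
  shows "linear_map_on seq_scale seq_scale s_space (Lstar_star x)"
proof -
  have inner: "ell2_inner (Lstar_star x \<xi>) (unit_seq k) = ell2_inner \<xi> (x (unit_seq k))" if "\<xi> \<in> s_space" for \<xi> k
    using Lstar_adjoint'[OF assms that s.unit_seq_mem] .
  have e: "x (unit_seq k) \<in> ell2" for k
    using LstarD(2)[OF assms s.unit_seq_mem] s_subset_ell2 by blast
  show ?thesis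
    unfolding linear_map_on_def
  proof (intro conjI ballI allI ext)
    fix \<xi> \<eta> k assume "\<xi> \<in> s_space" "\<eta> \<in> s_space"
    then show "Lstar_star x (\<xi> + \<eta>) k = (Lstar_star x \<xi> + Lstar_star x \<eta>) k"
      using inner[of "\<xi> + \<eta>" k] inner[of \<xi> k] inner[of \<eta> k] ell2_inner_add_left[of \<xi> \<eta> "x (unit_seq k)"] e
        s.add_mem[of \<xi> \<eta>] by (simp add: ell2_inner_unit_seq s_subset_ell2)
  next
    fix c \<xi> k assume "\<xi> \<in> s_space"
    then show "Lstar_star x (seq_scale c \<xi>) k = seq_scale c (Lstar_star x \<xi>) k"
      using inner[of "seq_scale c \<xi>" k] inner[of \<xi> k] ell2_inner_scale_left[of \<xi> "x (unit_seq k)" c] e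
        s.scale_mem[of \<xi> c] by (simp add: ell2_inner_unit_seq s_subset_ell2 seq_scale_def)
  qed
qed

lemma Lstar_star_Lstar:
  assumes "x \<in> Lstar"
  shows "Lstar_star x \<in> Lstar"
  using LstarD[OF assms] Lstar_star_linear[OF assms] Lstar_adjoint'[OF assms]
  by (intro LstarI(1)[of _ x]) (auto simp: Lstar_star_def)

lemma Lstar_add:
  assumes "x \<in> Lstar" "y \<in> Lstar"
  shows "x + y \<in> Lstar" "Lstar_star (x + y) = Lstar_star x + Lstar_star y"
proof -
  note D = LstarD[OF assms(1)] LstarD[OF assms(2)]
  have lin: "linear_map_on seq_scale seq_scale s_space (x + y)"
    using D(1,5) by (auto simp: linear_map_on_def seq_scale_def algebra_simps fun_eq_iff)
  have im: "(x + y) ` s_space \<subseteq> s_space"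
    using D(2,6) s.add_mem by auto
  have zero: "(x + y) \<xi> = 0" if "\<xi> \<notin> s_space" for \<xi>
    using D(3,7) that by simp
  have st: "(Lstar_star x + Lstar_star y) \<eta> \<in> s_space" if "\<eta> \<in> s_space" for \<eta>
    using D(4,8) that s.add_mem by simp
  have adj: "ell2_inner ((x + y) \<xi>) \<eta> = ell2_inner \<xi> ((Lstar_star x + Lstar_star y) \<eta>)"
    if "\<xi> \<in> s_space" "\<eta> \<in> s_space" for \<xi> \<eta>
    using that D(2,4,6,8) Lstar_adjoint[OF assms(1)] Lstar_adjoint[OF assms(2)]
    by (simp add: ell2_inner_add_left ell2_inner_add_right s_subset_ell2)
  show "x + y \<in> Lstar"
    by (rule LstarI(1)[OF lin im zero st adj])
  show "Lstar_star (x + y) = Lstar_star x + Lstar_star y"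
  proof
    show "Lstar_star (x + y) \<eta> = (Lstar_star x + Lstar_star y) \<eta>" for \<eta>
    proof (cases "\<eta> \<in> s_space")
      case True
      show ?thesis
        by (rule LstarI(2)[OF lin im zero st adj]) (use True in auto)
    qed (simp add: Lstar_star_def)
  qed
qed

lemma Lstar_scale:
  assumes "x \<in> Lstar"
  shows "op_scale c x \<in> Lstar" "Lstar_star (op_scale c x) = op_scale (cnj c) (Lstar_star x)"
proof -
  note D = LstarD[OF assms]
  have lin: "linear_map_on seq_scale seq_scale s_space (op_scale c x)"
    using D(1) by (auto simp: linear_map_on_def seq_scale_def op_scale_def algebra_simps fun_eq_iff)
  have im: "op_scale c x ` s_space \<subseteq> s_space"
    using D(2) s.scale_mem by (auto simp: op_scale_def)
  have zero: "op_scale c x \<xi> = 0" if "\<xi> \<notin> s_space" for \<xi>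
    using D(3) that by (simp add: op_scale_def)
  have st: "op_scale (cnj c) (Lstar_star x) \<eta> \<in> s_space" if "\<eta> \<in> s_space" for \<eta>
    using D(4) that s.scale_mem by (simp add: op_scale_def)
  have adj: "ell2_inner (op_scale c x \<xi>) \<eta> = ell2_inner \<xi> (op_scale (cnj c) (Lstar_star x) \<eta>)"
    if "\<xi> \<in> s_space" "\<eta> \<in> s_space" for \<xi> \<eta>
    using that D(2,4) Lstar_adjoint[OF assms]
    by (simp add: ell2_inner_scale_left ell2_inner_scale_right s_subset_ell2 op_scale_def)
  show "op_scale c x \<in> Lstar"
    by (rule LstarI(1)[OF lin im zero st adj])
  show "Lstar_star (op_scale c x) = op_scale (cnj c) (Lstar_star x)"
  proof
    show "Lstar_star (op_scale c x) \<eta> = op_scale (cnj c) (Lstar_star x) \<eta>" for \<eta>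
      using LstarI(2)[OF lin im zero st adj, of \<eta>]
      by (cases "\<eta> \<in> s_space") (auto simp: Lstar_star_def op_scale_def)
  qed
qed

lemma Lstar_complex_subspace: "complex_subspace op_scale Lstar"
proof -
  interpret vector_space op_scale
    by (rule vector_space_op_scale)
  have "linear_map_on seq_scale seq_scale s_space 0"
    by (auto simp: linear_map_on_def seq_scale_def fun_eq_iff)
  then have "0 \<in> Lstar"
    using s.zero_mem by (intro LstarI(1)[of 0 0]) (auto simp: ell2_inner_def)
  then show ?thesis
    by unfold_locales (auto simp: subspace_def Lstar_add Lstar_scale)
qed

text \<open>Uniform boundedness takes the place of the closed graph theorem: each finite section
  \<open>f K\<close> involves finitely many coordinates, which are continuous through the adjoint,
  and the supremum over \<open>K\<close> is the norm of \<open>x \<xi>\<close>.\<close>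

lemma Lstar_continuous:
  assumes x: "x \<in> Lstar"
  shows "\<exists>r. \<exists>C>0. \<forall>\<xi>\<in>s_space. s_norm N (x \<xi>) \<le> C * s_norm r \<xi>"
proof -
  define f where "f = (\<lambda>K \<xi>. L2_set (\<lambda>i. cmod (x \<xi> i) * s_weight N i) {..<K::nat})"
  note D = LstarD[OF x]
  have "\<exists>r. \<exists>C>0. \<forall>K\<in>UNIV. \<forall>\<xi>\<in>s_space. f K \<xi> \<le> C * s_norm r \<xi>"
  proof (rule s.uniform_boundedness)
    fix K :: nat
    show "seminorm_on seq_scale s_space (f K)"
      unfolding seminorm_on_def
    proof (intro conjI ballI allI)
      fix \<xi> \<eta> assume *: "\<xi> \<in> s_space" "\<eta> \<in> s_space"
      have "f K (\<xi> + \<eta>) \<le> L2_set (\<lambda>i. cmod (x \<xi> i) * s_weight N i + cmod (x \<eta> i) * s_weight N i) {..<K}"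
        unfolding f_def
      proof (rule L2_set_mono)
        show "cmod (x (\<xi> + \<eta>) i) * s_weight N i \<le> cmod (x \<xi> i) * s_weight N i + cmod (x \<eta> i) * s_weight N i" for i
          using linear_map_onD(1)[OF D(1) *] norm_triangle_ineq[of "x \<xi> i" "x \<eta> i"]
          by (simp add: distrib_right[symmetric] mult_right_mono)
      qed auto
      also note L2_set_triangle_ineq
      finally show "f K (\<xi> + \<eta>) \<le> f K \<xi> + f K \<eta>"
        by (simp add: f_def)
    next
      fix c \<xi> assume *: "\<xi> \<in> s_space"
      show "f K (seq_scale c \<xi>) = cmod c * f K \<xi>"
        using linear_map_onD(2)[OF D(1) *, of c]
        by (simp add: f_def seq_scale_def L2_set_right_distrib norm_mult mult.assoc)
    qed (simp add: f_def)
    have le: "f K \<xi> \<le> (\<Sum>i<K. ell2_norm (Lstar_star x (unit_seq i)) * s_weight N i) * s_norm 0 \<xi>" if \<xi>: "\<xi> \<in> s_space" for \<xi>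
    proof -
      have "f K \<xi> \<le> (\<Sum>i<K. cmod (x \<xi> i) * s_weight N i)"
        unfolding f_def by (rule L2_set_le_sum) auto
      also have "\<dots> \<le> (\<Sum>i<K. (ell2_norm (Lstar_star x (unit_seq i)) * s_weight N i) * s_norm 0 \<xi>)"
      proof (rule sum_mono)
        fix i
        have "cmod (x \<xi> i) \<le> ell2_norm \<xi> * ell2_norm (Lstar_star x (unit_seq i))"
          unfolding Lstar_component[OF x \<xi>]
          by (intro Cauchy_Schwarz_ell2 s_subset_ell2 \<xi> D(4) s.unit_seq_mem)
        then have "cmod (x \<xi> i) * s_weight N i \<le> (ell2_norm \<xi> * ell2_norm (Lstar_star x (unit_seq i))) * s_weight N i"
          by (intro mult_right_mono) auto
        then show "cmod (x \<xi> i) * s_weight N i \<le> (ell2_norm (Lstar_star x (unit_seq i)) * s_weight N i) * s_norm 0 \<xi>"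
          by (simp add: s_norm_0 mult_ac)
      qed
      finally show ?thesis
        by (simp add: sum_distrib_right)
    qed
    then show "\<exists>r C. \<forall>\<xi>\<in>s_space. f K \<xi> \<le> C * s_norm r \<xi>"
      by blast
  next
    fix \<xi> assume "\<xi> \<in> s_space"
    then show "\<exists>M. \<forall>K\<in>UNIV. f K \<xi> \<le> M"
      using L2_set_le_wnorm[OF s_space_wl2[OF D(2)], of \<xi>] by (auto simp: f_def)
  qed
  then show ?thesis
    using wl2_bound(2)[of "x _" "s_weight N"] unfolding f_def s_norm_eq by blast
qed

lemma Lstar_bounded:
  assumes "x \<in> Lstar" "s_bounded B"
  shows "bdd_above ((\<lambda>\<xi>. s_norm N (x \<xi>)) ` B)"
proof -
  obtain r C where C: "C > 0" "\<And>\<xi>. \<xi> \<in> s_space \<Longrightarrow> s_norm N (x \<xi>) \<le> C * s_norm r \<xi>"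
    using Lstar_continuous[OF assms(1)] by blast
  obtain D where D: "\<And>\<xi>. \<xi> \<in> B \<Longrightarrow> s_norm r \<xi> \<le> D"
    using assms(2) unfolding s_bounded_def by blast
  have "s_norm N (x \<xi>) \<le> C * D" if "\<xi> \<in> B" for \<xi>
    using order_trans[OF C(2) mult_left_mono[OF D[OF that]]] C(1) that assms(2)
    by (auto simp: s_bounded_def)
  then show ?thesis
    by (intro bdd_aboveI2)
qed

lemma Lstar_seminorm_le:
  assumes "x \<in> Lstar" "s_bounded B" "\<xi> \<in> B"
  shows "s_norm N (x \<xi>) \<le> Lstar_seminorm N B x" "s_norm N (Lstar_star x \<xi>) \<le> Lstar_seminorm N B x"
  unfolding Lstar_seminorm_def
  using cSUP_upper[OF assms(3) Lstar_bounded[OF assms(1,2)]]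
    cSUP_upper[OF assms(3) Lstar_bounded[OF Lstar_star_Lstar[OF assms(1)] assms(2)]]
  by (simp_all add: le_max_iff_disj)

lemma Lstar_seminorm_least:
  assumes "B \<noteq> {}" "\<And>\<xi>. \<xi> \<in> B \<Longrightarrow> s_norm N (x \<xi>) \<le> C" "\<And>\<xi>. \<xi> \<in> B \<Longrightarrow> s_norm N (Lstar_star x \<xi>) \<le> C"
  shows "Lstar_seminorm N B x \<le> C"
  unfolding Lstar_seminorm_def using assms by (auto intro: cSUP_least)

lemma s_norm_nonneg: "\<xi> \<in> s_space \<Longrightarrow> 0 \<le> s_norm N \<xi>"
  using seminorm_onD(1)[OF s.seminorm_p] .

section \<open>The topology \<open>tau_star\<close>\<close>

definition Lstar_seminorms :: "(seq_op \<Rightarrow> real) set"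
  where "Lstar_seminorms = {Lstar_seminorm N B | N B. s_bounded B \<and> B \<noteq> {}}"

lemma tau_star_eq: "tau_star = seminorm_topology Lstar Lstar_seminorms"
  by (simp add: tau_star_def Lstar_seminorms_def)

lemma seminorm_Lstar_seminorm:
  assumes B: "s_bounded B" "B \<noteq> {}"
  shows "seminorm_on op_scale Lstar (Lstar_seminorm N B)"
proof -
  have Bs: "B \<subseteq> s_space"
    using B by (simp add: s_bounded_def)
  note tri = seminorm_onD(3)[OF s.seminorm_p]
  have scale_le: "Lstar_seminorm N B (op_scale c x) \<le> cmod c * Lstar_seminorm N B x" if x: "x \<in> Lstar" for c x
  proof (rule Lstar_seminorm_least[OF B(2)])
    fix \<xi> assume \<xi>: "\<xi> \<in> B"
    then have "\<xi> \<in> s_space"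
      using Bs by blast
    then have "s_norm N (op_scale c x \<xi>) = cmod c * s_norm N (x \<xi>)"
      "s_norm N (Lstar_star (op_scale c x) \<xi>) = cmod c * s_norm N (Lstar_star x \<xi>)"
      unfolding Lstar_scale(2)[OF x] using LstarD(2,4)[OF x] seminorm_onD(2)[OF s.seminorm_p]
      by (simp_all add: op_scale_def)
    then show "s_norm N (op_scale c x \<xi>) \<le> cmod c * Lstar_seminorm N B x"
      "s_norm N (Lstar_star (op_scale c x) \<xi>) \<le> cmod c * Lstar_seminorm N B x"
      using Lstar_seminorm_le[OF x B(1) \<xi>, of N] by (simp_all add: mult_left_mono)
  qed
  show ?thesis
    unfolding seminorm_on_def
  proof (intro conjI ballI allI)
    fix x assume x: "x \<in> Lstar"
    obtain \<xi> where "\<xi> \<in> B"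
      using B by blast
    then show "0 \<le> Lstar_seminorm N B x"
      using Lstar_seminorm_le(1)[OF x B(1), of \<xi> N] s_norm_nonneg[OF LstarD(2)[OF x], of \<xi> N] Bs by force
  next
    fix c x assume x: "x \<in> Lstar"
    \<comment> \<open>The reverse inequality is \<open>scale_le\<close> applied to the factor
      \<open>1 / c\<close>; for \<open>c = 0\<close> it reduces to nonnegativity.\<close>
    have "cmod c * Lstar_seminorm N B x \<le> Lstar_seminorm N B (op_scale c x)"
    proof (cases "c = 0")
      case True
      obtain \<xi> where "\<xi> \<in> B"
        using B by blast
      then show ?thesis
        using True Lstar_seminorm_le(1)[OF Lstar_scale(1)[OF x] B(1), of \<xi> N c]
          s_norm_nonneg[OF LstarD(2)[OF Lstar_scale(1)[OF x]], of \<xi> N c] Bs by force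
    next
      case False
      have "op_scale (1 / c) (op_scale c x) = x"
        using False by (auto simp: op_scale_def seq_scale_def)
      then have "Lstar_seminorm N B x \<le> cmod (1 / c) * Lstar_seminorm N B (op_scale c x)"
        using scale_le[OF Lstar_scale(1)[OF x, of c], of "1 / c"] by simp
      then show ?thesis
        using False by (simp add: norm_divide field_simps)
    qed
    then show "Lstar_seminorm N B (op_scale c x) = cmod c * Lstar_seminorm N B x"
      using scale_le[OF x, of c] by simp
  next
    fix x y assume x: "x \<in> Lstar" and y: "y \<in> Lstar"
    show "Lstar_seminorm N B (x + y) \<le> Lstar_seminorm N B x + Lstar_seminorm N B y"
    proof (rule Lstar_seminorm_least[OF B(2)])
      fix \<xi> assume \<xi>: "\<xi> \<in> B"
      then have "\<xi> \<in> s_space"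
        using Bs by blast
      then have "s_norm N ((x + y) \<xi>) \<le> s_norm N (x \<xi>) + s_norm N (y \<xi>)"
        "s_norm N (Lstar_star (x + y) \<xi>) \<le> s_norm N (Lstar_star x \<xi>) + s_norm N (Lstar_star y \<xi>)"
        using LstarD(2,4)[OF x] LstarD(2,4)[OF y] tri by (simp_all add: Lstar_add[OF x y])
      then show "s_norm N ((x + y) \<xi>) \<le> Lstar_seminorm N B x + Lstar_seminorm N B y"
        "s_norm N (Lstar_star (x + y) \<xi>) \<le> Lstar_seminorm N B x + Lstar_seminorm N B y"
        using Lstar_seminorm_le[OF x B(1) \<xi>, of N] Lstar_seminorm_le[OF y B(1) \<xi>, of N] by linarith+
    qed
  qed
qed

lemma s_norm_mono: "\<xi> \<in> s_space \<Longrightarrow> M \<le> N \<Longrightarrow> s_norm M \<xi> \<le> s_norm N \<xi>"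
  using s.p_mono .

lemma Lstar_seminorm_mono:
  assumes "x \<in> Lstar" "M \<le> N" "B \<subseteq> B'" "B \<noteq> {}" "s_bounded B'"
  shows "Lstar_seminorm M B x \<le> Lstar_seminorm N B' x"
proof (rule Lstar_seminorm_least[OF assms(4)])
  fix \<xi> assume \<xi>: "\<xi> \<in> B"
  have "\<xi> \<in> B'" "\<xi> \<in> s_space"
    using \<xi> assms by (auto simp: s_bounded_def)
  then show "s_norm M (x \<xi>) \<le> Lstar_seminorm N B' x" "s_norm M (Lstar_star x \<xi>) \<le> Lstar_seminorm N B' x"
    using Lstar_seminorm_le[OF assms(1,5), of \<xi> N] LstarD(2,4)[OF assms(1)] s_norm_mono[OF _ assms(2)]
    by (meson order_trans)+
qed

interpretation Lstar: directed_seminorms op_scale Lstar Lstar_seminorms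
proof -
  interpret complex_subspace op_scale Lstar
    by (rule Lstar_complex_subspace)
  have bdd_single: "s_bounded {0}"
    using s.zero_mem by (auto simp: s_bounded_def)
  have bdd_Un: "s_bounded (B \<union> B')" if B: "s_bounded B" "s_bounded B'" for B B'
  proof -
    have "\<exists>C. \<forall>\<xi>\<in>B \<union> B'. s_norm q \<xi> \<le> C" for q
    proof -
      obtain C D where "\<forall>\<xi>\<in>B. s_norm q \<xi> \<le> C" "\<forall>\<xi>\<in>B'. s_norm q \<xi> \<le> D"
        using B[unfolded s_bounded_def] by blast
      then show ?thesis
        by (intro exI[of _ "max C D"]) (auto simp: le_max_iff_disj)
    qed
    then show ?thesis
      using that by (auto simp: s_bounded_def)
  qed
  show "directed_seminorms op_scale Lstar Lstar_seminorms"
  proof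
    show "Lstar_seminorms \<noteq> {}"
      using bdd_single by (auto simp: Lstar_seminorms_def)
  next
    fix p assume "p \<in> Lstar_seminorms"
    then show "seminorm_on op_scale Lstar p"
      using seminorm_Lstar_seminorm by (auto simp: Lstar_seminorms_def)
  next
    fix p q assume "p \<in> Lstar_seminorms" "q \<in> Lstar_seminorms"
    then obtain M N A B where *: "p = Lstar_seminorm M A" "q = Lstar_seminorm N B" "s_bounded A"
      "s_bounded B" "A \<noteq> {}" "B \<noteq> {}"
      unfolding Lstar_seminorms_def by blast
    then show "\<exists>r\<in>Lstar_seminorms. \<forall>x\<in>Lstar. p x \<le> r x \<and> q x \<le> r x"
      using bdd_Un[of A B]
      by (intro bexI[of _ "Lstar_seminorm (max M N) (A \<union> B)"] ballI conjI)
        (auto intro!: Lstar_seminorm_mono simp: Lstar_seminorms_def)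
  qed
qed

lemma s_bounded_singleton: "\<xi> \<in> s_space \<Longrightarrow> s_bounded {\<xi>}"
  by (auto simp: s_bounded_def)

lemma Lstar_ext:
  assumes "x \<in> Lstar" "y \<in> Lstar" "\<And>\<xi>. \<xi> \<in> s_space \<Longrightarrow> x \<xi> = y \<xi>"
  shows "x = y"
  using assms LstarD(3) by (metis ext)

lemma Hausdorff_tau_star: "Hausdorff_space tau_star"
  unfolding Hausdorff_space_def
proof (intro allI impI)
  fix x y assume "x \<in> topspace tau_star \<and> y \<in> topspace tau_star \<and> x \<noteq> y"
  then have xy: "x \<in> Lstar" "y \<in> Lstar" "x \<noteq> y"
    by (auto simp: tau_star_eq)
  then obtain \<xi> where \<xi>: "\<xi> \<in> s_space" "x \<xi> \<noteq> y \<xi>"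
    using Lstar_ext by blast
  then obtain k where k: "(x - y) \<xi> k \<noteq> 0"
    by (auto simp: fun_eq_iff)
  let ?p = "Lstar_seminorm 0 {\<xi>}"
  have p: "?p \<in> Lstar_seminorms"
    using s_bounded_singleton[OF \<xi>(1)] by (auto simp: Lstar_seminorms_def)
  have d: "x - y \<in> Lstar"
    using Lstar.diff_mem xy by blast
  have "cmod ((x - y) \<xi> k) \<le> s_norm 0 ((x - y) \<xi>)"
    using s.component_le[OF LstarD(2)[OF d \<xi>(1)]] .
  then have pos: "?p (x - y) > 0"
    using Lstar_seminorm_le(1)[OF d s_bounded_singleton[OF \<xi>(1)], of \<xi> 0] zero_less_norm_iff[of "(x - y) \<xi> k"] k by (simp del: zero_less_norm_iff)
  let ?U = "\<lambda>z. {w \<in> Lstar. ?p (w - z) < ?p (x - y) / 2}"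
  have "openin tau_star (?U x)" "openin tau_star (?U y)"
    unfolding tau_star_eq using Lstar.openin_ball[OF p] xy by blast+
  moreover have "x \<in> ?U x" "y \<in> ?U y"
    using xy pos Lstar.seminorm_zero[OF Lstar.seminorm_P[OF p]] by auto
  moreover have "disjnt (?U x) (?U y)"
    unfolding disjnt_iff
  proof (intro allI notI)
    fix w assume w: "w \<in> ?U x \<and> w \<in> ?U y"
    then show False
      using Lstar.seminorm_triangle[OF Lstar.seminorm_P[OF p], of x w y]
        Lstar.seminorm_commute[OF Lstar.seminorm_P[OF p], of x w] xy by auto
  qed
  ultimately show "\<exists>U V. openin tau_star U \<and> openin tau_star V \<and> x \<in> U \<and> y \<in> V \<and> disjnt U V"
    by blast
qed

text \<open>The range of a projection is its fixed point set, an equalizer of two continuous maps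
  into a Hausdorff space.\<close>

lemma complemented_imp_closedin:
  assumes "complemented F"
  shows "closedin tau_star F"
proof -
  obtain P where P: "continuous_map tau_star tau_star P" "\<forall>x\<in>Lstar. P (P x) = P x" "P ` Lstar = F"
    using assms unfolding complemented_def by blast
  have "P ` Lstar \<subseteq> Lstar"
    using continuous_map_image_subset_topspace[OF P(1)] by (simp add: tau_star_eq)
  then have "F = {x \<in> topspace tau_star. P x = x}"
    using P(2,3) by (force simp: tau_star_eq)
  then show ?thesis
    using closedin_continuous_maps_eq[OF Hausdorff_tau_star P(1) continuous_map_id] by simp
qed

text \<open>The extension is written down coordinatewise through the adjoint vectors. Truncations
  lie in \<open>s_space\<close> and their images converge coordinatewise, which carries the bound
  over to \<open>ell2\<close>.\<close>

lemma extends_to_boundedI: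
  assumes x: "x \<in> Lstar" and C: "\<And>\<xi>. \<xi> \<in> s_space \<Longrightarrow> ell2_norm (x \<xi>) \<le> C * ell2_norm \<xi>" and "0 \<le> C"
  shows "extends_to_bounded x"
proof -
  define X where "X = (\<lambda>\<xi> i. ell2_inner \<xi> (Lstar_star x (unit_seq i)))"
  have e: "Lstar_star x (unit_seq i) \<in> ell2" for i
    using s_subset_ell2[OF LstarD(4)[OF x s.unit_seq_mem]] .
  have X_s: "X \<xi> = x \<xi>" if "\<xi> \<in> s_space" for \<xi>
    using Lstar_component[OF x that] by (auto simp: X_def)
  have lin: "linear_map_on seq_scale seq_scale ell2 X"
    unfolding linear_map_on_def X_def
    using ell2_inner_add_left[OF _ _ e] ell2_inner_scale_left[OF _ e]
    by (auto simp: fun_eq_iff seq_scale_def)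
  have "X \<xi> \<in> ell2 \<and> ell2_norm (X \<xi>) \<le> C * ell2_norm \<xi>" if \<xi>: "\<xi> \<in> ell2" for \<xi>
  proof -
    have tr: "x (trunc n \<xi>) \<in> wl2 (\<lambda>_. 1)" for n
      using s_subset_ell2[OF LstarD(2)[OF x s.trunc_mem]] by (simp add: ell2_eq)
    have le: "wnorm (\<lambda>_. 1) (x (trunc n \<xi>)) \<le> C * ell2_norm \<xi>" for n
      using C[OF s.trunc_mem, of n \<xi>] wnorm_trunc_le[of \<xi> "\<lambda>_. 1" n] \<xi>
        mult_left_mono[of "ell2_norm (trunc n \<xi>)" "ell2_norm \<xi>" C] \<open>0 \<le> C\<close>
      by (auto simp: ell2_norm_eq ell2_eq)
    have lim: "(\<lambda>n. x (trunc n \<xi>) i) \<longlonglongrightarrow> X \<xi> i" for i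
      using ell2_inner_trunc_tendsto[OF \<xi> e] X_s[OF s.trunc_mem, symmetric] by (simp add: X_def)
    show ?thesis
      using wl2_pointwise_limit[OF tr le lim] by (simp add: ell2_eq ell2_norm_eq)
  qed
  then show ?thesis
    unfolding extends_to_bounded_def using lin X_s by blast
qed


section \<open>Transport of seminorm topologies\<close>

lemma directed_seminorms_pullback:
  assumes "directed_seminorms sc2 W Q" "complex_subspace sc V"
    and lin: "linear_map_on sc sc2 V f" and fV: "f ` V \<subseteq> W"
  shows "directed_seminorms sc V ((\<lambda>q x. q (f x)) ` Q)"
proof -
  interpret Q: directed_seminorms sc2 W Q by fact
  interpret complex_subspace sc V by fact
  show ?thesis
  proof
    show "(\<lambda>q x. q (f x)) ` Q \<noteq> {}"
      using Q.P_nonempty by simp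
  next
    fix p assume "p \<in> (\<lambda>q x. q (f x)) ` Q"
    then obtain q where q: "q \<in> Q" and p: "p = (\<lambda>x. q (f x))"
      by blast
    show "seminorm_on sc V p"
      using seminorm_onD[OF Q.seminorm_P[OF q]] linear_map_onD[OF lin] fV
      by (auto simp: seminorm_on_def p image_subset_iff)
  next
    fix p p' assume "p \<in> (\<lambda>q x. q (f x)) ` Q" "p' \<in> (\<lambda>q x. q (f x)) ` Q"
    then obtain q q' where q: "q \<in> Q" "q' \<in> Q" and p: "p = (\<lambda>x. q (f x))" "p' = (\<lambda>x. q' (f x))"
      by blast
    obtain r where r: "r \<in> Q" "\<And>y. y \<in> W \<Longrightarrow> q y \<le> r y \<and> q' y \<le> r y"
      using Q.directed[OF q] by blast
    show "\<exists>r\<in>(\<lambda>q x. q (f x)) ` Q. \<forall>x\<in>V. p x \<le> r x \<and> p' x \<le> r x"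
      using r fV by (intro bexI[of _ "\<lambda>x. r (f x)"]) (auto simp: p)
  qed
qed

text \<open>Replaces the abstract topology of the algebra by concrete seminorms, once through the
  power series space and once through the operator algebra. Balls correspond because
  \<open>f\<close> is injective, has range \<open>F\<close> and respects differences.\<close>

lemma seminorm_topology_pullback:
  assumes "directed_seminorms sc2 W Q" "complex_subspace sc V"
    and lin: "linear_map_on sc sc2 V f"
    and homeo: "homeomorphic_map T (subtopology (seminorm_topology W Q) F) f"
    and top: "topspace T = V" and F: "F \<subseteq> W"
  shows "T = seminorm_topology V ((\<lambda>q x. q (f x)) ` Q)"
proof -
  interpret Q: directed_seminorms sc2 W Q by fact
  have fV: "f ` V = F" and inj: "inj_on f V"
    using homeomorphic_imp_surjective_map[OF homeo] homeomorphic_imp_injective_map[OF homeo] top F by auto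
  interpret P: directed_seminorms sc V "(\<lambda>q x. q (f x)) ` Q"
    using directed_seminorms_pullback[OF assms(1,2) lin] fV F by blast
  have diff: "x \<in> V \<Longrightarrow> y \<in> V \<Longrightarrow> f (x - y) = f x - f y" for x y
    using P.linear_diff[OF lin] .
  have "openin T U \<longleftrightarrow> openin P.top_P U" for U
  proof -
    have "openin (subtopology (seminorm_topology W Q) F) (f ` U) \<longleftrightarrow>
        (\<forall>x\<in>U. \<exists>p\<in>(\<lambda>q x. q (f x)) ` Q. \<exists>\<epsilon>>0. {y \<in> V. p (y - x) < \<epsilon>} \<subseteq> U)" if U: "U \<subseteq> V"
    proof
      assume "openin (subtopology (seminorm_topology W Q) F) (f ` U)"
      then obtain O' where O: "openin (seminorm_topology W Q) O'" "f ` U = O' \<inter> F"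
        by (auto simp: openin_subtopology)
      show "\<forall>x\<in>U. \<exists>p\<in>(\<lambda>q x. q (f x)) ` Q. \<exists>\<epsilon>>0. {y \<in> V. p (y - x) < \<epsilon>} \<subseteq> U"
      proof
        fix x assume x: "x \<in> U"
        then have "f x \<in> O'"
          using O(2) by blast
        then obtain q \<epsilon> where q: "q \<in> Q" "\<epsilon> > 0" "{z \<in> W. q (z - f x) < \<epsilon>} \<subseteq> O'"
          using O(1) unfolding Q.openin_top_P_iff by blast
        have "{y \<in> V. q (f (y - x)) < \<epsilon>} \<subseteq> U"
        proof
          fix y assume y: "y \<in> {y \<in> V. q (f (y - x)) < \<epsilon>}"
          then have "f y \<in> {z \<in> W. q (z - f x) < \<epsilon>}" "f y \<in> F"
            using diff[of y x] subsetD[OF U x] fV F by auto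
          then have "f y \<in> O' \<inter> F"
            using q(3) by blast
          then have "f y \<in> f ` U"
            using O(2) by simp
          then show "y \<in> U"
            using inj_on_image_mem_iff[OF inj _ U] y by simp
        qed
        then show "\<exists>p\<in>(\<lambda>q x. q (f x)) ` Q. \<exists>\<epsilon>>0. {y \<in> V. p (y - x) < \<epsilon>} \<subseteq> U"
          using q by (intro bexI[of _ "\<lambda>x. q (f x)"] exI[of _ \<epsilon>]) auto
      qed
    next
      assume R: "\<forall>x\<in>U. \<exists>p\<in>(\<lambda>q x. q (f x)) ` Q. \<exists>\<epsilon>>0. {y \<in> V. p (y - x) < \<epsilon>} \<subseteq> U"
      show "openin (subtopology (seminorm_topology W Q) F) (f ` U)"
      proof (subst openin_subopen, intro ballI)
        fix z assume "z \<in> f ` U"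
        then obtain x where x: "x \<in> U" "z = f x"
          by blast
        then obtain q \<epsilon> where q: "q \<in> Q" "\<epsilon> > 0" "{y \<in> V. q (f (y - x)) < \<epsilon>} \<subseteq> U"
          using bspec[OF R x(1)] by auto
        have xV: "x \<in> V" "f x \<in> W" "f x \<in> F"
          using x U fV F by auto
        have "{y \<in> W. q (y - f x) < \<epsilon>} \<inter> F \<subseteq> f ` U"
        proof
          fix y assume y: "y \<in> {y \<in> W. q (y - f x) < \<epsilon>} \<inter> F"
          then obtain v where v: "v \<in> V" "y = f v"
            using fV by blast
          then have "v \<in> U"
            using q(3) y diff[of v x] xV by auto
          then show "y \<in> f ` U"
            using v by blast
        qed
        moreover have "openin (subtopology (seminorm_topology W Q) F) ({y \<in> W. q (y - f x) < \<epsilon>} \<inter> F)"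
          using Q.openin_ball[OF q(1) xV(2)] by (auto simp: openin_subtopology)
        moreover have "z \<in> {y \<in> W. q (y - f x) < \<epsilon>} \<inter> F"
          using xV q Q.seminorm_zero[OF Q.seminorm_P[OF q(1)]] by (simp add: x)
        ultimately show "\<exists>T. openin (subtopology (seminorm_topology W Q) F) T \<and> z \<in> T \<and> T \<subseteq> f ` U"
          by blast
      qed
    qed
    then show ?thesis
      unfolding homeomorphic_map_openness_eq[OF homeo, of U] P.openin_top_P_iff top by blast
  qed
  then show ?thesis
    by (simp add: topology_eq)
qed

text \<open>Continuity of the identity map, read through the seminorm criterion.\<close>

lemma seminorm_topology_eq_bound:
  assumes "directed_seminorms sc V P" "directed_seminorms sc V Q"
    and eq: "seminorm_topology V P = seminorm_topology V Q" and "q \<in> Q"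
  shows "\<exists>p\<in>P. \<exists>C>0. \<forall>x\<in>V. q x \<le> C * p x"
proof -
  have "linear_map_on sc sc V (\<lambda>x. x)"
    by (simp add: linear_map_on_def)
  moreover have "continuous_map (seminorm_topology V P) (seminorm_topology V Q) (\<lambda>x. x)"
    unfolding eq using continuous_map_id by (simp add: id_def)
  ultimately show ?thesis
    using continuous_linear_iff[OF assms(1,2), of "\<lambda>x. x"] \<open>q \<in> Q\<close> by auto
qed

section \<open>The algebra with seminorms carried over from the power series space\<close>

locale power_series_model = vector_space sc
  for sc :: "complex \<Rightarrow> 'e::ab_group_add \<Rightarrow> 'e" +
  fixes T :: "'e topology" and \<alpha> :: "nat \<Rightarrow> real" and \<Psi> :: "'e \<Rightarrow> nat \<Rightarrow> complex"
  assumes alpha_nonneg: "0 \<le> \<alpha> j"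
    and topspace_T: "topspace T = UNIV"
    and Psi_linear: "linear_map_on sc seq_scale UNIV \<Psi>"
    and Psi_homeomorphic: "homeomorphic_map T (power_series_topology \<alpha>) \<Psi>"
begin

definition p :: "nat \<Rightarrow> 'e \<Rightarrow> real"
  where "p q x = wnorm (\<lambda>j. exp (real q * \<alpha> j)) (\<Psi> x)"

sublocale Lam: koethe_weights "\<lambda>q j. exp (real q * \<alpha> j)"
  by (rule power_series_weights[OF alpha_nonneg])

lemma Psi_range: "range \<Psi> = koethe_space (\<lambda>q j. exp (real q * \<alpha> j))"
  using homeomorphic_imp_surjective_map[OF Psi_homeomorphic]
  by (auto simp: topspace_T power_series_topology_def power_series_space_eq)

lemma Psi_mem: "\<Psi> x \<in> koethe_space (\<lambda>q j. exp (real q * \<alpha> j))"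
  using Psi_range by blast

lemma Psi_wl2: "\<Psi> x \<in> wl2 (\<lambda>j. exp (real q * \<alpha> j))"
  using Psi_range by (auto simp: koethe_space_def)

lemma Psi_add: "\<Psi> (x + y) = \<Psi> x + \<Psi> y"
  and Psi_scale: "\<Psi> (sc c x) = seq_scale c (\<Psi> x)"
  using linear_map_onD[OF Psi_linear] by auto

lemma complex_subspace_UNIV: "complex_subspace sc UNIV"
  by unfold_locales simp

lemma Psi_diff: "\<Psi> (x - y) = \<Psi> x - \<Psi> y"
  using complex_subspace.linear_diff[OF complex_subspace_UNIV Psi_linear] by simp

lemma Psi_sum: "\<Psi> (sum g I) = (\<Sum>i\<in>I. \<Psi> (g i))"
  using complex_subspace.linear_sum[OF complex_subspace_UNIV Psi_linear vector_space_seq_scale] by simp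

sublocale E: frechet_seminorms sc UNIV p
proof -
  interpret complex_subspace sc UNIV
    by (rule complex_subspace_UNIV)
  show "frechet_seminorms sc UNIV p"
  proof
    show "seminorm_on sc UNIV (p q)" for q
      using seminorm_onD[OF Lam.seminorm_p] Psi_mem
      by (auto simp: seminorm_on_def p_def Psi_add Psi_scale)
    show "p q x \<le> p (Suc q) x" for q x
      unfolding p_def using Lam.p_Suc[of "\<Psi> x" q] Psi_range by blast
  next
    fix X :: "nat \<Rightarrow> 'e" assume "\<And>q. summable (\<lambda>k. p q (X k))"
    then obtain \<xi> where \<xi>: "\<xi> \<in> range \<Psi>"
      "\<And>q. (\<lambda>n. wnorm (\<lambda>j. exp (real q * \<alpha> j)) (\<xi> - (\<Sum>k<n. \<Psi> (X k)))) \<longlonglongrightarrow> 0"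
      using Lam.series_converges[of "\<lambda>k. \<Psi> (X k)"] Psi_mem unfolding p_def Psi_range by blast
    then obtain l where "\<xi> = \<Psi> l"
      by blast
    then show "\<exists>l\<in>UNIV. \<forall>q. (\<lambda>n. p q (l - (\<Sum>k<n. X k))) \<longlonglongrightarrow> 0"
      using \<xi>(2) by (auto simp: p_def Psi_diff Psi_sum)
  qed
qed

lemma T_eq: "T = seminorm_topology UNIV (range p)"
proof -
  have "T = seminorm_topology UNIV ((\<lambda>q x. q (\<Psi> x)) ` range (\<lambda>q. wnorm (\<lambda>j. exp (real q * \<alpha> j))))"
  proof (rule seminorm_topology_pullback[OF Lam.directed_seminorms_axioms complex_subspace_UNIV Psi_linear _ topspace_T subset_refl])
    show "homeomorphic_map T (subtopology Lam.top_P (koethe_space (\<lambda>q j. exp (real q * \<alpha> j)))) \<Psi>"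
      using Psi_homeomorphic subtopology_topspace[of Lam.top_P]
      by (simp add: power_series_topology_def power_series_space_eq power_series_norm_eq)
  qed
  moreover have "(\<lambda>q x. q (\<Psi> x)) ` range (\<lambda>q. wnorm (\<lambda>j. exp (real q * \<alpha> j))) = range p"
    by (auto simp: p_def image_iff fun_eq_iff)
  ultimately show ?thesis
    by simp
qed

lemma fundamental_system_p: "fundamental_system sc T p"
  unfolding fundamental_system_def using E.seminorm_p E.p_Suc T_eq by auto

lemma p_nonneg: "0 \<le> p q x"
  using seminorm_onD(1)[OF E.seminorm_p] by simp

end

section \<open>Scalar products\<close>

locale scalar_product_space = vector_space sc
  for sc :: "complex \<Rightarrow> 'e::ab_group_add \<Rightarrow> 'e" +
  fixes B :: "'e \<Rightarrow> 'e \<Rightarrow> complex"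
  assumes scalar_product: "scalar_product sc B"
begin

lemma B_add_left: "B (x + y) z = B x z + B y z"
  and B_scale_left: "B (sc c x) y = c * B x y"
  and B_commute: "B y x = cnj (B x y)"
  and B_pos: "x \<noteq> 0 \<Longrightarrow> 0 < Re (B x x)"
  using scalar_product unfolding scalar_product_def by blast+

lemma B_add_right: "B x (y + z) = B x y + B x z"
  using B_commute[of x "y + z"] B_commute[of x y] B_commute[of x z] by (simp add: B_add_left)

lemma B_scale_right: "B x (sc c y) = cnj c * B x y"
  using B_commute[of x "sc c y"] B_commute[of x y] by (simp add: B_scale_left)

lemma B_zero_left: "B 0 y = 0"
  using B_add_left[of 0 0 y] by simp

lemma B_zero_right: "B x 0 = 0"
  using B_add_right[of x 0 0] by simp

lemma B_diff_left: "B (x - y) z = B x z - B y z"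
  using B_add_left[of "x - y" y z] by simp

lemma B_diff_right: "B x (y - z) = B x y - B x z"
  using B_add_right[of x "y - z" z] by simp

lemma B_sum_left: "B (sum f I) z = (\<Sum>i\<in>I. B (f i) z)"
  by (induction I rule: infinite_finite_induct) (auto simp: B_zero_left B_add_left)

lemma B_sum_right: "B z (sum f I) = (\<Sum>i\<in>I. B z (f i))"
  by (induction I rule: infinite_finite_induct) (auto simp: B_zero_right B_add_right)

abbreviation nrm :: "'e \<Rightarrow> real"
  where "nrm \<equiv> hilbert_norm B"

lemma B_self_nonneg: "0 \<le> Re (B x x)"
  using B_pos[of x] by (cases "x = 0") (auto simp: B_zero_left)

lemma nrm_nonneg: "0 \<le> nrm x"
  by (simp add: hilbert_norm_def B_self_nonneg)

lemma B_self: "B x x = complex_of_real ((nrm x)\<^sup>2)"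
proof -
  have "Im (B x x) = 0"
    using B_commute[of x x] by (metis cnj.simps(2) equal_neg_zero)
  then show ?thesis
    by (simp add: complex_eq_iff hilbert_norm_def B_self_nonneg)
qed

lemma nrm_eq_0: "nrm x = 0 \<Longrightarrow> x = 0"
  using B_pos[of x] by (auto simp: hilbert_norm_def)

lemma B_nondegenerate: "(\<And>z. B z x = B z y) \<Longrightarrow> x = y"
  using B_pos[of "x - y"] B_diff_right[of "x - y" x y] by fastforce

lemma Cauchy_Schwarz: "cmod (B x y) \<le> nrm x * nrm y"
proof (cases "y = 0")
  case True
  then show ?thesis
    by (simp add: B_zero_right nrm_nonneg)
next
  case False
  have ny: "(nrm y)\<^sup>2 > 0"
    using nrm_eq_0 False by fastforce
  define c where "c = B x y / complex_of_real ((nrm y)\<^sup>2)"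
  have "B (x - sc c y) (x - sc c y) = B x x - cnj c * B x y - c * (B y x - cnj c * B y y)"
    by (simp add: B_diff_left B_diff_right B_scale_left B_scale_right algebra_simps)
  also have "cnj c * B y y = B y x"
    using ny B_commute[of y x] unfolding c_def B_self[of y] by simp
  also have "cnj c * B x y = complex_of_real ((cmod (B x y))\<^sup>2 / (nrm y)\<^sup>2)"
    unfolding c_def of_real_divide complex_norm_square by (simp add: mult.commute)
  finally have "(nrm x)\<^sup>2 - (cmod (B x y))\<^sup>2 / (nrm y)\<^sup>2 \<ge> 0"
    using B_self_nonneg[of "x - sc c y"] B_self[of x] by simp
  then have "(cmod (B x y))\<^sup>2 \<le> (nrm x * nrm y)\<^sup>2"
    using ny by (simp add: field_simps power_mult_distrib)
  then show ?thesis
    by (rule power2_le_imp_le) (simp add: nrm_nonneg)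
qed

lemma seminorm_nrm: "seminorm_on sc UNIV nrm"
  unfolding seminorm_on_def
proof (intro conjI ballI allI)
  fix x y
  have "Re (B (x + y) (x + y)) = (nrm x)\<^sup>2 + 2 * Re (B x y) + (nrm y)\<^sup>2"
    using B_commute[of y x] B_self[of x] B_self[of y] by (simp add: B_add_left B_add_right)
  also have "\<dots> \<le> (nrm x + nrm y)\<^sup>2"
    using order_trans[OF complex_Re_le_cmod Cauchy_Schwarz[of x y]] by (simp add: power2_sum)
  finally show "nrm (x + y) \<le> nrm x + nrm y"
    unfolding hilbert_norm_def[of B "x + y"] by (intro real_le_lsqrt) (auto simp: nrm_nonneg)
next
  fix c x
  have "B (sc c x) (sc c x) = (c * cnj c) * B x x"
    by (simp add: B_scale_left B_scale_right)
  also have "\<dots> = complex_of_real ((cmod c * nrm x)\<^sup>2)"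
    unfolding complex_norm_square[symmetric] B_self by (simp add: power_mult_distrib)
  finally have "B (sc c x) (sc c x) = complex_of_real ((cmod c * nrm x)\<^sup>2)" .
  then show "nrm (sc c x) = cmod c * nrm x"
    unfolding hilbert_norm_def[of B "sc c x"] by (simp add: nrm_nonneg)
qed (simp add: nrm_nonneg)

end


section \<open>Subalgebras of bounded operators are \<open>\<beta>\<close>DN\<close>

lemma extends_to_boundedD:
  assumes "extends_to_bounded x"
  shows "\<exists>C\<ge>0. \<forall>\<xi>\<in>s_space. ell2_norm (x \<xi>) \<le> C * ell2_norm \<xi>"
proof -
  obtain X C where X: "\<And>\<xi>. \<xi> \<in> ell2 \<Longrightarrow> ell2_norm (X \<xi>) \<le> C * ell2_norm \<xi>"
    "\<And>\<xi>. \<xi> \<in> s_space \<Longrightarrow> X \<xi> = x \<xi>"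
    using assms unfolding extends_to_bounded_def by blast
  \<comment> \<open>The constant in \<open>extends_to_bounded\<close> carries no sign, hence the
    maximum.\<close>
  have "ell2_norm (x \<xi>) \<le> max C 0 * ell2_norm \<xi>" if "\<xi> \<in> s_space" for \<xi>
    using X(1)[OF s_subset_ell2[OF that]] X(2)[OF that]
      mult_right_mono[of C "max C 0", OF _ ell2_norm_nonneg[OF s_subset_ell2[OF that]]] by simp
  then show ?thesis
    by (intro exI[of _ "max C 0"]) auto
qed

lemma Lstar_trunc_tendsto:
  assumes x: "x \<in> Lstar" and \<xi>: "\<xi> \<in> s_space"
  shows "(\<lambda>n. x (trunc n \<xi>) i) \<longlonglongrightarrow> x \<xi> i"
  using ell2_inner_trunc_tendsto[OF s_subset_ell2[OF \<xi>] s_subset_ell2[OF LstarD(4)[OF x s.unit_seq_mem]]]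
  by (simp add: Lstar_component[OF x \<xi>] Lstar_component[OF x s.trunc_mem])

lemma Lstar_eqI_unit_seq:
  assumes x: "x \<in> Lstar" "\<And>k. x (unit_seq k) = 0"
  shows "x = 0"
proof (rule Lstar_ext[OF x(1) Lstar.zero_mem])
  fix \<xi> assume \<xi>: "\<xi> \<in> s_space"
  have "x (trunc n \<xi>) = 0" for n
  proof -
    have "x (trunc n \<xi>) = (\<Sum>k<n. x (seq_scale (\<xi> k) (unit_seq k)))"
      unfolding trunc_eq_sum
      by (rule s.linear_sum[OF LstarD(1)[OF x(1)] vector_space_seq_scale]) (intro s.scale_mem s.unit_seq_mem)
    also have "\<dots> = 0"
      using linear_map_onD(2)[OF LstarD(1)[OF x(1)] s.unit_seq_mem] x(2) by (simp add: s.scale_zero_right)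
    finally show ?thesis .
  qed
  then have "(\<lambda>n. 0) \<longlonglongrightarrow> x \<xi> i" for i
    using Lstar_trunc_tendsto[OF x(1) \<xi>, of i] by simp
  then show "x \<xi> = 0 \<xi>"
    using LIMSEQ_unique[OF _ tendsto_const] by (auto simp: fun_eq_iff)
qed

text \<open>Expand \<open>\<xi>\<close> in unit sequences and apply Cauchy-Schwarz with the factor
  \<open>k + 1\<close> moved to the coefficients, which is where \<open>s_norm 1\<close> comes
  from.\<close>

lemma Lstar_ell2_norm_le:
  assumes x: "x \<in> Lstar" and \<xi>: "\<xi> \<in> s_space"
    and M: "\<And>n. L2_set (\<lambda>k. ell2_norm (x (unit_seq k)) / real (Suc k)) {..<n} \<le> M"
  shows "ell2_norm (x \<xi>) \<le> M * s_norm 1 \<xi>"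
proof -
  have mem: "x (trunc n \<xi>) \<in> wl2 (\<lambda>_. 1)" for n
    using s_subset_ell2[OF LstarD(2)[OF x s.trunc_mem]] by (simp add: ell2_eq)
  have xe: "x (unit_seq k) \<in> ell2" for k
    using s_subset_ell2[OF LstarD(2)[OF x s.unit_seq_mem]] .
  have le: "wnorm (\<lambda>_. 1) (x (trunc n \<xi>)) \<le> M * s_norm 1 \<xi>" for n
  proof -
    have "x (trunc n \<xi>) = (\<Sum>k<n. x (seq_scale (\<xi> k) (unit_seq k)))"
      unfolding trunc_eq_sum
      by (rule s.linear_sum[OF LstarD(1)[OF x] vector_space_seq_scale]) (intro s.scale_mem s.unit_seq_mem)
    also have "\<dots> = (\<Sum>k<n. seq_scale (\<xi> k) (x (unit_seq k)))"
      using linear_map_onD(2)[OF LstarD(1)[OF x] s.unit_seq_mem] by simp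
    finally have "ell2_norm (x (trunc n \<xi>)) \<le> (\<Sum>k<n. ell2_norm (seq_scale (\<xi> k) (x (unit_seq k))))"
      using ell2.seminorm_sum[OF seminorm_ell2_norm, of "{..<n}"] xe ell2.scale_mem by simp
    also have "\<dots> = (\<Sum>k<n. \<bar>ell2_norm (x (unit_seq k)) / real (Suc k)\<bar> * (cmod (\<xi> k) * s_weight 1 k))"
    proof (rule sum.cong)
      fix k
      show "ell2_norm (seq_scale (\<xi> k) (x (unit_seq k))) =
          \<bar>ell2_norm (x (unit_seq k)) / real (Suc k)\<bar> * (cmod (\<xi> k) * s_weight 1 k)"
        using seminorm_onD(2)[OF seminorm_ell2_norm xe] ell2_norm_nonneg[OF xe] by simp
    qed simp
    also have "\<dots> \<le> L2_set (\<lambda>k. ell2_norm (x (unit_seq k)) / real (Suc k)) {..<n} * s_norm 1 \<xi>"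
      unfolding s_norm_eq by (intro wl2_sum_le s_space_wl2[OF \<xi>]) simp
    also have "\<dots> \<le> M * s_norm 1 \<xi>"
      by (intro mult_right_mono M s_norm_nonneg \<xi>)
    finally show ?thesis
      by (simp add: ell2_norm_eq)
  qed
  show ?thesis
    using wl2_pointwise_limit(2)[OF mem le Lstar_trunc_tendsto[OF x \<xi>]] by (simp add: ell2_norm_eq)
qed

lemma summable_inverse_Suc_squared: "summable (\<lambda>k. c * (1 / real (Suc k))\<^sup>2)"
proof -
  have "summable (\<lambda>k. inverse (real (Suc k) ^ 2))"
    using inverse_power_summable[of 2, where 'a = real]
    by (subst summable_Suc_iff[of "\<lambda>n. inverse (real n ^ 2)"]) simp
  then show ?thesis
    by (intro summable_mult) (simp add: power_one_over inverse_eq_divide)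
qed

text \<open>The scalar product is the weighted Hilbert--Schmidt product
  \<open>\<Sum>\<^sub>k \<langle>x e\<^sub>k, y e\<^sub>k\<rangle> / (k + 1)\<^sup>2\<close>. The weights make it converge, while \<open>|\<xi>|\<^sub>1\<close> absorbs them when
  \<open>x \<xi>\<close> is estimated. Normality of the operators, i.e. commutativity of the algebra, bounds the
  adjoints as well.\<close>

lemma bounded_subalgebra_imp_betaDN:
  fixes sc :: "complex \<Rightarrow> 'e::comm_ring_1 \<Rightarrow> 'e"
  assumes "power_series_model sc T \<alpha> \<Psi>"
    and F: "star_subalgebra F" and bdd: "\<forall>x\<in>F. extends_to_bounded x"
    and iso: "star_algebra_isomorphic sc star T F"
  shows "betaDN_algebra sc star T"
proof -
  interpret power_series_model sc T \<alpha> \<Psi> by fact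
  obtain \<Phi> where lin: "linear_map_on sc op_scale UNIV \<Phi>" and mult: "\<And>x y. \<Phi> (x * y) = \<Phi> x \<circ> \<Phi> y"
    and star: "\<And>x. \<Phi> (star x) = Lstar_star (\<Phi> x)"
    and homeo: "homeomorphic_map T (subtopology tau_star F) \<Phi>"
    using iso unfolding star_algebra_isomorphic_def by blast
  have FL: "F \<subseteq> Lstar"
    using F by (simp add: star_subalgebra_def)
  have ran: "range \<Phi> = F" and inj: "inj \<Phi>"
    using homeomorphic_imp_surjective_map[OF homeo] homeomorphic_imp_injective_map[OF homeo] FL
    by (auto simp: topspace_T tau_star_eq)
  have L: "\<Phi> x \<in> Lstar" for x
    using ran FL by blast
  have \<Phi>_add: "\<Phi> (x + y) = \<Phi> x + \<Phi> y" and \<Phi>_scale: "\<Phi> (sc c x) = op_scale c (\<Phi> x)" for c x y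
    using linear_map_onD[OF lin] by auto
  define P where "P = (\<lambda>q x. q (\<Phi> x)) ` Lstar_seminorms"
  have dP: "directed_seminorms sc UNIV P"
    unfolding P_def using L
    by (intro directed_seminorms_pullback[OF Lstar.directed_seminorms_axioms complex_subspace_UNIV lin]) auto
  have TP: "T = seminorm_topology UNIV P"
    unfolding P_def using homeo unfolding tau_star_eq
    by (intro seminorm_topology_pullback[OF Lstar.directed_seminorms_axioms complex_subspace_UNIV lin _ topspace_T FL])
  have upper: "\<exists>r. \<exists>C>0. \<forall>x. Lstar_seminorm N A (\<Phi> x) \<le> C * p r x" if "s_bounded A" "A \<noteq> {}" for N A
    using seminorm_topology_eq_bound[OF E.directed_seminorms_axioms dP, of "\<lambda>x. Lstar_seminorm N A (\<Phi> x)"]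
      that T_eq TP by (auto simp: P_def Lstar_seminorms_def)
  have lower: "\<exists>N A C. s_bounded A \<and> A \<noteq> {} \<and> C > 0 \<and> (\<forall>x. p q x \<le> C * Lstar_seminorm N A (\<Phi> x))" for q
  proof -
    obtain g C where g: "g \<in> P" "C > 0" "\<forall>x. p q x \<le> C * g x"
      using seminorm_topology_eq_bound[OF dP E.directed_seminorms_axioms, of "p q"] T_eq TP by auto
    then obtain N A where "s_bounded A" "A \<noteq> {}" "g = (\<lambda>x. Lstar_seminorm N A (\<Phi> x))"
      unfolding P_def Lstar_seminorms_def by blast
    then show ?thesis
      using g by blast
  qed
  have mem: "\<Phi> x \<xi> \<in> s_space" "\<Phi> x \<xi> \<in> ell2" if "\<xi> \<in> s_space" for x \<xi>
    using LstarD(2)[OF L that] s_subset_ell2 by auto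
  have memk: "\<Phi> x (unit_seq k) \<in> ell2" for x k
    by (rule mem(2)[OF s.unit_seq_mem])
  \<comment> \<open>\<open>h x k\<close> is the weighted length of the \<open>k\<close>-th column of
    \<open>\<Phi> x\<close>; the Hilbert norm to be built is the \<open>ell2\<close> norm of
    \<open>h x\<close>.\<close>
  define h where "h = (\<lambda>x k. ell2_norm (\<Phi> x (unit_seq k)) / real (Suc k))"
  have h_nonneg: "0 \<le> h x k" for x k
    using ell2_norm_nonneg[OF memk] by (simp add: h_def)
  have norm_unit: "ell2_norm (unit_seq k) = 1" for k
    by (simp add: ell2_norm_eq wnorm_unit_seq)
  have op_bound: "\<exists>C\<ge>0. \<forall>\<xi>\<in>s_space. ell2_norm (\<Phi> x \<xi>) \<le> C * ell2_norm \<xi>" for x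
    using extends_to_boundedD bdd ran by blast
  have h_sq: "summable (\<lambda>k. (h x k)\<^sup>2)" for x
  proof -
    obtain C where C: "C \<ge> 0" "\<And>\<xi>. \<xi> \<in> s_space \<Longrightarrow> ell2_norm (\<Phi> x \<xi>) \<le> C * ell2_norm \<xi>"
      using op_bound by blast
    have "(h x k)\<^sup>2 \<le> C\<^sup>2 * (1 / real (Suc k))\<^sup>2" for k
    proof -
      have "h x k \<le> C * (1 / real (Suc k))"
        using C(2)[OF s.unit_seq_mem, of k] norm_unit[of k] by (simp add: h_def divide_right_mono)
      then show ?thesis
        using h_nonneg by (metis power_mono power_mult_distrib)
    qed
    then show ?thesis
      by (intro summable_comparison_test'[OF summable_inverse_Suc_squared[of "C\<^sup>2"], of 0]) auto
  qed
  define B where "B = (\<lambda>x y. \<Sum>k. ell2_inner (\<Phi> x (unit_seq k)) (\<Phi> y (unit_seq k)) * complex_of_real ((1 / real (Suc k))\<^sup>2))"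
  have sm: "summable (\<lambda>k. ell2_inner (\<Phi> x (unit_seq k)) (\<Phi> y (unit_seq k)) * complex_of_real ((1 / real (Suc k))\<^sup>2))" for x y
  proof (rule summable_comparison_test'[of "\<lambda>k. (h x k)\<^sup>2 + (h y k)\<^sup>2" 0])
    show "summable (\<lambda>k. (h x k)\<^sup>2 + (h y k)\<^sup>2)"
      by (intro summable_add h_sq)
    fix k
    have "norm (ell2_inner (\<Phi> x (unit_seq k)) (\<Phi> y (unit_seq k)) * complex_of_real ((1 / real (Suc k))\<^sup>2)) =
        cmod (ell2_inner (\<Phi> x (unit_seq k)) (\<Phi> y (unit_seq k))) * (1 / real (Suc k))\<^sup>2"
      by (simp add: norm_mult del: of_real_power)
    also have "\<dots> \<le> (ell2_norm (\<Phi> x (unit_seq k)) * ell2_norm (\<Phi> y (unit_seq k))) * (1 / real (Suc k))\<^sup>2"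
      by (intro mult_right_mono Cauchy_Schwarz_ell2 memk) auto
    also have "\<dots> = h x k * h y k"
      by (simp add: h_def power2_eq_square)
    also have "\<dots> \<le> (h x k)\<^sup>2 + (h y k)\<^sup>2"
      using sum_squares_bound[of "h x k" "h y k"] mult_nonneg_nonneg[OF h_nonneg h_nonneg, of x k y k]
      by linarith
    finally show "norm (ell2_inner (\<Phi> x (unit_seq k)) (\<Phi> y (unit_seq k)) * complex_of_real ((1 / real (Suc k))\<^sup>2)) \<le> (h x k)\<^sup>2 + (h y k)\<^sup>2" .
  qed
  have B_self: "B x x = complex_of_real (\<Sum>k. (h x k)\<^sup>2)" for x
  proof -
    have "ell2_inner (\<Phi> x (unit_seq k)) (\<Phi> x (unit_seq k)) * complex_of_real ((1 / real (Suc k))\<^sup>2) = complex_of_real ((h x k)\<^sup>2)" for k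
      by (simp add: ell2_inner_self[OF memk] h_def power_divide)
    then show ?thesis
      unfolding B_def using suminf_of_real[OF h_sq[of x], where 'a = complex] by simp
  qed
  have norm_B: "hilbert_norm B x = wnorm (\<lambda>_. 1) (\<lambda>k. complex_of_real (h x k))" for x
    by (simp add: hilbert_norm_def B_self wnorm_def)
  have h_wl2: "(\<lambda>k. complex_of_real (h x k)) \<in> wl2 (\<lambda>_. 1)" for x
    using h_sq by (simp add: wl2_def)
  have L2_le: "L2_set (h x) {..<n} \<le> hilbert_norm B x" for x n
    using L2_set_le_wnorm[OF h_wl2, of "{..<n}" x] h_nonneg by (simp add: norm_B)
  have le_L2: "hilbert_norm B x \<le> C" if "\<And>n. L2_set (h x) {..<n} \<le> C" for x C
    unfolding norm_B using that h_nonneg by (intro wl2_bound(2)) simp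
  have sp: "scalar_product sc B"
    unfolding scalar_product_def
  proof (intro conjI allI impI)
    fix x y z
    show "B (x + y) z = B x z + B y z"
      unfolding B_def using suminf_add[OF sm[of x z] sm[of y z]]
      by (simp add: \<Phi>_add ell2_inner_add_left memk distrib_right)
  next
    fix c x y
    show "B (sc c x) y = c * B x y"
      unfolding B_def using suminf_mult[OF sm[of x y], of c]
      by (simp add: \<Phi>_scale op_scale_def ell2_inner_scale_left memk mult.assoc)
  next
    fix x y
    have "(\<lambda>k. cnj (ell2_inner (\<Phi> x (unit_seq k)) (\<Phi> y (unit_seq k)) * complex_of_real ((1 / real (Suc k))\<^sup>2))) sums cnj (B x y)"
      unfolding B_def sums_cnj by (rule summable_sums[OF sm])
    moreover have "cnj (ell2_inner (\<Phi> x (unit_seq k)) (\<Phi> y (unit_seq k)) * complex_of_real ((1 / real (Suc k))\<^sup>2)) =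
        ell2_inner (\<Phi> y (unit_seq k)) (\<Phi> x (unit_seq k)) * complex_of_real ((1 / real (Suc k))\<^sup>2)" for k
      using ell2_inner_commute[OF memk memk, of x k y k] by simp
    ultimately show "B y x = cnj (B x y)"
      unfolding fun_cong[OF fun_cong[OF B_def], of y x] by (simp only: sums_iff)
  next
    fix x :: 'e assume "x \<noteq> 0"
    have "\<exists>k. \<Phi> x (unit_seq k) \<noteq> 0"
    proof (rule ccontr)
      assume "\<nexists>k. \<Phi> x (unit_seq k) \<noteq> 0"
      then have "\<Phi> x = 0"
        by (intro Lstar_eqI_unit_seq L) auto
      moreover have "\<Phi> 0 = 0"
        using E.linear_zero[OF lin vector_space_op_scale] .
      ultimately show False
        using injD[OF inj, of x 0] \<open>x \<noteq> 0\<close> by simp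
    qed
    then obtain k i where "\<Phi> x (unit_seq k) i \<noteq> 0"
      by (auto simp: fun_eq_iff)
    then have "0 < cmod (\<Phi> x (unit_seq k) i)"
      by simp
    also have "\<dots> \<le> ell2_norm (\<Phi> x (unit_seq k))"
      using wl2_component[of "\<Phi> x (unit_seq k)" "\<lambda>_. 1" i] memk by (simp add: ell2_eq ell2_norm_eq)
    finally have "ell2_norm (\<Phi> x (unit_seq k)) > 0" .
    then have "h x k > 0"
      by (simp add: h_def)
    then have "(\<Sum>k. (h x k)\<^sup>2) > 0"
      by (intro suminf_pos2[OF h_sq, of _ k]) auto
    then show "0 < Re (B x x)"
      by (simp add: B_self)
  qed
  interpret scalar_product_space sc B
    by unfold_locales (rule sp)
  \<comment> \<open>The Hilbert norm is the supremum of its finite sections. Each section is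
    continuous since it sees finitely many columns, and uniform boundedness passes to the
    supremum.\<close>
  have "\<exists>r. \<exists>C>0. \<forall>n\<in>UNIV. \<forall>x\<in>UNIV. L2_set (h x) {..<n} \<le> C * p r x"
  proof (rule E.uniform_boundedness)
    fix n :: nat
    have h_tri: "h (x + y) k \<le> h x k + h y k" for x y k
      using seminorm_onD(3)[OF seminorm_ell2_norm memk memk, of x k y k]
      by (simp add: h_def \<Phi>_add add_divide_distrib[symmetric] divide_right_mono)
    have h_scale: "h (sc c x) = (\<lambda>k. cmod c * h x k)" for c x
      using seminorm_onD(2)[OF seminorm_ell2_norm memk, of c x] by (simp add: h_def \<Phi>_scale op_scale_def)
    show "seminorm_on sc UNIV (\<lambda>x. L2_set (h x) {..<n})"
      unfolding seminorm_on_def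
    proof (intro conjI ballI allI)
      fix x y
      have "L2_set (h (x + y)) {..<n} \<le> L2_set (\<lambda>k. h x k + h y k) {..<n}"
        by (intro L2_set_mono h_tri h_nonneg)
      also note L2_set_triangle_ineq
      finally show "L2_set (h (x + y)) {..<n} \<le> L2_set (h x) {..<n} + L2_set (h y) {..<n}" .
    qed (simp_all add: h_scale L2_set_right_distrib)
    \<comment> \<open>Taking \<open>{..n}\<close> instead of \<open>{..<n}\<close> keeps
      \<open>A\<close> nonempty for \<open>n = 0\<close>, as the seminorms of
      \<open>tau_star\<close> require.\<close>
    define A where "A = unit_seq ` {..n}"
    have A: "s_bounded A" "A \<noteq> {}"
      unfolding s_bounded_def A_def using s.unit_seq_mem
      by (auto intro!: exI[of _ "\<Sum>k\<le>n. s_norm _ (unit_seq k)"] member_le_sum s_norm_nonneg)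
    obtain r C where C: "C > 0" "\<And>x. Lstar_seminorm 0 A (\<Phi> x) \<le> C * p r x"
      using upper[OF A] by blast
    have "L2_set (h x) {..<n} \<le> (real n * C) * p r x" for x
    proof -
      have "h x k \<le> C * p r x" if "k < n" for k
      proof -
        have "h x k \<le> ell2_norm (\<Phi> x (unit_seq k))"
          using ell2_norm_nonneg[OF memk, of x k] by (simp add: h_def field_simps mult_left_mono)
        also have "\<dots> \<le> Lstar_seminorm 0 A (\<Phi> x)"
          using Lstar_seminorm_le(1)[OF L A(1), of "unit_seq k" 0 x] that by (simp add: A_def s_norm_0)
        finally show ?thesis
          using C(2)[of x] by simp
      qed
      then have "(\<Sum>k<n. h x k) \<le> (\<Sum>k<n. C * p r x)"
        by (intro sum_mono) auto
      then show ?thesis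
        using order_trans[OF L2_set_le_sum[of "{..<n}" "h x"]] h_nonneg by (simp add: mult.assoc)
    qed
    then show "\<exists>r C. \<forall>x\<in>UNIV. L2_set (h x) {..<n} \<le> C * p r x"
      by blast
  qed (use L2_le in blast)
  then obtain r C where "C > 0" "\<And>x. nrm x \<le> C * p r x"
    using le_L2 by blast
  then have cont: "continuous_map T euclideanreal nrm"
    unfolding T_eq E.continuous_seminorm_iff[OF seminorm_nrm] by blast
  have ell2_le: "ell2_norm (\<Phi> x \<xi>) \<le> nrm x * s_norm 1 \<xi>" if "\<xi> \<in> s_space" for x \<xi>
    using Lstar_ell2_norm_le[OF L that] L2_le unfolding h_def by blast
  have normal: "ell2_norm (Lstar_star (\<Phi> x) \<xi>) = ell2_norm (\<Phi> x \<xi>)" if \<xi>: "\<xi> \<in> s_space" for x \<xi>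
  proof -
    \<comment> \<open>Commutativity of the algebra, carried over by \<open>\<Phi>\<close>, makes the
      operators normal; hence the \<open>ell2\<close> bound for \<open>\<Phi> x \<xi>\<close> also
      holds for the adjoint.\<close>
    have comm: "\<Phi> x (Lstar_star (\<Phi> x) \<xi>) = Lstar_star (\<Phi> x) (\<Phi> x \<xi>)"
      using mult[of x "star x"] mult[of "star x" x] by (simp add: mult.commute star fun_eq_iff)
    have Ls: "Lstar_star (\<Phi> x) \<xi> \<in> s_space"
      using LstarD(4)[OF L \<xi>] .
    have "complex_of_real ((ell2_norm (Lstar_star (\<Phi> x) \<xi>))\<^sup>2) = ell2_inner (\<Phi> x (Lstar_star (\<Phi> x) \<xi>)) \<xi>"
      using ell2_inner_self[OF s_subset_ell2[OF Ls]] Lstar_adjoint[OF L Ls \<xi>, of x] by simp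
    also have "\<dots> = complex_of_real ((ell2_norm (\<Phi> x \<xi>))\<^sup>2)"
      unfolding comm using Lstar_adjoint'[OF L mem(1)[OF \<xi>] \<xi>, of x x] ell2_inner_self[OF mem(2)[OF \<xi>]] by simp
    finally have "(ell2_norm (Lstar_star (\<Phi> x) \<xi>))\<^sup>2 = (ell2_norm (\<Phi> x \<xi>))\<^sup>2"
      by (simp only: of_real_eq_iff)
    then show ?thesis
      using ell2_norm_nonneg[OF s_subset_ell2[OF Ls]] ell2_norm_nonneg[OF mem(2)[OF \<xi>]]
      by (simp add: power2_eq_iff_nonneg)
  qed
  have dom_L: "\<exists>D>0. \<forall>x. (Lstar_seminorm N A (\<Phi> x))\<^sup>2 \<le> D * nrm x * Lstar_seminorm (2 * N) A (\<Phi> x)"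
    if A: "s_bounded A" "A \<noteq> {}" for N A
  proof -
    obtain D' where D': "\<And>\<xi>. \<xi> \<in> A \<Longrightarrow> s_norm 1 \<xi> \<le> D'"
      using A unfolding s_bounded_def by blast
    define D where "D = max D' 1"
    have As: "\<xi> \<in> s_space" "s_norm 1 \<xi> \<le> D" if "\<xi> \<in> A" for \<xi>
      using D'[OF that] that A by (auto simp: D_def s_bounded_def)
    have "(Lstar_seminorm N A (\<Phi> x))\<^sup>2 \<le> D * nrm x * Lstar_seminorm (2 * N) A (\<Phi> x)" for x
    proof -
      define R where "R = D * nrm x * Lstar_seminorm (2 * N) A (\<Phi> x)"
      \<comment> \<open>A seminorm of \<open>tau_star\<close> is a maximum over an operator and its
        adjoint; \<open>\<eta>\<close> stands for the image of \<open>\<xi>\<close> under either of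
        them.\<close>
      have step: "s_norm N \<eta> \<le> sqrt R"
        if "\<eta> \<in> s_space" "ell2_norm \<eta> \<le> nrm x * s_norm 1 \<xi>" "s_norm (2 * N) \<eta> \<le> Lstar_seminorm (2 * N) A (\<Phi> x)" "\<xi> \<in> A" for \<xi> \<eta>
      proof -
        have "ell2_norm \<eta> \<le> D * nrm x"
          using that(2) mult_left_mono[OF As(2)[OF that(4)] nrm_nonneg, of x] by (simp add: mult.commute)
        then have "ell2_norm \<eta> * s_norm (2 * N) \<eta> \<le> R"
          unfolding R_def using that(3) s_norm_nonneg[OF that(1)] nrm_nonneg
          by (intro mult_mono) (auto simp: D_def)
        then show ?thesis
          using s_norm_interpolation[OF that(1), of N] by (intro real_le_rsqrt) simp
      qed
      have "Lstar_seminorm N A (\<Phi> x) \<le> sqrt R"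
      proof (rule Lstar_seminorm_least[OF A(2)])
        fix \<xi> assume \<xi>: "\<xi> \<in> A"
        show "s_norm N (\<Phi> x \<xi>) \<le> sqrt R"
          using step[OF mem(1)[OF As(1)[OF \<xi>]] ell2_le[OF As(1)[OF \<xi>]] Lstar_seminorm_le(1)[OF L A(1) \<xi>] \<xi>] .
        show "s_norm N (Lstar_star (\<Phi> x) \<xi>) \<le> sqrt R"
          using step[OF LstarD(4)[OF L[of x] As(1)[OF \<xi>]] _ Lstar_seminorm_le(2)[OF L A(1) \<xi>] \<xi>]
            ell2_le[OF As(1)[OF \<xi>], of x] normal[OF As(1)[OF \<xi>], of x] by simp
      qed
      moreover have "0 \<le> Lstar_seminorm N A (\<Phi> x)"
        using seminorm_onD(1)[OF seminorm_Lstar_seminorm[OF A] L] .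
      ultimately show ?thesis
        unfolding R_def[symmetric] by (metis power_mono real_sqrt_pow2_iff real_sqrt_ge_0_iff order_trans)
    qed
    then show ?thesis
      by (intro exI[of _ D]) (auto simp: D_def)
  qed
  have dom: "\<exists>r. \<exists>C>0. \<forall>x. (p q x)\<^sup>2 \<le> C * nrm x * p r x" for q
  proof -
    obtain N A C where A: "s_bounded A" "A \<noteq> {}" and C: "C > 0" "\<And>x. p q x \<le> C * Lstar_seminorm N A (\<Phi> x)"
      using lower by blast
    obtain D where D: "D > 0" "\<And>x. (Lstar_seminorm N A (\<Phi> x))\<^sup>2 \<le> D * nrm x * Lstar_seminorm (2 * N) A (\<Phi> x)"
      using dom_L[OF A] by blast
    obtain r K where K: "K > 0" "\<And>x. Lstar_seminorm (2 * N) A (\<Phi> x) \<le> K * p r x"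
      using upper[OF A] by blast
    have "(p q x)\<^sup>2 \<le> (C\<^sup>2 * D * K) * nrm x * p r x" for x
    proof -
      have "(p q x)\<^sup>2 \<le> (C * Lstar_seminorm N A (\<Phi> x))\<^sup>2"
        using C(2)[of x] p_nonneg by (intro power_mono) auto
      also have "\<dots> = C\<^sup>2 * (Lstar_seminorm N A (\<Phi> x))\<^sup>2"
        by (simp add: power_mult_distrib)
      also have "\<dots> \<le> C\<^sup>2 * (D * nrm x * Lstar_seminorm (2 * N) A (\<Phi> x))"
        using D(2) by (intro mult_left_mono) auto
      also have "\<dots> \<le> C\<^sup>2 * (D * nrm x * (K * p r x))"
        using K(2) D(1) nrm_nonneg by (intro mult_left_mono) auto
      finally show ?thesis
        by (simp add: mult_ac)
    qed
    then show ?thesis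
      using C(1) D(1) K(1) by (intro exI[of _ r] exI[of _ "C\<^sup>2 * D * K"]) auto
  qed
  have "dominating_norm sc T nrm"
    unfolding dominating_norm_def
    using seminorm_nrm nrm_eq_0 cont fundamental_system_p dom by blast
  moreover have "B (x * y) z = B y (star x * z)" for x y z
    unfolding B_def mult star comp_def
    using Lstar_adjoint[OF L mem(1)[OF s.unit_seq_mem] mem(1)[OF s.unit_seq_mem]] by simp
  moreover have "\<exists>C>0. \<forall>y. nrm (x * y) \<le> C * nrm y" for x
  proof -
    obtain C where C: "C \<ge> 0" "\<And>\<xi>. \<xi> \<in> s_space \<Longrightarrow> ell2_norm (\<Phi> x \<xi>) \<le> C * ell2_norm \<xi>"
      using op_bound by blast
    \<comment> \<open>The operator bound \<open>C\<close> may be \<open>0\<close>, while a strictly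
      positive constant is asked for.\<close>
    have "nrm (x * y) \<le> (C + 1) * nrm y" for y
    proof (rule le_L2)
      fix n
      have "h (x * y) k \<le> (C + 1) * h y k" for k
      proof -
        have "ell2_norm (\<Phi> (x * y) (unit_seq k)) \<le> (C + 1) * ell2_norm (\<Phi> y (unit_seq k))"
          using C(2)[OF mem(1)[OF s.unit_seq_mem], of y k] ell2_norm_nonneg[OF memk, of y k]
          by (simp add: mult distrib_right)
        then show ?thesis
          by (simp add: h_def divide_right_mono)
      qed
      then have "L2_set (h (x * y)) {..<n} \<le> L2_set (\<lambda>k. (C + 1) * h y k) {..<n}"
        using h_nonneg by (intro L2_set_mono) auto
      also have "\<dots> = (C + 1) * L2_set (h y) {..<n}"
        using L2_set_right_distrib[of "C + 1" "h y" "{..<n}"] C(1) by simp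
      also have "\<dots> \<le> (C + 1) * nrm y"
        using L2_le C(1) by (intro mult_left_mono) auto
      finally show "L2_set (h (x * y)) {..<n} \<le> (C + 1) * nrm y" .
    qed
    then show ?thesis
      using C(1) by (intro exI[of _ "C + 1"]) auto
  qed
  ultimately show ?thesis
    unfolding betaDN_algebra_def using sp by blast
qed


section \<open>Nuclearity\<close>

lemma L2_set_sum_le: "L2_set (\<lambda>j. \<Sum>n\<in>A. f n j) J \<le> (\<Sum>n\<in>A. L2_set (f n) J)"
proof (induction A rule: infinite_finite_induct)
  case (insert a A)
  then show ?case
    using order_trans[OF L2_set_triangle_ineq add_left_mono[OF insert.IH]] by simp
qed (auto simp: L2_set_def)

text \<open>Reading a nuclear representation of the identity at the unit vectors gives
  \<open>e\<^sup>-\<^sup>r\<^sup>\<alpha>\<^sup>j \<le> C \<Sum>\<^sub>n c\<^sub>n |y\<^sub>n(j)|\<close>, and the right-hand side is square summable in \<open>j\<close> by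
  Minkowski's inequality.\<close>

lemma nuclear_imp_square_summable:
  assumes \<alpha>: "\<And>j. 0 \<le> \<alpha> j"
    and nuc: "nuclear_space seq_scale (power_series_space \<alpha>) (power_series_topology \<alpha>)"
  shows "\<exists>(m::nat) S. \<forall>n. L2_set (\<lambda>j. exp (- real m * \<alpha> j)) {..<n} \<le> S"
proof -
  let ?w = "\<lambda>q j. exp (real q * \<alpha> j)"
  interpret koethe_weights ?w
    by (rule power_series_weights[OF \<alpha>])
  have top: "power_series_topology \<alpha> = top_P"
    by (simp add: power_series_topology_def power_series_space_eq power_series_norm_eq)
  have "continuous_map top_P euclideanreal (wnorm (?w 0))"
    unfolding continuous_seminorm_iff[OF seminorm_p]
    by (intro bexI[OF _ rangeI[of "\<lambda>q. wnorm (?w q)" 0]] exI[of _ 1]) auto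
  note nuc' = mp[OF spec[OF conjunct2[OF nuc[unfolded nuclear_space_def top power_series_space_eq]]]
      conjI[OF seminorm_p[of 0] this]]
  then obtain q f y c where q: "seminorm_on seq_scale (koethe_space ?w) q" "continuous_map top_P euclideanreal q"
    and ys: "\<forall>n. y n \<in> koethe_space ?w" and cs: "\<forall>n. 0 \<le> (c n :: real)"
    and fcs: "\<forall>n. \<forall>x\<in>koethe_space ?w. cmod (f n x) \<le> c n * q x"
    and sm: "summable (\<lambda>n. c n * wnorm (?w 0) (y n))"
    and lims: "\<forall>x\<in>koethe_space ?w.
      (\<lambda>N. wnorm (?w 0) (x - (\<Sum>n<N. seq_scale (f n x) (y n)))) \<longlonglongrightarrow> 0"
    by (elim exE conjE) (rule that)
  note y = spec[OF ys] and c = spec[OF cs] and fc = bspec[OF spec[OF fcs]] and lim = bspec[OF lims]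
  obtain r C where C: "C > 0" "\<And>x. x \<in> koethe_space ?w \<Longrightarrow> q x \<le> C * wnorm (?w r) x"
    using q(2) unfolding continuous_seminorm_iff[OF q(1)] by blast
  define S where "S = C * (\<Sum>n. c n * wnorm (?w 0) (y n))"
  have "L2_set (\<lambda>j. exp (- real r * \<alpha> j)) {..<K} \<le> S" for K
  proof (rule LIMSEQ_le_const2)
    have comp: "(\<lambda>N. \<Sum>n<N. f n (unit_seq j) * y n j) \<longlonglongrightarrow> 1" for j
    proof -
      have "(\<lambda>N. 1 - (\<Sum>n<N. f n (unit_seq j) * y n j)) \<longlonglongrightarrow> 0"
      proof (rule Lim_null_comparison[OF always_eventually lim[OF unit_seq_mem[of j]]], rule allI)
        fix N
        have "unit_seq j - (\<Sum>n<N. seq_scale (f n (unit_seq j)) (y n)) \<in> koethe_space ?w"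
          by (intro diff_mem sum_mem scale_mem unit_seq_mem y)
        from component_le[OF this, of j 0]
        have "cmod (unit_seq j j - (\<Sum>n<N. seq_scale (f n (unit_seq j)) (y n)) j) \<le>
            wnorm (?w 0) (unit_seq j - (\<Sum>n<N. seq_scale (f n (unit_seq j)) (y n)))"
          by simp
        moreover have "(\<Sum>n<N. seq_scale (f n (unit_seq j)) (y n)) j = (\<Sum>n<N. f n (unit_seq j) * y n j)"
          by (induction N) (auto simp: seq_scale_def)
        ultimately show "norm (1 - (\<Sum>n<N. f n (unit_seq j) * y n j)) \<le>
            wnorm (?w 0) (unit_seq j - (\<Sum>n<N. seq_scale (f n (unit_seq j)) (y n)))"
          by (simp add: unit_seq_def)
      qed
      from tendsto_diff[OF tendsto_const this, of 1] show ?thesis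
        by simp
    qed
    have "(\<lambda>N. L2_set (\<lambda>j. exp (- real r * \<alpha> j) * cmod (\<Sum>n<N. f n (unit_seq j) * y n j)) {..<K})
        \<longlonglongrightarrow> L2_set (\<lambda>j. exp (- real r * \<alpha> j) * cmod 1) {..<K}"
      unfolding L2_set_def by (intro tendsto_intros comp)
    then show "(\<lambda>N. L2_set (\<lambda>j. exp (- real r * \<alpha> j) * cmod (\<Sum>n<N. f n (unit_seq j) * y n j)) {..<K})
        \<longlonglongrightarrow> L2_set (\<lambda>j. exp (- real r * \<alpha> j)) {..<K}"
      by simp
    have "L2_set (\<lambda>j. exp (- real r * \<alpha> j) * cmod (\<Sum>n<N. f n (unit_seq j) * y n j)) {..<K} \<le> S" for N
    proof -
      have "L2_set (\<lambda>j. exp (- real r * \<alpha> j) * cmod (\<Sum>n<N. f n (unit_seq j) * y n j)) {..<K} \<le>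
          L2_set (\<lambda>j. \<Sum>n<N. (C * c n) * (cmod (y n j) * ?w 0 j)) {..<K}"
      proof (rule L2_set_mono)
        fix j
        \<comment> \<open>\<open>f n\<close> is bounded by \<open>c n * q\<close>, and
          \<open>q\<close> of the unit sequence is at most \<open>C * exp (r * \<alpha> j)\<close>;
          the prefactor cancels this growth.\<close>
        have fe: "exp (- real r * \<alpha> j) * cmod (f n (unit_seq j)) \<le> C * c n" for n
        proof -
          have "cmod (f n (unit_seq j)) \<le> c n * (C * exp (real r * \<alpha> j))"
            using fc[OF unit_seq_mem, of n j] mult_left_mono[OF C(2)[OF unit_seq_mem[of j]] c[of n]]
            by (simp add: wnorm_unit_seq)
          then have "exp (- real r * \<alpha> j) * cmod (f n (unit_seq j)) \<le> exp (- real r * \<alpha> j) * (c n * (C * exp (real r * \<alpha> j)))"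
            by (intro mult_left_mono) auto
          also have "\<dots> = C * c n * (exp (- real r * \<alpha> j) * exp (real r * \<alpha> j))"
            by simp
          also have "exp (- real r * \<alpha> j) * exp (real r * \<alpha> j) = 1"
            by (simp add: exp_add[symmetric])
          finally show ?thesis
            by simp
        qed
        have "exp (- real r * \<alpha> j) * cmod (\<Sum>n<N. f n (unit_seq j) * y n j) \<le>
            exp (- real r * \<alpha> j) * (\<Sum>n<N. cmod (f n (unit_seq j)) * cmod (y n j))"
          using norm_sum[of "\<lambda>n. f n (unit_seq j) * y n j" "{..<N}"]
          by (intro mult_left_mono) (auto simp: norm_mult)
        also have "\<dots> = (\<Sum>n<N. (exp (- real r * \<alpha> j) * cmod (f n (unit_seq j))) * cmod (y n j))"
          by (simp add: sum_distrib_left mult.assoc)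
        also have "\<dots> \<le> (\<Sum>n<N. (C * c n) * cmod (y n j))"
          by (intro sum_mono mult_right_mono fe) auto
        finally show "exp (- real r * \<alpha> j) * cmod (\<Sum>n<N. f n (unit_seq j) * y n j) \<le>
            (\<Sum>n<N. (C * c n) * (cmod (y n j) * ?w 0 j))"
          by simp
      qed auto
      also have "\<dots> \<le> (\<Sum>n<N. L2_set (\<lambda>j. (C * c n) * (cmod (y n j) * ?w 0 j)) {..<K})"
        by (rule L2_set_sum_le)
      also have "\<dots> \<le> (\<Sum>n<N. C * (c n * wnorm (?w 0) (y n)))"
      proof (rule sum_mono)
        fix n
        have "L2_set (\<lambda>j. (C * c n) * (cmod (y n j) * ?w 0 j)) {..<K} =
            (C * c n) * L2_set (\<lambda>j. cmod (y n j) * ?w 0 j) {..<K}"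
          using L2_set_right_distrib[of "C * c n" "\<lambda>j. cmod (y n j) * ?w 0 j"] C(1) c[of n] by simp
        also have "\<dots> \<le> (C * c n) * wnorm (?w 0) (y n)"
        proof (intro mult_left_mono L2_set_le_wnorm)
          show "y n \<in> wl2 (?w 0)"
            using y[of n] unfolding koethe_space_def by blast
        qed (use C(1) c[of n] in auto)
        finally show "L2_set (\<lambda>j. (C * c n) * (cmod (y n j) * ?w 0 j)) {..<K} \<le> C * (c n * wnorm (?w 0) (y n))"
          by (simp add: mult.assoc)
      qed
      also have "\<dots> \<le> S"
        unfolding S_def sum_distrib_left[symmetric]
        using C(1) c seminorm_onD(1)[OF seminorm_p[of 0] y]
        by (intro mult_left_mono sum_le_suminf sm) auto
      finally show ?thesis .
    qed
    then show "\<exists>N. \<forall>n\<ge>N. L2_set (\<lambda>j. exp (- real r * \<alpha> j) * cmod (\<Sum>n<n. f n (unit_seq j) * y n j)) {..<K} \<le> S"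
      by blast
  qed
  then show ?thesis
    by blast
qed

section \<open>Orthonormal bases in power series spaces\<close>

context scalar_product_space
begin

text \<open>Both span conditions matter: \<open>g n\<close> in the span of \<open>e\<close> up to
  \<open>n\<close> bounds the seminorms of \<open>g n\<close> by Bernstein, and \<open>e n\<close>
  in the span of \<open>g\<close> up to \<open>n\<close> makes heads of expansions orthogonal to
  later basis vectors.\<close>

lemma gram_schmidt:
  assumes indep: "\<And>n::nat. e n \<notin> span (e ` {..<n})"
  shows "\<exists>g. (\<forall>m n. B (g m) (g n) = (if m = n then 1 else 0)) \<and>
    (\<forall>n. g n \<in> span (e ` {..n})) \<and> (\<forall>n. e n \<in> span (g ` {..n}))"
proof -
  define P where "P = (\<lambda>g n r. B r r = 1 \<and> (\<forall>m<n. B r (g m) = 0) \<and> r \<in> span (e ` {..n}) \<and>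
    e n \<in> span (insert r (g ` {..<n})))"
  have "\<exists>g. \<forall>n. P g n (g n)"
  proof (rule dependent_wellorder_choice)
    fix r and f g :: "nat \<Rightarrow> 'e" and n assume "\<And>m. m < n \<Longrightarrow> f m = g m"
    moreover from this have "f ` {..<n} = g ` {..<n}"
      by (intro image_cong) auto
    ultimately show "P f n r = P g n r"
      unfolding P_def by auto
  next
    fix n g assume g: "\<And>m. m < n \<Longrightarrow> P g m (g m)"
    have orth: "B (g k) (g m) = (if k = m then 1 else 0)" if "k < n" "m < n" for k m
      using g[OF that(1)] g[OF that(2)] B_commute[of "g k" "g m"]
      by (cases k m rule: linorder_cases) (auto simp: P_def)
    define u where "u = (\<Sum>m<n. sc (B (e n) (g m)) (g m))"
    define v where "v = e n - u"
    have gs: "g m \<in> span (e ` {..<n})" if "m < n" for m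
    proof -
      have "g m \<in> span (e ` {..m})" "e ` {..m} \<subseteq> e ` {..<n}"
        using g[OF that] that by (auto simp: P_def)
      then show ?thesis
        using span_mono by blast
    qed
    have u_e: "u \<in> span (e ` {..<n})"
      unfolding u_def by (intro span_sum span_scale gs) auto
    have "v \<noteq> 0"
      using indep[of n] u_e by (auto simp: v_def)
    then have nv: "nrm v > 0"
      using nrm_eq_0 nrm_nonneg[of v] by force
    have Bv: "B v (g m) = 0" if "m < n" for m
    proof -
      have "B u (g m) = (\<Sum>k<n. B (e n) (g k) * B (g k) (g m))"
        by (simp add: u_def B_sum_left B_scale_left)
      also have "\<dots> = (\<Sum>k<n. if k = m then B (e n) (g m) else 0)"
        using that by (intro sum.cong) (auto simp: orth)
      also have "\<dots> = B (e n) (g m)"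
        using that by simp
      finally show ?thesis
        by (simp add: v_def B_diff_left)
    qed
    define r where "r = sc (complex_of_real (1 / nrm v)) v"
    have "B r r = complex_of_real ((1 / nrm v) * (1 / nrm v) * (nrm v)\<^sup>2)"
      by (simp add: r_def B_scale_left B_scale_right B_self[of v])
    then have "B r r = 1"
      using nv by (simp add: power2_eq_square)
    moreover have "\<forall>m<n. B r (g m) = 0"
      by (simp add: r_def B_scale_left Bv)
    moreover have "r \<in> span (e ` {..n})"
    proof -
      have "u \<in> span (e ` {..n})"
        using u_e span_mono[of "e ` {..<n}" "e ` {..n}"] by fastforce
      then show ?thesis
        unfolding r_def v_def by (intro span_scale span_diff) (auto intro: span_base)
    qed
    moreover have "e n \<in> span (insert r (g ` {..<n}))"
    proof -
      have "e n = sc (complex_of_real (nrm v)) r + u"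
        using nv by (simp add: r_def v_def)
      moreover have "sc (complex_of_real (nrm v)) r + u \<in> span (insert r (g ` {..<n}))"
        unfolding u_def by (intro span_add span_scale span_sum) (auto intro: span_base)
      ultimately show ?thesis
        by simp
    qed
    ultimately show "\<exists>r. P g n r"
      by (auto simp: P_def)
  qed
  then obtain g where g: "\<And>n. P g n (g n)"
    by blast
  have "B (g m) (g n) = (if m = n then 1 else 0)" for m n
    using g[of m] g[of n] B_commute[of "g m" "g n"]
    by (cases m n rule: linorder_cases) (auto simp: P_def)
  moreover have "insert (g n) (g ` {..<n}) = g ` {..n}" for n
    by (auto simp: le_less)
  ultimately show ?thesis
    using g unfolding P_def by (intro exI[of _ g]) auto
qed

end

text \<open>The hypotheses on the norm and on the exponents in analytic form, relative to the fixed
  seminorms \<open>p\<close>.\<close>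

locale dominated_model = power_series_model sc T \<alpha> \<Psi> + scalar_product_space sc B
  for sc :: "complex \<Rightarrow> 'e::ab_group_add \<Rightarrow> 'e" and T \<alpha> \<Psi> B +
  assumes incseq_alpha: "incseq \<alpha>"
    and nrm_bound: "\<exists>k. \<exists>C>0. \<forall>x. nrm x \<le> C * p k x"
    and dominating: "\<exists>r. \<exists>C>0. \<forall>x. (p q x)\<^sup>2 \<le> C * nrm x * p r x"
    and nuclearity: "\<exists>(m::nat) S. \<forall>n. L2_set (\<lambda>j. exp (- real m * \<alpha> j)) {..<n} \<le> S"
begin

definition e :: "nat \<Rightarrow> 'e"
  where "e j = inv \<Psi> (unit_seq j)"

lemma Psi_e: "\<Psi> (e j) = unit_seq j"
  using Psi_range Lam.unit_seq_mem[of j] unfolding e_def by (metis f_inv_into_f)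

definition hd_sum :: "nat \<Rightarrow> 'e \<Rightarrow> 'e"
  where "hd_sum n x = (\<Sum>j<n. sc (\<Psi> x j) (e j))"

lemma Psi_hd_sum: "\<Psi> (hd_sum n x) = trunc n (\<Psi> x)"
  by (simp add: hd_sum_def Psi_sum Psi_scale Psi_e trunc_eq_sum)

text \<open>From index \<open>n\<close> on, \<open>exp (m * \<alpha> j)\<close> is at least
  \<open>exp (m * \<alpha> n)\<close>, so \<open>m\<close> extra levels of the seminorm buy this
  factor.\<close>

lemma tail_bound: "p q (x - hd_sum n x) \<le> exp (- real m * \<alpha> n) * p (q + m) x"
  unfolding p_def Psi_diff Psi_hd_sum
proof (rule wl2_bound(2))
  fix k
  have "L2_set (\<lambda>j. cmod ((\<Psi> x - trunc n (\<Psi> x)) j) * exp (real q * \<alpha> j)) {..<k} \<le>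
      L2_set (\<lambda>j. exp (- real m * \<alpha> n) * (cmod (\<Psi> x j) * exp (real (q + m) * \<alpha> j))) {..<k}"
  proof (rule L2_set_mono)
    fix j
    show "cmod ((\<Psi> x - trunc n (\<Psi> x)) j) * exp (real q * \<alpha> j) \<le>
        exp (- real m * \<alpha> n) * (cmod (\<Psi> x j) * exp (real (q + m) * \<alpha> j))"
    proof (cases "j < n")
      case False
      then have "real m * \<alpha> n \<le> real m * \<alpha> j"
        using incseq_alpha by (intro mult_left_mono) (auto simp: incseq_def)
      then have "exp (real q * \<alpha> j) \<le> exp (- real m * \<alpha> n) * exp (real (q + m) * \<alpha> j)"
        unfolding exp_add[symmetric] by (simp add: algebra_simps)
      then have "cmod (\<Psi> x j) * exp (real q * \<alpha> j) \<le> cmod (\<Psi> x j) * (exp (- real m * \<alpha> n) * exp (real (q + m) * \<alpha> j))"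
        by (intro mult_left_mono) auto
      then show ?thesis
        using False by (simp add: trunc_def mult_ac)
    qed (simp add: trunc_def)
  qed auto
  also have "\<dots> = exp (- real m * \<alpha> n) * L2_set (\<lambda>j. cmod (\<Psi> x j) * exp (real (q + m) * \<alpha> j)) {..<k}"
    by (subst L2_set_right_distrib) auto
  also have "\<dots> \<le> exp (- real m * \<alpha> n) * wnorm (\<lambda>j. exp (real (q + m) * \<alpha> j)) (\<Psi> x)"
    by (intro mult_left_mono L2_set_le_wnorm Psi_wl2) auto
  finally show "L2_set (\<lambda>j. cmod ((\<Psi> x - trunc n (\<Psi> x)) j) * exp (real q * \<alpha> j)) {..<k} \<le>
      exp (- real m * \<alpha> n) * wnorm (\<lambda>j. exp (real (q + m) * \<alpha> j)) (\<Psi> x)" .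
qed

text \<open>Finite combinations of the vectors \<open>e j\<close> are dense in the Hilbert norm,
  which is the completeness needed for Parseval's identity.\<close>

lemma nrm_tail_tendsto: "(\<lambda>n. nrm (x - hd_sum n x)) \<longlonglongrightarrow> 0"
proof -
  obtain k C where C: "\<And>x. nrm x \<le> C * p k x"
    using nrm_bound by blast
  have "(\<lambda>n. C * p k (x - hd_sum n x)) \<longlonglongrightarrow> 0"
    unfolding p_def Psi_diff Psi_hd_sum by (intro tendsto_mult_right_zero wnorm_trunc_tendsto Psi_wl2)
  then show ?thesis
  proof (rule Lim_null_comparison[rotated], intro always_eventually allI)
    show "norm (nrm (x - hd_sum n x)) \<le> C * p k (x - hd_sum n x)" for n
      using C[of "x - hd_sum n x"] nrm_nonneg[of "x - hd_sum n x"] by simp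
  qed
qed

lemma span_e_support: "u \<in> span (e ` {..<n}) \<Longrightarrow> n \<le> j \<Longrightarrow> \<Psi> u j = 0"
proof (induction u rule: span_induct_alt)
  case base
  then show ?case
    using Psi_scale[of 0 0] by (simp add: seq_scale_def)
next
  case (step c x y)
  then show ?case
    by (auto simp: Psi_add Psi_scale Psi_e seq_scale_def unit_seq_def)
qed

lemma e_independent: "e n \<notin> span (e ` {..<n})"
  using span_e_support[of "e n" n n] by (auto simp: Psi_e unit_seq_def)

text \<open>The counterpart of \<open>tail_bound\<close>: with support up to \<open>n\<close>,
  raising the level by \<open>d\<close> costs at most \<open>exp (d * \<alpha> n)\<close>.\<close>

lemma bernstein:
  assumes "u \<in> span (e ` {..n})"
  shows "p (q + d) u \<le> exp (real d * \<alpha> n) * p q u"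
  unfolding p_def
proof (rule wl2_bound(2))
  have supp: "\<Psi> u j = 0" if "j > n" for j
    using span_e_support[of u "Suc n" j] assms that by (simp add: lessThan_Suc_atMost)
  fix k
  have "L2_set (\<lambda>j. cmod (\<Psi> u j) * exp (real (q + d) * \<alpha> j)) {..<k} \<le>
      L2_set (\<lambda>j. exp (real d * \<alpha> n) * (cmod (\<Psi> u j) * exp (real q * \<alpha> j))) {..<k}"
  proof (rule L2_set_mono)
    fix j
    show "cmod (\<Psi> u j) * exp (real (q + d) * \<alpha> j) \<le> exp (real d * \<alpha> n) * (cmod (\<Psi> u j) * exp (real q * \<alpha> j))"
    proof (cases "j > n")
      case False
      then have "real d * \<alpha> j \<le> real d * \<alpha> n"
        using incseq_alpha by (intro mult_left_mono) (auto simp: incseq_def)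
      then have "exp (real (q + d) * \<alpha> j) \<le> exp (real d * \<alpha> n) * exp (real q * \<alpha> j)"
        unfolding exp_add[symmetric] by (simp add: algebra_simps)
      then have "cmod (\<Psi> u j) * exp (real (q + d) * \<alpha> j) \<le> cmod (\<Psi> u j) * (exp (real d * \<alpha> n) * exp (real q * \<alpha> j))"
        by (intro mult_left_mono) auto
      then show ?thesis
        by (simp add: mult_ac)
    qed (simp add: supp)
  qed auto
  also have "\<dots> = exp (real d * \<alpha> n) * L2_set (\<lambda>j. cmod (\<Psi> u j) * exp (real q * \<alpha> j)) {..<k}"
    by (subst L2_set_right_distrib) auto
  also have "\<dots> \<le> exp (real d * \<alpha> n) * wnorm (\<lambda>j. exp (real q * \<alpha> j)) (\<Psi> u)"
    by (intro mult_left_mono L2_set_le_wnorm Psi_wl2) auto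
  finally show "L2_set (\<lambda>j. cmod (\<Psi> u j) * exp (real (q + d) * \<alpha> j)) {..<k} \<le>
      exp (real d * \<alpha> n) * wnorm (\<lambda>j. exp (real q * \<alpha> j)) (\<Psi> u)" .
qed

text \<open>Combine domination with Bernstein's inequality and cancel \<open>p q u\<close>.\<close>

lemma span_bound: "\<exists>d. \<exists>C>0. \<forall>n. \<forall>u\<in>span (e ` {..n}). p q u \<le> C * exp (real d * \<alpha> n) * nrm u"
proof -
  obtain r C where C: "C > 0" "\<And>x. (p q x)\<^sup>2 \<le> C * nrm x * p r x"
    using dominating by blast
  have "p q u \<le> C * exp (real r * \<alpha> n) * nrm u" if u: "u \<in> span (e ` {..n})" for n u
  proof (cases "p q u = 0")
    case False
    then have pos: "p q u > 0"
      using p_nonneg[of q u] by simp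
    \<comment> \<open>Raising the level from \<open>r\<close> to \<open>q + r\<close> lets Bernstein
      start at level \<open>q\<close>, so that \<open>p q u\<close> occurs on both sides.\<close>
    have "(p q u)\<^sup>2 \<le> C * nrm u * p (q + r) u"
      using C(1) nrm_nonneg[of u] by (intro order_trans[OF C(2) mult_left_mono[OF E.p_mono]]) auto
    also have "\<dots> \<le> C * nrm u * (exp (real r * \<alpha> n) * p q u)"
      using bernstein[OF u] C(1) nrm_nonneg by (intro mult_left_mono) auto
    finally have "p q u * p q u \<le> (C * exp (real r * \<alpha> n) * nrm u) * p q u"
      by (simp add: power2_eq_square mult_ac)
    then show ?thesis
      using pos by simp
  qed (use C(1) nrm_nonneg in simp)
  then show ?thesis
    using C(1) by blast
qed

text \<open>\<open>\<iota>\<close> takes coefficients in the Gram-Schmidt basis,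
  \<open>\<pi>\<close> sums the series with given coefficients. The last two clauses say that
  \<open>\<pi>\<close> is the adjoint of \<open>\<iota>\<close> and, by Parseval, that
  \<open>\<iota>\<close> preserves the scalar product; since \<open>B\<close> is nondegenerate,
  together they make \<open>\<pi>\<close> a left inverse of \<open>\<iota>\<close>.\<close>

lemma coordinate_isometry:
  "\<exists>\<iota> \<pi>. (\<forall>x. \<iota> x \<in> koethe_space (\<lambda>q j. exp (real q * \<alpha> j))) \<and>
    (\<forall>q. \<exists>r. \<exists>C>0. \<forall>x. wnorm (\<lambda>j. exp (real q * \<alpha> j)) (\<iota> x) \<le> C * p r x) \<and>
    (\<forall>q. \<exists>r. \<exists>C>0. \<forall>\<xi>\<in>koethe_space (\<lambda>q j. exp (real q * \<alpha> j)). p q (\<pi> \<xi>) \<le> C * wnorm (\<lambda>j. exp (real r * \<alpha> j)) \<xi>) \<and>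
    (\<forall>x. \<forall>\<xi>\<in>koethe_space (\<lambda>q j. exp (real q * \<alpha> j)). B x (\<pi> \<xi>) = ell2_inner (\<iota> x) \<xi>) \<and>
    (\<forall>x z. ell2_inner (\<iota> z) (\<iota> x) = B z x)"
proof -
  let ?w = "\<lambda>q j. exp (real q * \<alpha> j)"
  obtain g where g: "\<And>m n. B (g m) (g n) = (if m = n then 1 else 0)"
    "\<And>n. g n \<in> span (e ` {..n})" "\<And>n. e n \<in> span (g ` {..n})"
    using gram_schmidt[of e] e_independent by blast
  have nrm_g: "nrm (g n) = 1" for n
    by (simp add: hilbert_norm_def g(1))
  obtain m S where S: "\<And>n. L2_set (\<lambda>j. exp (- real m * \<alpha> j)) {..<n} \<le> S"
    using nuclearity by blast
  obtain k C0 where C0: "C0 > 0" "\<And>x. nrm x \<le> C0 * p k x"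
    using nrm_bound by blast
  have S0: "S \<ge> 0"
    using order_trans[OF L2_set_nonneg S] .
  have hd_span: "hd_sum n x \<in> span (g ` {..<n})" for n x
    unfolding hd_sum_def
  proof (intro span_sum span_scale)
    fix j assume "j \<in> {..<n}"
    then have "g ` {..j} \<subseteq> g ` {..<n}"
      by auto
    then show "e j \<in> span (g ` {..<n})"
      using g(3)[of j] span_mono by blast
  qed
  have orth: "B u (g n) = 0" if "u \<in> span (g ` {..<n})" for u n
    using that by (induction u rule: span_induct_alt) (auto simp: B_zero_left B_add_left B_scale_left g(1))
  \<comment> \<open>The head \<open>hd_sum n x\<close> is orthogonal to \<open>g n\<close>, so only
    the tail contributes to the coefficient.\<close>
  have coeff: "cmod (B x (g n)) \<le> C0 * (exp (- real l * \<alpha> n) * p (k + l) x)" for x n l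
  proof -
    have "cmod (B x (g n)) = cmod (B (x - hd_sum n x) (g n))"
      by (simp add: B_diff_left orth[OF hd_span])
    also have "\<dots> \<le> C0 * p k (x - hd_sum n x)"
      using order_trans[OF Cauchy_Schwarz C0(2)[of "x - hd_sum n x", THEN mult_right_mono, of "nrm (g n)"]]
      by (simp add: nrm_g)
    also have "\<dots> \<le> C0 * (exp (- real l * \<alpha> n) * p (k + l) x)"
      using tail_bound C0(1) by (intro mult_left_mono) auto
    finally show ?thesis .
  qed
  define \<iota> where "\<iota> = (\<lambda>x n. B x (g n))"
  \<comment> \<open>Levels add up: \<open>k\<close> for the continuity of the norm, \<open>q\<close>
    to absorb the weight, \<open>m\<close> to leave a square summable factor. The summand
    \<open>1\<close> keeps the constant positive.\<close>
  have \<iota>: "\<iota> x \<in> wl2 (?w q) \<and> wnorm (?w q) (\<iota> x) \<le> (C0 * S + 1) * p (k + (q + m)) x" for x q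
  proof -
    let ?a = "C0 * p (k + (q + m)) x"
    have "L2_set (\<lambda>n. cmod (\<iota> x n) * ?w q n) {..<N} \<le> (C0 * S + 1) * p (k + (q + m)) x" for N
    proof -
      have "L2_set (\<lambda>n. cmod (\<iota> x n) * ?w q n) {..<N} \<le> L2_set (\<lambda>n. ?a * exp (- real m * \<alpha> n)) {..<N}"
      proof (rule L2_set_mono)
        fix n
        have "cmod (\<iota> x n) * ?w q n \<le> (C0 * (exp (- real (q + m) * \<alpha> n) * p (k + (q + m)) x)) * ?w q n"
          unfolding \<iota>_def by (intro mult_right_mono coeff) auto
        also have "\<dots> = ?a * (exp (- real (q + m) * \<alpha> n) * ?w q n)"
          by simp
        also have "exp (- real (q + m) * \<alpha> n) * ?w q n = exp (- real m * \<alpha> n)"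
          unfolding exp_add[symmetric] by (simp add: algebra_simps)
        finally show "cmod (\<iota> x n) * ?w q n \<le> ?a * exp (- real m * \<alpha> n)" .
      qed auto
      also have "\<dots> = ?a * L2_set (\<lambda>n. exp (- real m * \<alpha> n)) {..<N}"
        using L2_set_right_distrib[of ?a "\<lambda>n. exp (- real m * \<alpha> n)"] C0(1) p_nonneg by simp
      also have "\<dots> \<le> ?a * S"
        using S C0(1) p_nonneg by (intro mult_left_mono) auto
      also have "\<dots> \<le> (C0 * S + 1) * p (k + (q + m)) x"
        using p_nonneg[of "k + (q + m)" x] by (simp add: algebra_simps)
      finally show ?thesis .
    qed
    then show ?thesis
      by (intro conjI wl2_bound)
  qed
  have C0S: "C0 * S + 1 > 0"
    using C0(1) S0 by (simp add: add_nonneg_pos)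
  have parseval: "(\<lambda>n. B z (g n) * cnj (B x (g n))) sums B z x" for z x
  proof -
    \<comment> \<open>\<open>R N\<close> is the orthogonal projection onto the span of the first
      \<open>N\<close> basis vectors.\<close>
    define R where "R = (\<lambda>N x. \<Sum>n<N. sc (B x (g n)) (g n))"
    have R_g: "B (R N y) (g n) = B y (g n)" if "n < N" for N y n
    proof -
      have "B (R N y) (g n) = (\<Sum>l<N. if l = n then B y (g n) else 0)"
        unfolding R_def B_sum_left B_scale_left g(1) by (intro sum.cong) auto
      then show ?thesis
        using that by simp
    qed
    have R_span: "R N u = u" if "u \<in> span (g ` {..<N})" for N u
      using that
    proof (induction u rule: span_induct_alt)
      case base
      then show ?case
        by (simp add: R_def B_zero_left)
    next
      case (step c x y)
      then obtain i where i: "i < N" "x = g i"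
        by auto
      have "R N (g i) = (\<Sum>l<N. if l = i then g i else 0)"
        unfolding R_def g(1) by (intro sum.cong) auto
      then have "R N x = x"
        using i by simp
      moreover have "R N (sc c x + y) = sc c (R N x) + R N y"
        unfolding R_def by (simp add: B_add_left B_scale_left scale_left_distrib sum.distrib scale_sum_right)
      ultimately show ?case
        using step.IH by simp
    qed
    have bessel: "nrm (y - R N y) \<le> nrm y" for N y
    proof -
      have "B (y - R N y) (R N y) = (\<Sum>n<N. cnj (B y (g n)) * B (y - R N y) (g n))"
        unfolding R_def[of] B_sum_right B_scale_right by simp
      also have "\<dots> = 0"
        using R_g by (intro sum.neutral) (simp add: B_diff_left)
      finally have 0: "B (y - R N y) (R N y) = 0" .
      have "B y y = B ((y - R N y) + R N y) ((y - R N y) + R N y)"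
        by simp
      also have "\<dots> = B (y - R N y) (y - R N y) + B (R N y) (R N y)"
        using 0 B_commute[of "R N y" "y - R N y"] by (simp only: B_add_left B_add_right) simp
      finally have "Re (B (y - R N y) (y - R N y)) \<le> Re (B y y)"
        using B_self_nonneg[of "R N y"] by simp
      then show ?thesis
        by (simp add: hilbert_norm_def)
    qed
    \<comment> \<open>\<open>R N\<close> fixes the head, so its error at \<open>x\<close> equals its
      error at the tail, which is at most the norm of the tail.\<close>
    have "nrm (x - R N x) \<le> nrm (x - hd_sum N x)" for N
    proof -
      have "R N (x - hd_sum N x) = R N x - R N (hd_sum N x)"
        unfolding R_def by (simp add: B_diff_left scale_left_diff_distrib sum_subtractf)
      then have "x - R N x = (x - hd_sum N x) - R N (x - hd_sum N x)"
        by (simp add: R_span[OF hd_span])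
      then show ?thesis
        using bessel[of "x - hd_sum N x" N] by (simp only:)
    qed
    then have "(\<lambda>N. nrm (x - R N x)) \<longlonglongrightarrow> 0"
      using nrm_nonneg by (intro Lim_null_comparison[OF always_eventually nrm_tail_tendsto[of x]]) simp
    then have "(\<lambda>N. nrm z * nrm (x - R N x)) \<longlonglongrightarrow> 0"
      by (rule tendsto_mult_right_zero)
    then have "(\<lambda>N. B z (R N x) - B z x) \<longlonglongrightarrow> 0"
    proof (rule Lim_null_comparison[rotated], intro always_eventually allI)
      show "norm (B z (R N x) - B z x) \<le> nrm z * nrm (x - R N x)" for N
        using Cauchy_Schwarz[of z "x - R N x"] by (simp add: B_diff_right norm_minus_commute)
    qed
    then have "(\<lambda>N. B z (R N x)) \<longlonglongrightarrow> B z x"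
      by (simp add: LIM_zero_iff)
    then show ?thesis
      by (simp add: sums_def R_def B_sum_right B_scale_right mult.commute)
  qed
  have "\<exists>d. \<exists>C>0. \<forall>n. p q (g n) \<le> C * exp (real d * \<alpha> n)" for q
  proof -
    obtain d C where C: "C > 0" "\<And>n u. u \<in> span (e ` {..n}) \<Longrightarrow> p q u \<le> C * exp (real d * \<alpha> n) * nrm u"
      using span_bound by blast
    then show ?thesis
      using C(2)[OF g(2)] nrm_g by (intro exI[of _ d] exI[of _ C]) auto
  qed
  then obtain d D where D: "\<And>q. D q > 0" "\<And>q n. p q (g n) \<le> D q * exp (real (d q) * \<alpha> n)"
    by metis
  \<comment> \<open>The growth \<open>d q\<close> of the basis vectors is raised by
    \<open>m\<close>, so that a factor \<open>exp (- m * \<alpha> n)\<close> is left over for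
    Cauchy-Schwarz.\<close>
  have part: "(\<Sum>n<N. p q (sc (\<xi> n) (g n))) \<le> (D q * S + 1) * wnorm (?w (d q + m)) \<xi>"
    if \<xi>: "\<xi> \<in> koethe_space ?w" for \<xi> q N
  proof -
    have \<xi>q: "\<xi> \<in> wl2 (?w (d q + m))"
      using \<xi> unfolding koethe_space_def by blast
    have "(\<Sum>n<N. p q (sc (\<xi> n) (g n))) \<le> (\<Sum>n<N. D q * (\<bar>exp (- real m * \<alpha> n)\<bar> * (cmod (\<xi> n) * ?w (d q + m) n)))"
    proof (rule sum_mono)
      fix n
      have "p q (sc (\<xi> n) (g n)) = cmod (\<xi> n) * p q (g n)"
        using seminorm_onD(2)[OF E.seminorm_p] by simp
      also have "\<dots> \<le> cmod (\<xi> n) * (D q * exp (real (d q) * \<alpha> n))"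
        by (intro mult_left_mono D) auto
      also have "exp (real (d q) * \<alpha> n) = exp (- real m * \<alpha> n) * ?w (d q + m) n"
        unfolding exp_add[symmetric] by (simp add: algebra_simps)
      finally show "p q (sc (\<xi> n) (g n)) \<le> D q * (\<bar>exp (- real m * \<alpha> n)\<bar> * (cmod (\<xi> n) * ?w (d q + m) n))"
        by (simp add: mult_ac)
    qed
    also have "\<dots> = D q * (\<Sum>n<N. \<bar>exp (- real m * \<alpha> n)\<bar> * (cmod (\<xi> n) * ?w (d q + m) n))"
      by (simp add: sum_distrib_left)
    also have "\<dots> \<le> D q * (L2_set (\<lambda>n. exp (- real m * \<alpha> n)) {..<N} * wnorm (?w (d q + m)) \<xi>)"
      using D(1)[of q] by (intro mult_left_mono wl2_sum_le \<xi>q) auto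
    also have "\<dots> \<le> D q * (S * wnorm (?w (d q + m)) \<xi>)"
      using D(1)[of q] S wnorm_nonneg[OF \<xi>q] by (intro mult_left_mono mult_right_mono) auto
    also have "\<dots> \<le> (D q * S + 1) * wnorm (?w (d q + m)) \<xi>"
      using wnorm_nonneg[OF \<xi>q] by (simp add: algebra_simps)
    finally show ?thesis .
  qed
  have "\<exists>l. \<forall>q. (\<lambda>n. p q (l - (\<Sum>i<n. sc (\<xi> i) (g i)))) \<longlonglongrightarrow> 0" if \<xi>: "\<xi> \<in> koethe_space ?w" for \<xi>
  proof -
    have "summable (\<lambda>n. p q (sc (\<xi> n) (g n)))" for q
      using part[OF \<xi>] p_nonneg by (intro summableI_nonneg_bounded) auto
    from E.series_converges[OF UNIV_I this] show ?thesis
      by simp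
  qed
  note ex_limit = this
  define \<pi> where "\<pi> = (\<lambda>\<xi>. SOME l. \<forall>q. (\<lambda>n. p q (l - (\<Sum>i<n. sc (\<xi> i) (g i)))) \<longlonglongrightarrow> 0)"
  have \<pi>: "(\<lambda>n. p q (\<pi> \<xi> - (\<Sum>i<n. sc (\<xi> i) (g i)))) \<longlonglongrightarrow> 0" if "\<xi> \<in> koethe_space ?w" for \<xi> q
    unfolding \<pi>_def using someI_ex[OF ex_limit[OF that]] by (rule spec)
  have \<pi>_bound: "p q (\<pi> \<xi>) \<le> (D q * S + 1) * wnorm (?w (d q + m)) \<xi>" if \<xi>: "\<xi> \<in> koethe_space ?w" for \<xi> q
  proof (rule LIMSEQ_le_const)
    let ?b = "(D q * S + 1) * wnorm (?w (d q + m)) \<xi>"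
    show "(\<lambda>n. p q (\<pi> \<xi> - (\<Sum>i<n. sc (\<xi> i) (g i))) + ?b) \<longlonglongrightarrow> ?b"
      using tendsto_add[OF \<pi>[OF \<xi>] tendsto_const[of ?b]] by simp
    have "p q (\<pi> \<xi>) \<le> p q (\<pi> \<xi> - (\<Sum>i<n. sc (\<xi> i) (g i))) + ?b" for n
      using E.seminorm_triangle[OF E.seminorm_p, of "\<pi> \<xi>" "\<Sum>i<n. sc (\<xi> i) (g i)" 0 q]
        E.seminorm_sum[OF E.seminorm_p, of "{..<n}" "\<lambda>i. sc (\<xi> i) (g i)" q] part[OF \<xi>, of q n] by simp
    then show "\<exists>N. \<forall>n\<ge>N. p q (\<pi> \<xi>) \<le> p q (\<pi> \<xi> - (\<Sum>i<n. sc (\<xi> i) (g i))) + ?b"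
      by blast
  qed
  have DS: "D q * S + 1 > 0" for q
    using D(1)[of q] S0 by (simp add: add_nonneg_pos)
  have Lam_ell2: "\<xi> \<in> ell2" if "\<xi> \<in> koethe_space ?w" for \<xi>
  proof -
    have "\<xi> \<in> wl2 (?w 0)"
      using that unfolding koethe_space_def by blast
    then show ?thesis
      by (simp add: ell2_eq)
  qed
  have \<iota>_mem: "\<iota> x \<in> koethe_space ?w" for x
    using \<iota> by (simp add: koethe_space_def)
  have adj: "B x (\<pi> \<xi>) = ell2_inner (\<iota> x) \<xi>" if \<xi>: "\<xi> \<in> koethe_space ?w" for x \<xi>
  proof -
    have "(\<lambda>n. nrm x * (C0 * p k (\<pi> \<xi> - (\<Sum>i<n. sc (\<xi> i) (g i))))) \<longlonglongrightarrow> 0"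
      by (intro tendsto_mult_right_zero \<pi>[OF \<xi>])
    then have "(\<lambda>n. B x (\<Sum>i<n. sc (\<xi> i) (g i)) - B x (\<pi> \<xi>)) \<longlonglongrightarrow> 0"
    proof (rule Lim_null_comparison[rotated], intro always_eventually allI)
      fix n
      let ?y = "\<pi> \<xi> - (\<Sum>i<n. sc (\<xi> i) (g i))"
      have "cmod (B x ?y) \<le> nrm x * nrm ?y"
        by (rule Cauchy_Schwarz)
      also have "\<dots> \<le> nrm x * (C0 * p k ?y)"
        by (intro mult_left_mono C0 nrm_nonneg)
      finally show "norm (B x (\<Sum>i<n. sc (\<xi> i) (g i)) - B x (\<pi> \<xi>)) \<le> nrm x * (C0 * p k ?y)"
        by (simp add: B_diff_right norm_minus_commute)
    qed
    then have "(\<lambda>n. B x (\<Sum>i<n. sc (\<xi> i) (g i))) \<longlonglongrightarrow> B x (\<pi> \<xi>)"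
      by (simp add: LIM_zero_iff)
    moreover have "(\<lambda>n. B x (\<Sum>i<n. sc (\<xi> i) (g i))) \<longlonglongrightarrow> ell2_inner (\<iota> x) \<xi>"
      using summable_LIMSEQ[OF ell2_inner_summable[OF Lam_ell2[OF \<iota>_mem[of x]] Lam_ell2[OF \<xi>]]]
      by (simp add: ell2_inner_def \<iota>_def B_sum_right B_scale_right mult.commute)
    ultimately show ?thesis
      by (rule LIMSEQ_unique)
  qed
  show ?thesis
  proof (intro exI[of _ \<iota>] exI[of _ \<pi>] conjI allI ballI)
    show "\<exists>r. \<exists>C>0. \<forall>x. wnorm (?w q) (\<iota> x) \<le> C * p r x" for q
      using \<iota>[of _ q] C0S by blast
    show "\<exists>r. \<exists>C>0. \<forall>\<xi>\<in>koethe_space ?w. p q (\<pi> \<xi>) \<le> C * wnorm (?w r) \<xi>" for q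
      by (rule exI[of _ "d q + m"], rule exI[of _ "D q * S + 1"]) (use DS \<pi>_bound in blast)
    show "ell2_inner (\<iota> z) (\<iota> x) = B z x" for x z
      using parseval[of z x] by (simp add: ell2_inner_def \<iota>_def sums_iff)
  qed (rule \<iota>_mem adj; assumption)+
qed

end


section \<open>Representation on \<open>s\<close>\<close>

lemma wl2_reindex:
  assumes "strict_mono \<nu>" "\<And>k. k \<notin> range \<nu> \<Longrightarrow> \<eta> k = 0"
  shows "\<eta> \<in> wl2 v \<longleftrightarrow> (\<lambda>j. \<eta> (\<nu> j)) \<in> wl2 (\<lambda>j. v (\<nu> j))"
    "wnorm v \<eta> = wnorm (\<lambda>j. v (\<nu> j)) (\<lambda>j. \<eta> (\<nu> j))"
  using summable_mono_reindex[of \<nu> "\<lambda>k. (cmod (\<eta> k) * v k)\<^sup>2"]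
    suminf_mono_reindex[of \<nu> "\<lambda>k. (cmod (\<eta> k) * v k)\<^sup>2"] assms
  by (auto simp: wl2_def wnorm_def)

lemma wl2_subsequence:
  assumes "strict_mono \<nu>" "\<eta> \<in> wl2 v"
  shows "(\<lambda>j. \<eta> (\<nu> j)) \<in> wl2 (\<lambda>j. v (\<nu> j))" "wnorm (\<lambda>j. v (\<nu> j)) (\<lambda>j. \<eta> (\<nu> j)) \<le> wnorm v \<eta>"
proof -
  have "L2_set (\<lambda>j. cmod (\<eta> (\<nu> j)) * v (\<nu> j)) {..<n} \<le> wnorm v \<eta>" for n
  proof -
    have "inj_on \<nu> {..<n}"
      using strict_mono_eq[OF assms(1)] by (auto simp: inj_on_def)
    then have "L2_set (\<lambda>j. cmod (\<eta> (\<nu> j)) * v (\<nu> j)) {..<n} = L2_set (\<lambda>k. cmod (\<eta> k) * v k) (\<nu> ` {..<n})"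
      by (simp add: L2_set_def sum.reindex)
    also have "\<dots> \<le> wnorm v \<eta>"
      using assms(2) by (rule L2_set_le_wnorm) simp
    finally show ?thesis .
  qed
  then show "(\<lambda>j. \<eta> (\<nu> j)) \<in> wl2 (\<lambda>j. v (\<nu> j))" "wnorm (\<lambda>j. v (\<nu> j)) (\<lambda>j. \<eta> (\<nu> j)) \<le> wnorm v \<eta>"
    using wl2_bound[of "\<lambda>j. \<eta> (\<nu> j)" "\<lambda>j. v (\<nu> j)"] by auto
qed

context dominated_model
begin

text \<open>Nuclearity bounds \<open>j\<close> by a power of \<open>e\<^sup>\<alpha>\<^sup>j\<close>, so that \<open>j + \<lfloor>e\<^sup>\<alpha>\<^sup>j\<rfloor>\<close> is polynomially
  equivalent to \<open>e\<^sup>\<alpha>\<^sup>j\<close> while being strictly increasing. Placing the \<open>j\<close>-th coordinate there embeds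
  the power series space into \<open>s\<close>.\<close>

lemma index_sequence:
  "\<exists>(\<nu> :: nat \<Rightarrow> nat) (M :: nat) D. strict_mono \<nu> \<and> D > 0 \<and>
    (\<forall>j. exp (\<alpha> j) \<le> real (Suc (\<nu> j)) \<and> real (Suc (\<nu> j)) \<le> D * exp (real M * \<alpha> j))"
proof -
  obtain m :: nat and S where S: "\<And>n. L2_set (\<lambda>j. exp (- real m * \<alpha> j)) {..<n} \<le> S"
    using nuclearity by blast
  define \<nu> where "\<nu> = (\<lambda>j. j + nat \<lfloor>exp (\<alpha> j)\<rfloor>)"
  have real_\<nu>: "real (\<nu> j) = real j + of_int \<lfloor>exp (\<alpha> j)\<rfloor>" for j
    by (simp add: \<nu>_def)
  have "strict_mono \<nu>"
  proof (rule strict_monoI)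
    fix i j :: nat assume "i < j"
    then have "exp (\<alpha> i) \<le> exp (\<alpha> j)"
      using incseq_alpha by (simp add: incseq_def)
    then have "nat \<lfloor>exp (\<alpha> i)\<rfloor> \<le> nat \<lfloor>exp (\<alpha> j)\<rfloor>"
      by (intro nat_mono floor_mono)
    then show "\<nu> i < \<nu> j"
      using \<open>i < j\<close> by (simp add: \<nu>_def)
  qed
  moreover have "exp (\<alpha> j) \<le> real (Suc (\<nu> j))" for j
    using real_\<nu>[of j] floor_correct[of "exp (\<alpha> j)"] by linarith
  \<comment> \<open>The exponent \<open>2 * m\<close> accounts for the summand \<open>j\<close> of
    \<open>\<nu> j\<close>, and the extra \<open>1\<close> makes room for the integer part of
    \<open>exp (\<alpha> j)\<close>.\<close>
  moreover have "real (Suc (\<nu> j)) \<le> (S\<^sup>2 + 1) * exp (real (2 * m + 1) * \<alpha> j)" for j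
  proof -
    \<comment> \<open>The terms decrease, so \<open>j + 1\<close> copies of the last one are at most
      the partial sum, hence at most \<open>S\<^sup>2\<close>.\<close>
    have "real (Suc j) * (exp (- real m * \<alpha> j))\<^sup>2 = (\<Sum>i<Suc j. (exp (- real m * \<alpha> j))\<^sup>2)"
      by simp
    also have "\<dots> \<le> (\<Sum>i<Suc j. (exp (- real m * \<alpha> i))\<^sup>2)"
    proof (intro sum_mono power_mono)
      fix i assume "i \<in> {..<Suc j}"
      then have "real m * \<alpha> i \<le> real m * \<alpha> j"
        using incseq_alpha by (intro mult_left_mono) (auto simp: incseq_def)
      then show "exp (- real m * \<alpha> j) \<le> exp (- real m * \<alpha> i)"
        by simp
    qed auto
    also have "\<dots> \<le> S\<^sup>2"
      using S[of "Suc j"] unfolding L2_set_def by (rule sqrt_le_D)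
    finally have "real (Suc j) * (exp (- real m * \<alpha> j))\<^sup>2 * (exp (real m * \<alpha> j))\<^sup>2 \<le> S\<^sup>2 * (exp (real m * \<alpha> j))\<^sup>2"
      by (intro mult_right_mono) auto
    moreover have "(exp (- real m * \<alpha> j))\<^sup>2 * (exp (real m * \<alpha> j))\<^sup>2 = 1"
      unfolding power_mult_distrib[symmetric] exp_add[symmetric] by simp
    ultimately have "real (Suc j) \<le> S\<^sup>2 * (exp (real m * \<alpha> j))\<^sup>2"
      by (simp only: mult.assoc mult_1_right)
    also have "(exp (real m * \<alpha> j))\<^sup>2 = exp (real (2 * m) * \<alpha> j)"
      by (simp add: power2_eq_square exp_add[symmetric] algebra_simps)
    also have "S\<^sup>2 * exp (real (2 * m) * \<alpha> j) \<le> S\<^sup>2 * exp (real (2 * m + 1) * \<alpha> j)"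
      using alpha_nonneg[of j] by (intro mult_left_mono) (auto intro!: mult_right_mono)
    finally have "real (Suc j) \<le> S\<^sup>2 * exp (real (2 * m + 1) * \<alpha> j)" .
    moreover have "of_int \<lfloor>exp (\<alpha> j)\<rfloor> \<le> exp (real (2 * m + 1) * \<alpha> j)"
    proof -
      have "1 * \<alpha> j \<le> real (2 * m + 1) * \<alpha> j"
        using alpha_nonneg[of j] by (intro mult_right_mono) auto
      then have "exp (\<alpha> j) \<le> exp (real (2 * m + 1) * \<alpha> j)"
        by simp
      then show ?thesis
        using of_int_floor_le[of "exp (\<alpha> j)"] by linarith
    qed
    ultimately show ?thesis
      using real_\<nu>[of j] by (simp add: distrib_right)
  qed
  moreover have "S\<^sup>2 + 1 > 0"
    by (simp add: add_nonneg_pos)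
  ultimately show ?thesis
    by blast
qed

text \<open>The coordinate isometry is followed by extension by zero along \<open>\<nu>\<close>.
  Extension \<open>\<kappa>\<close> and restriction \<open>\<rho>\<close> are adjoint to each other;
  the upper estimate for \<open>\<nu>\<close> makes \<open>\<kappa>\<close> continuous, the lower
  one \<open>\<rho>\<close>.\<close>

lemma isometric_embedding_into_s:
  "\<exists>\<iota> \<pi>. (\<forall>x. \<iota> x \<in> s_space) \<and>
    (\<forall>N. \<exists>r. \<exists>C>0. \<forall>x. s_norm N (\<iota> x) \<le> C * p r x) \<and>
    (\<forall>q. \<exists>N. \<exists>C>0. \<forall>\<xi>\<in>s_space. p q (\<pi> \<xi>) \<le> C * s_norm N \<xi>) \<and>
    (\<forall>x. \<forall>\<xi>\<in>s_space. B x (\<pi> \<xi>) = ell2_inner (\<iota> x) \<xi>) \<and>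
    (\<forall>x. \<pi> (\<iota> x) = x)"
proof -
  let ?w = "\<lambda>q j. exp (real q * \<alpha> j)"
  obtain \<iota>0 \<pi>0 where *: "\<forall>x. \<iota>0 x \<in> koethe_space ?w"
    "\<forall>q. \<exists>r. \<exists>C>0. \<forall>x. wnorm (?w q) (\<iota>0 x) \<le> C * p r x"
    "\<forall>q. \<exists>r. \<exists>C>0. \<forall>\<xi>\<in>koethe_space ?w. p q (\<pi>0 \<xi>) \<le> C * wnorm (?w r) \<xi>"
    "\<forall>x. \<forall>\<xi>\<in>koethe_space ?w. B x (\<pi>0 \<xi>) = ell2_inner (\<iota>0 x) \<xi>"
    "\<forall>x z. ell2_inner (\<iota>0 z) (\<iota>0 x) = B z x"
    using coordinate_isometry by (elim exE conjE) (rule that)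
  note mem0 = spec[OF *(1)] and \<iota>0 = spec[OF *(2)] and \<pi>0 = spec[OF *(3)]
    and adj0 = bspec[OF spec[OF *(4)]] and iso0 = spec[OF spec[OF *(5)]]
  obtain \<nu> :: "nat \<Rightarrow> nat" and M :: nat and D where \<nu>: "strict_mono \<nu>" and D: "D > 0"
    and lo: "\<And>j. exp (\<alpha> j) \<le> real (Suc (\<nu> j))" and hi: "\<And>j. real (Suc (\<nu> j)) \<le> D * exp (real M * \<alpha> j)"
    using index_sequence by blast
  have inj: "inj \<nu>"
    using strict_mono_eq[OF \<nu>] by (auto simp: inj_on_def)
  define \<kappa> where "\<kappa> = (\<lambda>\<xi> k. if k \<in> range \<nu> then \<xi> (inv \<nu> k) else (0::complex))"
  define \<rho> where "\<rho> = (\<lambda>(\<eta> :: nat \<Rightarrow> complex) j. \<eta> (\<nu> j))"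
  have \<kappa>_\<nu>: "\<kappa> \<xi> (\<nu> j) = \<xi> j" for \<xi> j
    by (simp add: \<kappa>_def inv_f_f[OF inj])
  have \<kappa>_0: "\<kappa> \<xi> k = 0" if "k \<notin> range \<nu>" for \<xi> k
    using that by (simp add: \<kappa>_def)
  have hi_pow: "s_weight N (\<nu> j) \<le> D ^ N * ?w (M * N) j" for N j
  proof -
    have "s_weight N (\<nu> j) \<le> (D * exp (real M * \<alpha> j)) ^ N"
      using hi[of j] by (intro power_mono) auto
    also have "\<dots> = D ^ N * ?w (M * N) j"
      by (simp add: power_mult_distrib exp_of_nat_mult[symmetric] mult_ac)
    finally show ?thesis .
  qed
  have lo_pow: "?w q j \<le> 1 * s_weight q (\<nu> j)" for q j
  proof -
    have "?w q j = exp (\<alpha> j) ^ q"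
      by (simp add: exp_of_nat_mult)
    also have "\<dots> \<le> s_weight q (\<nu> j)"
      using lo[of j] by (intro power_mono) auto
    finally show ?thesis
      by simp
  qed
  have \<kappa>: "\<kappa> \<xi> \<in> wl2 (s_weight N) \<and> wnorm (s_weight N) (\<kappa> \<xi>) \<le> D ^ N * wnorm (?w (M * N)) \<xi>"
    if "\<xi> \<in> koethe_space ?w" for \<xi> N
  proof -
    have "\<xi> \<in> wl2 (?w (M * N))"
      using that unfolding koethe_space_def by blast
    then show ?thesis
      using wl2_reindex[OF \<nu>, of "\<kappa> \<xi>" "s_weight N"] \<kappa>_0 D
        wl2_mono[of "\<lambda>j. s_weight N (\<nu> j)" "D ^ N" "?w (M * N)" \<xi>, OF _ hi_pow]
      by (simp add: \<kappa>_\<nu>)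
  qed
  have \<rho>: "\<rho> \<eta> \<in> wl2 (?w q) \<and> wnorm (?w q) (\<rho> \<eta>) \<le> s_norm q \<eta>" if "\<eta> \<in> s_space" for \<eta> q
  proof -
    have *: "(\<lambda>j. \<eta> (\<nu> j)) \<in> wl2 (\<lambda>j. s_weight q (\<nu> j))"
      "wnorm (\<lambda>j. s_weight q (\<nu> j)) (\<lambda>j. \<eta> (\<nu> j)) \<le> s_norm q \<eta>"
      using wl2_subsequence[OF \<nu> s_space_wl2[OF that, of q]] by (auto simp: s_norm_eq)
    show ?thesis
      using wl2_mono[of "?w q" 1 "\<lambda>j. s_weight q (\<nu> j)", OF _ lo_pow *(1)] *(2)
      by (simp add: \<rho>_def)
  qed
  have \<rho>_mem: "\<rho> \<eta> \<in> koethe_space ?w" if "\<eta> \<in> s_space" for \<eta>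
    using \<rho>[OF that] by (simp add: koethe_space_def)
  have \<kappa>_mem: "\<kappa> \<xi> \<in> s_space" if "\<xi> \<in> koethe_space ?w" for \<xi>
    using \<kappa>[OF that] by (simp add: s_space_eq koethe_space_def)
  have inner: "ell2_inner (\<kappa> \<xi>) \<eta> = ell2_inner \<xi> (\<rho> \<eta>)" for \<xi> \<eta>
    using suminf_mono_reindex[OF \<nu>, of "\<lambda>k. \<kappa> \<xi> k * cnj (\<eta> k)"] \<kappa>_0
    by (simp add: ell2_inner_def \<kappa>_\<nu> \<rho>_def)
  have \<rho>_\<kappa>: "\<rho> (\<kappa> \<xi>) = \<xi>" for \<xi>
    by (simp add: \<rho>_def \<kappa>_\<nu>)
  show ?thesis
  proof (intro exI[of _ "\<lambda>x. \<kappa> (\<iota>0 x)"] exI[of _ "\<lambda>\<xi>. \<pi>0 (\<rho> \<xi>)"] conjI allI ballI)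
    show "\<kappa> (\<iota>0 x) \<in> s_space" for x
      by (rule \<kappa>_mem[OF mem0])
  next
    fix N
    obtain r C where C: "C > 0" "\<And>x. wnorm (?w (M * N)) (\<iota>0 x) \<le> C * p r x"
      using \<iota>0 by blast
    have "s_norm N (\<kappa> (\<iota>0 x)) \<le> (D ^ N * C) * p r x" for x
      unfolding s_norm_eq mult.assoc using D
      by (intro order_trans[OF conjunct2[OF \<kappa>[OF mem0]] mult_left_mono[OF C(2)]]) simp
    then show "\<exists>r. \<exists>C>0. \<forall>x. s_norm N (\<kappa> (\<iota>0 x)) \<le> C * p r x"
      using C(1) D by (intro exI[of _ r] exI[of _ "D ^ N * C"]) auto
  next
    fix q
    obtain r C where C: "C > 0" "\<And>\<xi>. \<xi> \<in> koethe_space ?w \<Longrightarrow> p q (\<pi>0 \<xi>) \<le> C * wnorm (?w r) \<xi>"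
      using \<pi>0 by blast
    have "p q (\<pi>0 (\<rho> \<eta>)) \<le> C * s_norm r \<eta>" if "\<eta> \<in> s_space" for \<eta>
      using C(1) by (intro order_trans[OF C(2)[OF \<rho>_mem[OF that]] mult_left_mono[OF conjunct2[OF \<rho>[OF that]]]]) simp
    then show "\<exists>N. \<exists>C>0. \<forall>\<xi>\<in>s_space. p q (\<pi>0 (\<rho> \<xi>)) \<le> C * s_norm N \<xi>"
      using C(1) by blast
  next
    fix x \<xi> assume "\<xi> \<in> s_space"
    then show "B x (\<pi>0 (\<rho> \<xi>)) = ell2_inner (\<kappa> (\<iota>0 x)) \<xi>"
      by (simp add: inner adj0[OF \<rho>_mem])
  next
    fix x
    \<comment> \<open>Adjointness followed by isometry; nondegeneracy of \<open>B\<close> then gives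
      the left inverse.\<close>
    have "B z (\<pi>0 (\<iota>0 x)) = B z x" for z
      by (simp add: adj0[OF mem0] iso0)
    then show "\<pi>0 (\<rho> (\<kappa> (\<iota>0 x))) = x"
      unfolding \<rho>_\<kappa> by (rule B_nondegenerate)
  qed
qed

end

text \<open>With \<open>\<iota>\<close> and \<open>\<pi> = \<iota>\<^sup>*\<close> from the previous lemma, \<open>x\<close> is represented by \<open>\<iota> \<circ> (x * _) \<circ> \<pi>\<close>. An
  element is recovered from its operator \<open>y\<close> as \<open>\<pi> (y (\<iota> 1))\<close>, which makes sense on all of \<open>L\<^sup>*(s)\<close>
  and hence yields the projection.\<close>

lemma betaDN_imp_complemented_subalgebra:
  fixes sc :: "complex \<Rightarrow> 'e::comm_ring_1 \<Rightarrow> 'e"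
  assumes "frechet_star_algebra sc star T" and "dominated_model sc T \<alpha> \<Psi> B"
    and B_mult: "\<And>x y z. B (x * y) z = B y (star x * z)"
    and bounded: "\<And>x. \<exists>C>0. \<forall>y. hilbert_norm B (x * y) \<le> C * hilbert_norm B y"
  shows "\<exists>F. star_subalgebra F \<and> complemented F \<and> (\<forall>x\<in>F. extends_to_bounded x) \<and>
    star_algebra_isomorphic sc star T F"
proof -
  interpret frechet_star_algebra sc star T by fact
  interpret dominated_model sc T \<alpha> \<Psi> B by fact
  obtain \<iota> \<pi> where *: "\<forall>x. \<iota> x \<in> s_space"
    "\<forall>N. \<exists>r. \<exists>C>0. \<forall>x. s_norm N (\<iota> x) \<le> C * p r x"
    "\<forall>q. \<exists>N. \<exists>C>0. \<forall>\<xi>\<in>s_space. p q (\<pi> \<xi>) \<le> C * s_norm N \<xi>"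
    "\<forall>x. \<forall>\<xi>\<in>s_space. B x (\<pi> \<xi>) = ell2_inner (\<iota> x) \<xi>"
    "\<forall>x. \<pi> (\<iota> x) = x"
    using isometric_embedding_into_s by (elim exE conjE) (rule that)
  note \<iota>_mem = spec[OF *(1)] and \<iota>_bound = spec[OF *(2)] and \<pi>_bound = spec[OF *(3)]
    and adj = bspec[OF spec[OF *(4)]] and \<pi>_\<iota> = spec[OF *(5)]
  note \<iota>_ell2 = s_subset_ell2[OF \<iota>_mem]
  \<comment> \<open>Linearity of both maps is recovered from adjointness: coordinates of
    \<open>\<iota> x\<close> are scalar products with fixed vectors, and \<open>\<pi>\<close> is
    determined by its scalar products.\<close>
  have \<iota>_nth: "\<iota> x k = B x (\<pi> (unit_seq k))" for x k
    by (simp add: adj[OF s.unit_seq_mem] ell2_inner_unit_seq)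
  have \<iota>_add: "\<iota> (x + y) = \<iota> x + \<iota> y" and \<iota>_scale: "\<iota> (sc c x) = seq_scale c (\<iota> x)" for x y c
    by (auto simp: fun_eq_iff \<iota>_nth B_add_left B_scale_left seq_scale_def)
  have \<pi>_add: "\<pi> (\<xi> + \<eta>) = \<pi> \<xi> + \<pi> \<eta>" if "\<xi> \<in> s_space" "\<eta> \<in> s_space" for \<xi> \<eta>
    using that
    by (intro B_nondegenerate)
      (simp add: B_add_right adj s.add_mem ell2_inner_add_right \<iota>_ell2 s_subset_ell2)
  have \<pi>_scale: "\<pi> (seq_scale c \<xi>) = sc c (\<pi> \<xi>)" if "\<xi> \<in> s_space" for c \<xi>
    using that
    by (intro B_nondegenerate)
      (simp add: B_scale_right adj s.scale_mem ell2_inner_scale_right \<iota>_ell2 s_subset_ell2)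
  have isometry: "ell2_norm (\<iota> x) = nrm x" for x
  proof -
    have "complex_of_real ((ell2_norm (\<iota> x))\<^sup>2) = complex_of_real ((nrm x)\<^sup>2)"
      using adj[OF \<iota>_mem, of x x] by (simp add: \<pi>_\<iota> B_self[of x] ell2_inner_self[OF \<iota>_ell2])
    then have "(ell2_norm (\<iota> x))\<^sup>2 = (nrm x)\<^sup>2"
      by (simp only: of_real_eq_iff)
    then show ?thesis
      by (simp add: power2_eq_iff_nonneg ell2_norm_nonneg[OF \<iota>_ell2] nrm_nonneg)
  qed
  \<comment> \<open>The adjoint of an isometry is a contraction: the squared norm of
    \<open>\<pi> \<xi>\<close> is the product of \<open>\<iota> (\<pi> \<xi>)\<close> with
    \<open>\<xi>\<close>.\<close>
  have contraction: "nrm (\<pi> \<xi>) \<le> ell2_norm \<xi>" if \<xi>: "\<xi> \<in> s_space" for \<xi>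
  proof (cases "nrm (\<pi> \<xi>) = 0")
    case False
    have "complex_of_real ((nrm (\<pi> \<xi>))\<^sup>2) = ell2_inner (\<iota> (\<pi> \<xi>)) \<xi>"
      using adj[OF \<xi>, of "\<pi> \<xi>"] by (simp only: B_self)
    then have "(nrm (\<pi> \<xi>))\<^sup>2 = cmod (ell2_inner (\<iota> (\<pi> \<xi>)) \<xi>)"
      by (metis abs_power2 norm_of_real)
    also have "\<dots> \<le> nrm (\<pi> \<xi>) * ell2_norm \<xi>"
      using Cauchy_Schwarz_ell2[OF \<iota>_ell2 s_subset_ell2[OF \<xi>]] by (simp add: isometry)
    finally show ?thesis
      using False nrm_nonneg[of "\<pi> \<xi>"] by (simp add: power2_eq_square)
  qed (simp add: ell2_norm_nonneg[OF s_subset_ell2[OF \<xi>]])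
  define \<Phi> where "\<Phi> = (\<lambda>x \<xi>. if \<xi> \<in> s_space then \<iota> (x * \<pi> \<xi>) else 0)"
  have \<Phi>_s: "\<Phi> x \<xi> = \<iota> (x * \<pi> \<xi>)" if "\<xi> \<in> s_space" for x \<xi>
    using that by (simp add: \<Phi>_def)
  have lin: "linear_map_on seq_scale seq_scale s_space (\<Phi> x)" for x
    unfolding linear_map_on_def
    using s.add_mem s.scale_mem
    by (auto simp: \<Phi>_s \<pi>_add \<pi>_scale distrib_left \<iota>_add \<iota>_scale scale_mult_right)
  have adjoint: "ell2_inner (\<Phi> x \<xi>) \<eta> = ell2_inner \<xi> (\<Phi> (star x) \<eta>)" if "\<xi> \<in> s_space" "\<eta> \<in> s_space" for x \<xi> \<eta>
  proof -
    have "ell2_inner (\<Phi> x \<xi>) \<eta> = B (x * \<pi> \<xi>) (\<pi> \<eta>)"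
      by (simp add: \<Phi>_s that adj)
    also have "\<dots> = cnj (B (star x * \<pi> \<eta>) (\<pi> \<xi>))"
      unfolding B_mult[of x] by (rule B_commute)
    also have "\<dots> = cnj (ell2_inner (\<Phi> (star x) \<eta>) \<xi>)"
      by (simp add: \<Phi>_s that adj)
    also have "\<dots> = ell2_inner \<xi> (\<Phi> (star x) \<eta>)"
      using ell2_inner_commute[OF \<iota>_ell2 s_subset_ell2[OF that(1)]] by (simp add: \<Phi>_s that)
    finally show ?thesis .
  qed
  have zero: "\<Phi> x \<xi> = 0" if "\<xi> \<notin> s_space" for x \<xi>
    using that by (simp add: \<Phi>_def)
  have mem: "\<Phi> x \<xi> \<in> s_space" if "\<xi> \<in> s_space" for x \<xi>
    using that \<iota>_mem by (simp add: \<Phi>_s)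
  have L: "\<Phi> x \<in> Lstar" for x
    by (rule LstarI(1)[of _ "\<Phi> (star x)"]) (use lin mem zero adjoint in auto)
  have star_\<Phi>: "Lstar_star (\<Phi> x) = \<Phi> (star x)" for x
  proof
    fix \<eta>
    show "Lstar_star (\<Phi> x) \<eta> = \<Phi> (star x) \<eta>"
    proof (cases "\<eta> \<in> s_space")
      case True
      show ?thesis
        by (rule LstarI(2)[of _ "\<Phi> (star x)"]) (use lin mem zero adjoint True in auto)
    qed (simp add: Lstar_star_def zero)
  qed
  have mult_\<Phi>: "\<Phi> (x * y) = \<Phi> x \<circ> \<Phi> y" for x y
  proof
    \<comment> \<open>Outside \<open>s_space\<close> the inner operator returns the default
      \<open>0\<close>, which lies in \<open>s_space\<close>, so the outer one has to be evaluated
      there by linearity.\<close>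
    have "0 \<in> s_space"
      by (rule s.zero_mem)
    moreover from this have "\<Phi> x 0 = 0"
      using s.linear_zero[OF lin vector_space_seq_scale] by blast
    ultimately show "\<Phi> (x * y) \<xi> = (\<Phi> x \<circ> \<Phi> y) \<xi>" for \<xi>
      by (cases "\<xi> \<in> s_space") (simp_all add: \<Phi>_s \<iota>_mem \<pi>_\<iota> mult.assoc zero)
  qed
  have lin_\<Phi>: "linear_map_on sc op_scale UNIV \<Phi>"
    unfolding linear_map_on_def
    by (auto simp: fun_eq_iff \<Phi>_def distrib_right \<iota>_add \<iota>_scale scale_mult_left op_scale_def seq_scale_def)
  have comp_bound: "\<exists>r. \<exists>C>0. \<forall>x. p q (f x) \<le> C * p r x"
    if "continuous_map T T f" "seminorm_on sc UNIV (\<lambda>x. p q (f x))" for f q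
  proof -
    have "continuous_map T euclideanreal (p q)"
      unfolding T_eq E.continuous_seminorm_iff[OF E.seminorm_p]
      by (intro bexI[of _ "p q"] exI[of _ 1]) auto
    then have "continuous_map T euclideanreal (p q \<circ> f)"
      using continuous_map_compose[OF that(1)] by blast
    then show ?thesis
      using that(2) E.continuous_seminorm_iff unfolding T_eq comp_def by blast
  qed
  have semi_mult: "seminorm_on sc UNIV (\<lambda>x. p q (x * a))" for q a
    using seminorm_onD[OF E.seminorm_p[of q]] by (auto simp: seminorm_on_def distrib_right scale_mult_left)
  have mult_bound: "\<exists>r. \<exists>C>0. \<forall>x. p q (x * a) \<le> C * p r x" for q a
    by (rule comp_bound[OF continuous_mult_right semi_mult])
  have star_bound: "\<exists>r. \<exists>C>0. \<forall>x. p q (star x) \<le> C * p r x" for q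
    by (rule comp_bound[OF continuous_star])
      (use seminorm_onD[OF E.seminorm_p[of q]] in \<open>auto simp: seminorm_on_def star_add star_scale\<close>)
  \<comment> \<open>Separate continuity gives every \<open>\<xi>\<close> its own level and constant;
    uniform boundedness makes them common to all of \<open>A\<close>. For fixed \<open>x\<close>
    boundedness over \<open>A\<close> follows from the continuity of \<open>\<pi>\<close>, after
    commutativity has moved \<open>x\<close> to the right.\<close>
  have hypo: "\<exists>r. \<exists>C>0. \<forall>\<xi>\<in>A. \<forall>x\<in>UNIV. p q (x * \<pi> \<xi>) \<le> C * p r x" if A: "s_bounded A" for q A
  proof (rule E.uniform_boundedness)
    show "seminorm_on sc UNIV (\<lambda>x. p q (x * \<pi> \<xi>))" for \<xi>
      by (rule semi_mult)
    show "\<exists>r C. \<forall>x\<in>UNIV. p q (x * \<pi> \<xi>) \<le> C * p r x" for \<xi>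
      using mult_bound[of q "\<pi> \<xi>"] by blast
    fix x
    obtain r C where C: "C > 0" "\<And>y. p q (y * x) \<le> C * p r y"
      using mult_bound by blast
    obtain N D where D: "D > 0" "\<And>\<xi>. \<xi> \<in> s_space \<Longrightarrow> p r (\<pi> \<xi>) \<le> D * s_norm N \<xi>"
      using \<pi>_bound by blast
    obtain M where M: "\<And>\<xi>. \<xi> \<in> A \<Longrightarrow> s_norm N \<xi> \<le> M"
      using A unfolding s_bounded_def by blast
    have "p q (x * \<pi> \<xi>) \<le> C * (D * M)" if "\<xi> \<in> A" for \<xi>
    proof -
      have "\<xi> \<in> s_space"
        using that A by (auto simp: s_bounded_def)
      have "p q (x * \<pi> \<xi>) \<le> C * p r (\<pi> \<xi>)"
        using C(2)[of "\<pi> \<xi>"] by (simp add: mult.commute)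
      also have "\<dots> \<le> C * (D * s_norm N \<xi>)"
        using C(1) D(2)[OF \<open>\<xi> \<in> s_space\<close>] by (intro mult_left_mono) auto
      also have "\<dots> \<le> C * (D * M)"
        using C(1) D(1) M[OF that] by (intro mult_left_mono) auto
      finally show ?thesis .
    qed
    then show "\<exists>M. \<forall>\<xi>\<in>A. p q (x * \<pi> \<xi>) \<le> M"
      by blast
  qed
  have \<Phi>_bound: "\<exists>r. \<exists>C>0. \<forall>x. Lstar_seminorm N A (\<Phi> x) \<le> C * p r x" if A: "s_bounded A" "A \<noteq> {}" for N A
  proof -
    have As: "\<xi> \<in> s_space" if "\<xi> \<in> A" for \<xi>
      using that A by (auto simp: s_bounded_def)
    obtain q C where C: "C > 0" "\<And>x. s_norm N (\<iota> x) \<le> C * p q x"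
      using \<iota>_bound by blast
    obtain r D where D: "D > 0" "\<And>\<xi> x. \<xi> \<in> A \<Longrightarrow> p q (x * \<pi> \<xi>) \<le> D * p r x"
      using hypo[OF A(1), of q] by blast
    obtain t K where K: "K > 0" "\<And>x. p r (star x) \<le> K * p t x"
      using star_bound by blast
    have op: "s_norm N (\<Phi> x \<xi>) \<le> C * D * p r x" if "\<xi> \<in> A" for x \<xi>
      using order_trans[OF C(2) mult_left_mono[OF D(2)[OF that, of x]]] C(1)
      by (simp add: \<Phi>_s[OF As[OF that]] mult.assoc)
    \<comment> \<open>The operator needs level \<open>r\<close> and constant \<open>1\<close>, its
      adjoint level \<open>t\<close> and constant \<open>K\<close>; \<open>r + t\<close> and
      \<open>K + 1\<close> serve both.\<close>
    have "Lstar_seminorm N A (\<Phi> x) \<le> (C * D * (K + 1)) * p (r + t) x" for x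
    proof (rule Lstar_seminorm_least[OF A(2)])
      have CD: "C * D \<ge> 0"
        using C(1) D(1) by simp
      have r: "p r x \<le> (K + 1) * p (r + t) x"
        using E.p_mono[of x r "r + t"] K(1) p_nonneg[of "r + t" x] by (simp add: distrib_right add_increasing)
      have t: "p r (star x) \<le> (K + 1) * p (r + t) x"
        using order_trans[OF K(2) mult_left_mono[OF E.p_mono[of x t "r + t"], of K]] K(1) p_nonneg[of "r + t" x]
        by (simp add: distrib_right add_increasing2)
      fix \<xi> assume \<xi>: "\<xi> \<in> A"
      show "s_norm N (\<Phi> x \<xi>) \<le> (C * D * (K + 1)) * p (r + t) x"
        using order_trans[OF op[OF \<xi>, of x] mult_left_mono[OF r CD]] by (simp add: mult.assoc)
      show "s_norm N (Lstar_star (\<Phi> x) \<xi>) \<le> (C * D * (K + 1)) * p (r + t) x"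
        using order_trans[OF op[OF \<xi>, of "star x"] mult_left_mono[OF t CD]] by (simp add: star_\<Phi> mult.assoc)
    qed
    moreover have "C * D * (K + 1) > 0"
      using C(1) D(1) K(1) by simp
    ultimately show ?thesis
      by blast
  qed
  have cont_\<Phi>: "continuous_map T tau_star \<Phi>"
    unfolding T_eq tau_star_eq
    by (subst continuous_linear_iff[OF E.directed_seminorms_axioms Lstar.directed_seminorms_axioms lin_\<Phi>])
      (use L \<Phi>_bound in \<open>auto simp: Lstar_seminorms_def\<close>)
  define g where "g = (\<lambda>y. \<pi> (y (\<iota> 1)))"
  have g_\<Phi>: "g (\<Phi> x) = x" for x
    by (simp add: g_def \<Phi>_s[OF \<iota>_mem] \<pi>_\<iota>)
  have lin_g: "linear_map_on op_scale sc Lstar g"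
    unfolding linear_map_on_def g_def using LstarD(2)[OF _ \<iota>_mem]
    by (auto simp: \<pi>_add op_scale_def \<pi>_scale)
  have cont_g: "continuous_map tau_star T g"
    unfolding T_eq tau_star_eq
  proof (subst continuous_linear_iff[OF Lstar.directed_seminorms_axioms E.directed_seminorms_axioms lin_g], simp, intro ballI)
    fix f assume "f \<in> range p"
    then obtain q where f: "f = p q"
      by blast
    obtain N C where C: "C > 0" "\<And>\<xi>. \<xi> \<in> s_space \<Longrightarrow> p q (\<pi> \<xi>) \<le> C * s_norm N \<xi>"
      using \<pi>_bound by blast
    have bd: "s_bounded {\<iota> 1}"
      by (rule s_bounded_singleton[OF \<iota>_mem])
    have "f (g y) \<le> C * Lstar_seminorm N {\<iota> 1} y" if "y \<in> Lstar" for y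
      unfolding f g_def
      using order_trans[OF C(2)[OF LstarD(2)[OF that \<iota>_mem]]
          mult_left_mono[OF Lstar_seminorm_le(1)[OF that bd, of "\<iota> 1" N]]] C(1) by simp
    then show "\<exists>s\<in>Lstar_seminorms. \<exists>C>0. \<forall>y\<in>Lstar. f (g y) \<le> C * s y"
      using C(1) bd by (intro bexI[of _ "Lstar_seminorm N {\<iota> 1}"] exI[of _ C]) (auto simp: Lstar_seminorms_def)
  qed
  define F where "F = range \<Phi>"
  have FL: "F \<subseteq> Lstar"
    using L by (auto simp: F_def)
  \<comment> \<open>The inverse of \<open>\<Phi>\<close> is the restriction of \<open>g\<close> to
    \<open>F\<close>, whose continuity is known on all of \<open>Lstar\<close>.\<close>
  have "homeomorphic_maps T (subtopology tau_star F) \<Phi> g"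
    unfolding homeomorphic_maps_def
    using cont_\<Phi> continuous_map_from_subtopology[OF cont_g] g_\<Phi>
    by (auto simp: continuous_map_in_subtopology F_def)
  then have "star_algebra_isomorphic sc star T F"
    unfolding star_algebra_isomorphic_def homeomorphic_map_maps
    using lin_\<Phi> mult_\<Phi> star_\<Phi> by metis
  moreover have "star_subalgebra F"
  proof -
    have "module.subspace op_scale F"
      unfolding Lstar.subspace_def F_def
    proof (intro conjI ballI allI)
      show "0 \<in> range \<Phi>"
        using E.linear_zero[OF lin_\<Phi> vector_space_op_scale] by (metis rangeI)
    qed (use linear_map_onD[OF lin_\<Phi>] in \<open>auto intro: rangeI simp flip: linear_map_onD[OF lin_\<Phi>]\<close>)
    then show ?thesis
      unfolding star_subalgebra_def using FL
      by (auto simp: F_def star_\<Phi> simp flip: mult_\<Phi>)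
  qed
  moreover have "complemented F"
    unfolding complemented_def
  proof (intro exI[of _ "\<Phi> \<circ> g"] conjI ballI)
    show "linear_map_on op_scale op_scale Lstar (\<Phi> \<circ> g)"
      using lin_g lin_\<Phi> by (auto simp: linear_map_on_def)
    show "continuous_map tau_star tau_star (\<Phi> \<circ> g)"
      using cont_g cont_\<Phi> by (rule continuous_map_compose)
    show "(\<Phi> \<circ> g) ((\<Phi> \<circ> g) x) = (\<Phi> \<circ> g) x" for x
      by (simp add: g_\<Phi>)
    show "(\<Phi> \<circ> g) ` Lstar = F"
    proof
      show "F \<subseteq> (\<Phi> \<circ> g) ` Lstar"
      proof
        fix y assume "y \<in> F"
        then obtain x where "y = (\<Phi> \<circ> g) (\<Phi> x)"
          by (auto simp: F_def g_\<Phi>)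
        then show "y \<in> (\<Phi> \<circ> g) ` Lstar"
          using L by blast
      qed
    qed (auto simp: F_def)
  qed
  moreover have "extends_to_bounded y" if y: "y \<in> F" for y
  proof -
    obtain x where x: "y = \<Phi> x"
      using y by (auto simp: F_def)
    obtain C where C: "C > 0" "\<And>z. nrm (x * z) \<le> C * nrm z"
      using bounded by blast
    show ?thesis
      unfolding x
    proof (rule extends_to_boundedI[OF L])
      fix \<xi> assume \<xi>: "\<xi> \<in> s_space"
      show "ell2_norm (\<Phi> x \<xi>) \<le> C * ell2_norm \<xi>"
        using order_trans[OF C(2) mult_left_mono[OF contraction[OF \<xi>]]] C(1) by (simp add: \<Phi>_s[OF \<xi>] isometry)
    qed (use C(1) in simp)
  qed
  ultimately show ?thesis
    by blast
qed

text \<open>\<open>dominating_norm\<close> provides the inequality for some fundamental system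
  \<open>p'\<close>. Since \<open>p\<close> and \<open>p'\<close> generate the same topology, each
  is bounded by the other and the inequality carries over to \<open>p\<close>.\<close>

lemma dominated_modelI:
  assumes "power_series_model sc T \<alpha> \<Psi>" and sp: "scalar_product sc B"
    and dom: "dominating_norm sc T (hilbert_norm B)" and "incseq \<alpha>"
    and nuc: "nuclear_space seq_scale (power_series_space \<alpha>) (power_series_topology \<alpha>)"
  shows "dominated_model sc T \<alpha> \<Psi> B"
proof -
  interpret power_series_model sc T \<alpha> \<Psi> by fact
  interpret scalar_product_space sc B
    by unfold_locales (rule sp)
  obtain p' where cont: "continuous_map T euclideanreal nrm" and p': "fundamental_system sc T p'"
    and dom': "\<And>q. \<exists>r. \<exists>C>0. \<forall>x. (p' q x)\<^sup>2 \<le> C * nrm x * p' r x"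
    using dom unfolding dominating_norm_def by blast
  have semi': "seminorm_on sc UNIV (p' q)" and T': "T = seminorm_topology UNIV (range p')" for q
    using p' by (auto simp: fundamental_system_def)
  have mono': "q \<le> r \<Longrightarrow> p' q x \<le> p' r x" for q r x
    using p' lift_Suc_mono_le[of "\<lambda>q. p' q x"] by (auto simp: fundamental_system_def)
  interpret E': directed_seminorms sc UNIV "range p'"
  proof
    fix f g assume "f \<in> range p'" "g \<in> range p'"
    then obtain m n where "f = p' m" "g = p' n"
      by blast
    then show "\<exists>r\<in>range p'. \<forall>x\<in>UNIV. f x \<le> r x \<and> g x \<le> r x"
      using mono' by (intro bexI[of _ "p' (max m n)"]) auto
  qed (use semi' in auto)
  have top: "seminorm_topology UNIV (range p) = seminorm_topology UNIV (range p')"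
    using T_eq T' by simp
  have p_le: "\<exists>r. \<exists>C>0. \<forall>x. p q x \<le> C * p' r x" for q
    using seminorm_topology_eq_bound[OF E'.directed_seminorms_axioms E.directed_seminorms_axioms
        top[symmetric] rangeI[of p q]] by auto
  have p'_le: "\<exists>r. \<exists>C>0. \<forall>x. p' q x \<le> C * p r x" for q
    using seminorm_topology_eq_bound[OF E.directed_seminorms_axioms E'.directed_seminorms_axioms
        top rangeI[of p' q]] by auto
  have "\<exists>r. \<exists>C>0. \<forall>x. (p q x)\<^sup>2 \<le> C * nrm x * p r x" for q
  proof -
    obtain q' C where C: "C > 0" "\<And>x. p q x \<le> C * p' q' x"
      using p_le by blast
    obtain r' D where D: "D > 0" "\<And>x. (p' q' x)\<^sup>2 \<le> D * nrm x * p' r' x"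
      using dom' by blast
    obtain r K where K: "K > 0" "\<And>x. p' r' x \<le> K * p r x"
      using p'_le by blast
    have "(p q x)\<^sup>2 \<le> (C\<^sup>2 * D * K) * nrm x * p r x" for x
    proof -
      have "(p q x)\<^sup>2 \<le> (C * p' q' x)\<^sup>2"
        using C(2)[of x] p_nonneg by (intro power_mono) auto
      also have "\<dots> = C\<^sup>2 * (p' q' x)\<^sup>2"
        by (simp add: power_mult_distrib)
      also have "\<dots> \<le> C\<^sup>2 * (D * nrm x * p' r' x)"
        using D(2) by (intro mult_left_mono) auto
      also have "\<dots> \<le> C\<^sup>2 * (D * nrm x * (K * p r x))"
        using K(2) D(1) nrm_nonneg by (intro mult_left_mono) auto
      finally show ?thesis
        by (simp add: mult_ac)
    qed
    then show ?thesis
      using C(1) D(1) K(1) by (intro exI[of _ r] exI[of _ "C\<^sup>2 * D * K"]) auto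
  qed
  moreover have "\<exists>k. \<exists>C>0. \<forall>x. nrm x \<le> C * p k x"
    using cont unfolding T_eq E.continuous_seminorm_iff[OF seminorm_nrm] by blast
  ultimately show ?thesis
    using nuclear_imp_square_summable[OF alpha_nonneg nuc] \<open>incseq \<alpha>\<close> by unfold_locales
qed

theorem theorem3p6:
  fixes sc :: "complex \<Rightarrow> 'e::comm_ring_1 \<Rightarrow> 'e"
    and star :: "'e \<Rightarrow> 'e"
    and T :: "'e topology"
    and \<alpha> :: "nat \<Rightarrow> real"
  assumes "frechet_star_algebra sc star T"
    and "exponent_sequence \<alpha>"
    and "nuclear_space seq_scale (power_series_space \<alpha>) (power_series_topology \<alpha>)"
    and "frechet_isomorphic_power_series sc T \<alpha>"
  shows "((\<exists>F. star_subalgebra F \<and> complemented F \<and> (\<forall>x\<in>F. extends_to_bounded x) \<and>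
              star_algebra_isomorphic sc star T F)
          \<longleftrightarrow> (\<exists>F. star_subalgebra F \<and> closedin tau_star F \<and> (\<forall>x\<in>F. extends_to_bounded x) \<and>
              star_algebra_isomorphic sc star T F)) \<and>
         ((\<exists>F. star_subalgebra F \<and> closedin tau_star F \<and> (\<forall>x\<in>F. extends_to_bounded x) \<and>
              star_algebra_isomorphic sc star T F)
          \<longleftrightarrow> betaDN_algebra sc star T)"
proof -
  interpret frechet_star_algebra sc star T by fact
  have lcs: "locally_convex_space sc UNIV T"
    using frechet by (simp add: frechet_space_def)
  then have vs: "vector_space sc" and "topspace T = UNIV"
    by (auto simp: locally_convex_space_def)
  obtain \<Psi> where \<Psi>: "linear_map_on sc seq_scale UNIV \<Psi>" "homeomorphic_map T (power_series_topology \<alpha>) \<Psi>"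
    using assms(4) unfolding frechet_isomorphic_power_series_def by blast
  have \<alpha>: "0 \<le> \<alpha> j" "incseq \<alpha>" for j
    using assms(2) by (auto simp: exponent_sequence_def less_imp_le)
  have model: "power_series_model sc T \<alpha> \<Psi>"
    using vs \<alpha> \<Psi> \<open>topspace T = UNIV\<close>
    by (auto simp: power_series_model_def power_series_model_axioms_def)
  have "\<exists>F. star_subalgebra F \<and> complemented F \<and> (\<forall>x\<in>F. extends_to_bounded x) \<and>
      star_algebra_isomorphic sc star T F" if betaDN: "betaDN_algebra sc star T"
  proof -
    obtain B where B: "scalar_product sc B" "dominating_norm sc T (hilbert_norm B)"
      and mult: "\<forall>x y z. B (x * y) z = B y (star x * z)"
      and bounded: "\<forall>x. \<exists>C>0. \<forall>y. hilbert_norm B (x * y) \<le> C * hilbert_norm B y"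
      using betaDN unfolding betaDN_algebra_def by blast
    show ?thesis
      by (rule betaDN_imp_complemented_subalgebra[OF assms(1)
            dominated_modelI[OF model B \<alpha>(2) assms(3)]])
        (use mult bounded in blast)+
  qed
  moreover have "betaDN_algebra sc star T"
    if "star_subalgebra F" "\<forall>x\<in>F. extends_to_bounded x" "star_algebra_isomorphic sc star T F" for F
    using bounded_subalgebra_imp_betaDN[OF model that] .
  ultimately show ?thesis
    using complemented_imp_closedin by blast
qed

end
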